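(* Let $C_n$ denote the cycle on $n$ vertices with $n\ge 4$, and let $2\le k\le \lfloor\frac{n}{2}\rfloor$ be an integer. Then $$\operatorname{depth}\bigl(R/I(C_n)^{[k]}\bigr)\ge \left\lceil\frac{n}{3}\right\rceil+k-1.$$
   Context: All graphs are finite and simple. Fix a field $\mathbb{K}$. For a graph $G$ with vertex set $V(G)$ (vertices are identified with indeterminates), $R=\mathbb{K}[x\mid x\in V(G)]$ and $I(G)=\langle xy\mid \{x,y\}\in E(G)\rangle\subseteq R$ is the edge ideal. A $k$-matching of $G$ is a set of $k$ pairwise disjoint edges. The $k$-th square-free power $I(G)^{[k]}$ is the ideal of $R$ generated by the square-free monomials of $I(G)^k$; equivalently it is generated by the products $\prod_{x\in \bigcup_{e\in M}e}x$ over all $k$-matchings $M$ of $G$. The cycle $C_n$ has vertices $x_1,\dots,x_n$ and edges $\{x_i,x_{i+1}\}$ for $1\le i\le n-1$ and $\{x_1,x_n\}$; here $R=\mathbb{K}[x_1,\dots,x_n]$. *)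

theory Defs
  imports
    "Graph_Theory.Pair_Digraph"
    "HOL-Library.Poly_Mapping"
    "HOL-Library.Extended_Nat"
    "HOL-Algebra.Module"
    "HOL-Algebra.QuotRing"
    "HOL-Algebra.Ideal_Product"
begin

section \<open>Polynomial rings\<close>

text \<open>
  The type \<open>('v \<Rightarrow>\<^sub>0 nat) \<Rightarrow>\<^sub>0 'k\<close> is the polynomial ring over \<open>'k\<close> in all elements of \<open>'v\<close> as
  indeterminates. The ring \<open>K[x | x \<in> V]\<close> is the subring of the polynomials in which only
  indeterminates from \<open>V\<close> occur.
\<close>

type_synonym ('v, 'k) mvpoly = "('v \<Rightarrow>\<^sub>0 nat) \<Rightarrow>\<^sub>0 'k"

definition poly_ring :: "'v set \<Rightarrow> ('v, 'k::comm_ring_1) mvpoly ring" where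
  "poly_ring V = \<lparr>carrier = {p. \<forall>t \<in> Poly_Mapping.keys p. Poly_Mapping.keys t \<subseteq> V},
     mult = (*), one = 1, zero = 0, add = (+)\<rparr>"

definition indet :: "'v \<Rightarrow> ('v, 'k::comm_ring_1) mvpoly" where
  "indet v = Poly_Mapping.single (Poly_Mapping.single v 1) 1"

definition irrelevant_ideal :: "'v set \<Rightarrow> ('v, 'k::comm_ring_1) mvpoly set" where
  "irrelevant_ideal V = Idl\<^bsub>poly_ring V\<^esub> (indet ` V)"

lemma poly_ring_cring: "cring (poly_ring V :: ('v, 'k::comm_ring_1) mvpoly ring)"
proof -
  let ?R = "poly_ring V :: ('v, 'k) mvpoly ring"
  have mult: "p * q \<in> carrier ?R" if "p \<in> carrier ?R" "q \<in> carrier ?R" for p q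
    using that keys_mult[of p q] by (fastforce simp: poly_ring_def dest: subsetD[OF keys_add])
  have add: "p + q \<in> carrier ?R" if "p \<in> carrier ?R" "q \<in> carrier ?R" for p q
    using that keys_add[of p q] by (auto simp: poly_ring_def)
  have uminus: "- p \<in> carrier ?R" if "p \<in> carrier ?R" for p
    using that by (simp add: poly_ring_def)
  have sel: "x \<otimes>\<^bsub>?R\<^esub> y = x * y" "x \<oplus>\<^bsub>?R\<^esub> y = x + y" "\<one>\<^bsub>?R\<^esub> = 1" "\<zero>\<^bsub>?R\<^esub> = 0" for x y
    by (simp_all add: poly_ring_def)
  have closed: "0 \<in> carrier ?R" "1 \<in> carrier ?R"
    by (simp_all add: poly_ring_def)
  have "abelian_group ?R"
    by (rule abelian_groupI)
      (auto simp: sel closed add_ac intro: add uminus bexI[of _ "- x" for x])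
  moreover have "Group.comm_monoid ?R"
    by (rule Group.comm_monoidI) (auto simp: sel closed mult_ac intro: mult)
  ultimately show ?thesis
    by (rule cringI) (simp add: sel distrib_right)
qed


section \<open>Edge ideals and square-free powers\<close>

text \<open>
  A graph is a symmetric loop-free digraph (\<^locale>\<open>pair_graph\<close>); an edge \<open>{u, v}\<close> is the pair of
  arcs \<open>(u, v)\<close> and \<open>(v, u)\<close>.
\<close>

definition cycle_graph :: "nat \<Rightarrow> nat pair_pre_digraph" where
  "cycle_graph n =
     (let A = {(i, i + 1) | i. 1 \<le> i \<and> i \<le> n - 1} \<union> {(1, n)}
      in \<lparr>pverts = {1..n}, parcs = A \<union> A\<inverse>\<rparr>)"

lemma pair_graph_cycle_graph:
  assumes "n \<ge> 3"
  shows "pair_graph (cycle_graph n)"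
proof -
  have "{(i, i + 1) | i. 1 \<le> i \<and> i \<le> n - 1} \<subseteq> {1..n} \<times> {1..n}"
    using assms by auto
  then have fin: "finite {(i, i + 1) | i. 1 \<le> i \<and> i \<le> n - 1}"
    by (rule finite_subset) simp
  show ?thesis
    by unfold_locales
      (use fin assms in \<open>auto simp: cycle_graph_def Let_def symmetric_def
        arcs_ends_def arc_to_ends_def intro!: symI\<close>)
qed

definition edge_ideal :: "'v pair_pre_digraph \<Rightarrow> ('v, 'k::comm_ring_1) mvpoly set" where
  "edge_ideal G = Idl\<^bsub>poly_ring (pverts G)\<^esub> {indet u * indet v | u v. (u, v) \<in> parcs G}"

text \<open>The power in the definition below is the power of ideals.\<close>

definition squarefree_power ::
  "'v set \<Rightarrow> ('v, 'k::comm_ring_1) mvpoly set \<Rightarrow> nat \<Rightarrow> ('v, 'k) mvpoly set" where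
  "squarefree_power V I k = Idl\<^bsub>poly_ring V\<^esub>
     ({Poly_Mapping.single t 1 | t. \<forall>v. Poly_Mapping.lookup t v \<le> 1} \<inter>
      I [^]\<^bsub>ideals_set (poly_ring V)\<^esub> k)"


section \<open>Depth\<close>

definition quotient_module :: "('a, 'c) ring_scheme \<Rightarrow> 'a set \<Rightarrow> ('a, 'a set) module" where
  "quotient_module R I =
     \<lparr>carrier = carrier (R Quot I), mult = mult (R Quot I), one = \<one>\<^bsub>R Quot I\<^esub>,
      zero = \<zero>\<^bsub>R Quot I\<^esub>, add = add (R Quot I),
      smult = (\<lambda>a X. (I +>\<^bsub>R\<^esub> a) \<otimes>\<^bsub>R Quot I\<^esub> X)\<rparr>"

lemma quotient_module_module:
  assumes "cring R" "ideal I R"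
  shows "module R (quotient_module R I)"
proof -
  interpret cring R by fact
  interpret I: ideal I R by fact
  interpret Q: ring "R Quot I" by (rule I.quotient_is_ring)
  interpret h: ring_hom_ring R "R Quot I" "(+>\<^bsub>R\<^esub>) I" by (rule I.rcos_ring_hom_ring)
  have "abelian_group (quotient_module R I)"
    by (rule abelian_groupI)
      (auto simp: quotient_module_def Q.a_ac intro: Q.add.l_inv_ex)
  then show ?thesis
    by (intro moduleI \<open>cring R\<close>)
      (simp_all add: quotient_module_def Q.l_distr Q.r_distr Q.m_assoc)
qed

text \<open>The submodule \<open>S M\<close> of \<open>M\<close> generated by all products \<open>a m\<close> with \<open>a \<in> S\<close> and \<open>m \<in> M\<close>.\<close>

definition smult_submodule ::
  "('a, 'c) ring_scheme \<Rightarrow> 'a set \<Rightarrow> ('a, 'b, 'd) module_scheme \<Rightarrow> 'b set" where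
  "smult_submodule R S M =
     \<Inter> {N. submodule N R M \<and> (\<forall>a \<in> S. \<forall>m \<in> carrier M. a \<odot>\<^bsub>M\<^esub> m \<in> N)}"

text \<open>
  \<open>M\<close>-regular sequences: each \<open>f\<^sub>i\<close> is a non-zero-divisor on \<open>M / (f\<^sub>1, \<dots>, f\<^sub>i\<^sub>-\<^sub>1) M\<close>, and
  \<open>M \<noteq> (f\<^sub>1, \<dots>, f\<^sub>r) M\<close>. That multiplication by \<open>f\<^sub>i\<close> is injective on the quotient is expressed on
  representatives in \<open>M\<close>.
\<close>

definition regular_seq ::
  "('a, 'c) ring_scheme \<Rightarrow> ('a, 'b, 'd) module_scheme \<Rightarrow> 'a list \<Rightarrow> bool" where
  "regular_seq R M fs \<longleftrightarrow>
     set fs \<subseteq> carrier R \<and>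
     (\<forall>i < length fs. \<forall>m \<in> carrier M.
        (fs ! i) \<odot>\<^bsub>M\<^esub> m \<in> smult_submodule R (set (take i fs)) M \<longrightarrow>
        m \<in> smult_submodule R (set (take i fs)) M) \<and>
     smult_submodule R (set fs) M \<noteq> carrier M"

text \<open>
  The depth of \<open>M\<close> with respect to an ideal \<open>J\<close> (also called the grade of \<open>J\<close> on \<open>M\<close>), with the
  usual convention that it is infinite if \<open>J M = M\<close>. Over \<open>K[x | x \<in> V]\<close>, the depth of a finitely
  generated graded module is taken with respect to the ideal generated by \<open>V\<close>.
\<close>

definition depth ::
  "('a, 'c) ring_scheme \<Rightarrow> 'a set \<Rightarrow> ('a, 'b, 'd) module_scheme \<Rightarrow> enat" where
  "depth R J M =
     (if smult_submodule R J M = carrier M then \<infinity>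
      else Sup {enat (length fs) | fs. set fs \<subseteq> J \<and> regular_seq R M fs})"

end

theory Submission
  imports Defs
begin

text \<open>
  The Stanley-Reisner complex of \<open>I(C\<^sub>n)\<^bsup>[k]\<^esup>\<close> consists of the vertex sets \<open>F\<close> without a \<open>k\<close>-matching. The
  sequence \<open>e\<^sub>1, \<dots>, e\<^sub>r\<close> of elementary symmetric polynomials in all indeterminates is regular on every
  polynomial ring \<open>K[B]\<close> with \<open>B\<close> of size at least \<open>r\<close>, and for a fixed sequence weak regularity passes from
  the ends of a short exact sequence to its middle. So it suffices to decompose the complex, by
  successive splits into the faces containing and those not containing a given set, into intervals \<open>[A, B]\<close>
  with \<open>B\<close> of size at least \<open>r = \<lceil>n/3\<rceil> + k - 1\<close>.

  For paths such a decomposition arises from scanning the vertices along the greedy matching. For the cycle,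
  one first splits along the edges \<open>{1, 2}\<close>, \<open>{2, 3}\<close>, \<dots> until the first \<open>n + 1 - 2k\<close> vertices span no
  edge of a face. Deleting a vertex of the cycle at once would not do: the complex of a path
  with \<open>n - 1\<close> vertices has too small a depth if \<open>n \<equiv> 1\<close> modulo 3.
\<close>

section \<open>Filtering monomials and elementary symmetric polynomials\<close>

text \<open>Why the size of B is all that counts: the span of the monomials with support in [A, B]
  is a monomial times K[B]. The l-th elementary symmetric polynomial in all indeterminates acts on
  it as the one in B, since the terms with an indeterminate outside B are discarded. The constants,
  with j = k - 1: on a path with m vertices an edge put into the face gains two vertices of B and
  lowers the allowed matching number by one, while the remaining choices gain one vertex per three
  positions. This gives ceil(m/3) + j, which for m = n - 1 is one less than required if n is 1
  modulo 3. An edge forced into a face of the cycle makes up for it, because next to it a vertex is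
  out: 2 + ceil((n-3)/3) + (j-1) = ceil(n/3) + j. The splits stop at n + 1 - 2k = n - 1 - 2j
  vertices because the other 2j + 1 vertices are too few for j + 1 disjoint edges. They can be
  chosen freely once they are detached from the edge-free part. The count at this last stage is
  where k >= 2 enters: for k = 1 its inequality fails if n is 1 modulo 3.\<close>

definition pfilter :: "('a \<Rightarrow> bool) \<Rightarrow> ('a \<Rightarrow>\<^sub>0 'b::zero) \<Rightarrow> ('a \<Rightarrow>\<^sub>0 'b)" where
  "pfilter P p = Abs_poly_mapping (\<lambda>t. Poly_Mapping.lookup p t when P t)"

lemma lookup_pfilter: "Poly_Mapping.lookup (pfilter P p) t = (if P t then Poly_Mapping.lookup p t else 0)"
proof -
  have "finite {t. (Poly_Mapping.lookup p t when P t) \<noteq> 0}"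
    by (rule finite_subset[OF _ finite_lookup[of p]]) auto
  then show ?thesis by (simp add: pfilter_def)
qed

lemma keys_pfilter: "Poly_Mapping.keys (pfilter P p) = {t \<in> Poly_Mapping.keys p. P t}"
  by (auto simp: in_keys_iff lookup_pfilter split: if_splits)

lemma pfilter_add: "pfilter P (p + q) = pfilter P p + pfilter P (q :: _ \<Rightarrow>\<^sub>0 'b::comm_monoid_add)"
  by (rule poly_mapping_eqI) (simp add: lookup_pfilter lookup_add)

lemma pfilter_diff: "pfilter P (p - q) = pfilter P p - pfilter P (q :: _ \<Rightarrow>\<^sub>0 'b::ab_group_add)"
  by (rule poly_mapping_eqI) (simp add: lookup_pfilter lookup_minus)

lemma pfilter_zero [simp]: "pfilter P 0 = 0"
  by (rule poly_mapping_eqI) (simp add: lookup_pfilter)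

lemma pfilter_sum: "pfilter P (sum f A) = (\<Sum>a\<in>A. pfilter P (f a :: _ \<Rightarrow>\<^sub>0 'b::comm_monoid_add))"
  by (induction A rule: infinite_finite_induct) (simp_all add: pfilter_add)

lemma pfilter_eq_0_iff: "pfilter P p = 0 \<longleftrightarrow> (\<forall>t\<in>Poly_Mapping.keys p. \<not> P t)"
proof
  assume "pfilter P p = 0"
  then show "\<forall>t\<in>Poly_Mapping.keys p. \<not> P t"
    using keys_pfilter[of P p] by auto
next
  assume *: "\<forall>t\<in>Poly_Mapping.keys p. \<not> P t"
  show "pfilter P p = 0"
  proof (rule poly_mapping_eqI)
    show "Poly_Mapping.lookup (pfilter P p) t = Poly_Mapping.lookup 0 t" for t
      using * by (cases "t \<in> Poly_Mapping.keys p") (auto simp: lookup_pfilter in_keys_iff)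
  qed
qed

lemma pfilter_id_iff: "pfilter P p = p \<longleftrightarrow> (\<forall>t\<in>Poly_Mapping.keys p. P t)"
proof
  assume "pfilter P p = p"
  then show "\<forall>t\<in>Poly_Mapping.keys p. P t"
    using keys_pfilter[of P p] by auto
next
  assume *: "\<forall>t\<in>Poly_Mapping.keys p. P t"
  show "pfilter P p = p"
  proof (rule poly_mapping_eqI)
    show "Poly_Mapping.lookup (pfilter P p) t = Poly_Mapping.lookup p t" for t
      using * by (cases "t \<in> Poly_Mapping.keys p") (auto simp: lookup_pfilter in_keys_iff)
  qed
qed

lemma pfilter_pfilter: "pfilter P (pfilter Q p) = pfilter (\<lambda>t. P t \<and> Q t) p"
  by (rule poly_mapping_eqI) (simp add: lookup_pfilter)

lemma pfilter_single: "pfilter P (Poly_Mapping.single t c) = (if P t then Poly_Mapping.single t c else 0)"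
  by (rule poly_mapping_eqI) (auto simp: lookup_pfilter lookup_single when_def)

lemma lookup_single_times:
  "Poly_Mapping.lookup (Poly_Mapping.single s c * p) (s + t) = c * Poly_Mapping.lookup p t"
  for p :: "('v, 'k::comm_ring_1) mvpoly"
proof -
  have "Poly_Mapping.lookup (Poly_Mapping.single s c * p) (s + t)
      = (\<Sum>q. (c * Poly_Mapping.lookup p q) when s + t = s + q)"
    by (simp add: lookup_mult lookup_single when_mult mult_when)
  also have "\<dots> = c * Poly_Mapping.lookup p t"
    by simp
  finally show ?thesis .
qed

lemma single_one_times_cancel:
  fixes p q :: "('v, 'k::comm_ring_1) mvpoly"
  assumes "Poly_Mapping.single s 1 * p = Poly_Mapping.single s 1 * q"
  shows "p = q"
  by (rule poly_mapping_eqI) (metis assms lookup_single_times mult_1)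

lemma keys_times_obtain:
  fixes p q :: "('v, 'k::comm_ring_1) mvpoly"
  assumes "u \<in> Poly_Mapping.keys (p * q)"
  obtains s t where "s \<in> Poly_Mapping.keys p" "t \<in> Poly_Mapping.keys q" "u = s + t"
  using keys_mult[of p q] assms by auto

lemma keys_plus_nat: "Poly_Mapping.keys (s + t) = Poly_Mapping.keys s \<union> Poly_Mapping.keys (t :: 'v \<Rightarrow>\<^sub>0 nat)"
  by (auto simp: in_keys_iff lookup_add)

text \<open>Homogeneous components, \<open>pres\<close> and \<open>restr\<close> are all instances
  of \<open>pfilter\<close>; this rule moves each of them past a monomial, at the price of
  translating the predicate by the exponent \<open>s\<close>.\<close>

lemma pfilter_single_times:
  fixes p :: "('v, 'k::comm_ring_1) mvpoly"
  shows "pfilter P (Poly_Mapping.single s c * p) = Poly_Mapping.single s c * pfilter (\<lambda>t. P (s + t)) p"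
proof -
  let ?m = "Poly_Mapping.single s c" and ?Q = "\<lambda>t. P (s + t)"
  have split: "p = pfilter ?Q p + pfilter (\<lambda>t. \<not> ?Q t) p"
    by (rule poly_mapping_eqI) (simp add: lookup_pfilter lookup_add)
  have *: "\<exists>t\<in>Poly_Mapping.keys q. u = s + t"
    if u: "u \<in> Poly_Mapping.keys (?m * q)" for u and q :: "('v, 'k) mvpoly"
  proof -
    obtain s' t where "s' \<in> Poly_Mapping.keys ?m" "t \<in> Poly_Mapping.keys q" "u = s' + t"
      using u by (rule keys_times_obtain)
    then show ?thesis by (cases "c = 0") auto
  qed
  have 1: "pfilter P (?m * pfilter ?Q p) = ?m * pfilter ?Q p"
    unfolding pfilter_id_iff by (auto dest!: * simp: keys_pfilter)
  have 2: "pfilter P (?m * pfilter (\<lambda>t. \<not> ?Q t) p) = 0"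
    unfolding pfilter_eq_0_iff by (auto dest!: * simp: keys_pfilter)
  have "pfilter P (?m * p) = pfilter P (?m * pfilter ?Q p) + pfilter P (?m * pfilter (\<lambda>t. \<not> ?Q t) p)"
    by (subst split) (simp only: distrib_left pfilter_add)
  with 1 2 show ?thesis by simp
qed

lemma pfilter_eqI:
  fixes p q :: "_ \<Rightarrow>\<^sub>0 'b::ab_group_add"
  assumes "\<And>t. t \<in> Poly_Mapping.keys (p - q) \<Longrightarrow> \<not> P t"
  shows "pfilter P p = pfilter P q"
  using assms pfilter_eq_0_iff[of P "p - q"] by (simp add: pfilter_diff)

section \<open>Square-free monomials, degree, elementary symmetric polynomials\<close>

definition smono :: "'v set \<Rightarrow> 'v \<Rightarrow>\<^sub>0 nat" where
  "smono S = (\<Sum>v\<in>S. Poly_Mapping.single v 1)"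

lemma lookup_smono: "finite S \<Longrightarrow> Poly_Mapping.lookup (smono S) v = (if v \<in> S then 1 else 0)"
  by (auto simp: smono_def lookup_sum lookup_single when_def)

lemma keys_smono [simp]: "finite S \<Longrightarrow> Poly_Mapping.keys (smono S) = S"
  by (simp add: set_eq_iff in_keys_iff lookup_smono)

lemma smono_empty [simp]: "smono {} = 0"
  by (simp add: smono_def)

lemma smono_insert: "finite S \<Longrightarrow> v \<notin> S \<Longrightarrow> smono (insert v S) = Poly_Mapping.single v 1 + smono S"
  by (simp add: smono_def)

definition total_degree :: "('v \<Rightarrow>\<^sub>0 nat) \<Rightarrow> nat" where
  "total_degree t = (\<Sum>v\<in>Poly_Mapping.keys t. Poly_Mapping.lookup t v)"

lemma total_degree_add: "total_degree (s + t) = total_degree s + total_degree t"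
proof -
  let ?K = "Poly_Mapping.keys s \<union> Poly_Mapping.keys t"
  have *: "total_degree u = (\<Sum>v\<in>?K. Poly_Mapping.lookup u v)" if "Poly_Mapping.keys u \<subseteq> ?K" for u
    unfolding total_degree_def using that
    by (intro sum.mono_neutral_left) (auto simp: in_keys_iff)
  show ?thesis
    by (simp add: * keys_plus_nat lookup_add sum.distrib)
qed

lemma total_degree_smono: "finite S \<Longrightarrow> total_degree (smono S) = card S"
  by (simp add: total_degree_def lookup_smono)

lemma total_degree_single [simp]: "total_degree (Poly_Mapping.single v n) = n"
  by (cases "n = 0") (simp_all add: total_degree_def)

definition esym :: "nat \<Rightarrow> 'v set \<Rightarrow> ('v, 'k::comm_ring_1) mvpoly" where
  "esym l B = (\<Sum>S | S \<subseteq> B \<and> card S = l. Poly_Mapping.single (smono S) 1)"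

lemma esym_0 [simp]: "finite B \<Longrightarrow> esym 0 B = 1"
proof -
  assume "finite B"
  then have "S = {}" if "S \<subseteq> B" "card S = 0" for S
    using that finite_subset[of S B] by simp
  then have "{S. S \<subseteq> B \<and> card S = 0} = {{}}"
    by auto
  then show ?thesis by (simp add: esym_def)
qed

lemma esym_card: "finite B \<Longrightarrow> esym (card B) B = Poly_Mapping.single (smono B) 1"
proof -
  assume "finite B"
  then have "{S. S \<subseteq> B \<and> card S = card B} = {B}"
    using card_subset_eq by blast
  then show ?thesis by (simp add: esym_def)
qed

text \<open>Subsets are sorted by whether they contain \<open>y\<close>. Modulo \<open>y\<close>
  this turns \<open>esym (Suc l) (insert y B)\<close> into \<open>esym (Suc l) B\<close>, which
  drives the induction on the size of the set in \<open>esym_regular\<close>.\<close>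

lemma esym_insert:
  assumes "finite B" "y \<notin> B"
  shows "esym (Suc l) (insert y B)
    = esym (Suc l) B + indet y * (esym l B :: ('v, 'k::comm_ring_1) mvpoly)"
proof -
  have *: "{S. S \<subseteq> insert y B \<and> card S = Suc l}
      = {S. S \<subseteq> B \<and> card S = Suc l} \<union> insert y ` {S. S \<subseteq> B \<and> card S = l}" (is "?L = ?R1 \<union> ?R2")
  proof (intro equalityI subsetI)
    fix S assume S: "S \<in> ?L"
    show "S \<in> ?R1 \<union> ?R2"
    proof (cases "y \<in> S")
      case True
      then have "S = insert y (S - {y})" "S - {y} \<subseteq> B" "card (S - {y}) = l"
        using S assms by (auto dest: finite_subset)
      then show ?thesis by blast
    qed (use S in auto)
  next
    fix S assume "S \<in> ?R1 \<union> ?R2"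
    then show "S \<in> ?L"
    proof
      assume "S \<in> ?R2"
      then obtain T where T: "S = insert y T" "T \<subseteq> B" "card T = l" by auto
      then have "finite T" "y \<notin> T" using assms finite_subset by auto
      with T show ?thesis by auto
    qed auto
  qed
  have inj: "inj_on (insert y) {S. S \<subseteq> B \<and> card S = l}"
    using assms(2) by (auto simp: inj_on_def)
  have "esym (Suc l) (insert y B) = esym (Suc l) B
    + (\<Sum>S\<in>insert y ` {S. S \<subseteq> B \<and> card S = l}. Poly_Mapping.single (smono S) (1::'k))"
    unfolding esym_def * using assms by (intro sum.union_disjoint) auto
  also have "(\<Sum>S\<in>insert y ` {S. S \<subseteq> B \<and> card S = l}. Poly_Mapping.single (smono S) (1::'k))
      = indet y * esym l B"
    unfolding esym_def sum_distrib_left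
  proof (subst sum.reindex[OF inj], rule sum.cong, simp)
    fix S assume S: "S \<in> {S. S \<subseteq> B \<and> card S = l}"
    then have "finite S" "y \<notin> S"
      using assms finite_subset by auto
    then show "((\<lambda>S. Poly_Mapping.single (smono S) (1::'k)) \<circ> insert y) S
        = indet y * Poly_Mapping.single (smono S) 1"
      by (simp add: indet_def mult_single smono_insert)
  qed
  finally show ?thesis .
qed

text \<open>Setting all indeterminates outside \<open>W\<close> to zero.\<close>

definition pres :: "'v set \<Rightarrow> ('v, 'k::comm_ring_1) mvpoly \<Rightarrow> ('v, 'k) mvpoly" where
  "pres W = pfilter (\<lambda>t. Poly_Mapping.keys t \<subseteq> W)"

text \<open>The discarded terms span an ideal: once an exponent involves an indeterminate outside
  \<open>W\<close>, so does every multiple. Hence \<open>pres W\<close> is multiplicative.\<close>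

lemma pres_mult:
  fixes p q :: "('v, 'k::comm_ring_1) mvpoly"
  shows "pres W (p * q) = pres W p * pres W q"
proof -
  let ?P = "\<lambda>t. Poly_Mapping.keys t \<subseteq> W"
  have "pres W (p * q) = pres W (pres W p * pres W q)"
    unfolding pres_def
  proof (rule pfilter_eqI)
    fix t assume t: "t \<in> Poly_Mapping.keys (p * q - pfilter ?P p * pfilter ?P q)"
    have eq: "p * q - pfilter ?P p * pfilter ?P q
        = (p - pfilter ?P p) * q + pfilter ?P p * (q - pfilter ?P q)"
      by (simp add: algebra_simps)
    have k: "\<not> ?P s" if "s \<in> Poly_Mapping.keys (r - pfilter ?P r)" for s and r :: "('v, 'k) mvpoly"
      using that by (auto simp: in_keys_iff lookup_minus lookup_pfilter)
    have "t \<in> Poly_Mapping.keys ((p - pfilter ?P p) * q) \<or> t \<in> Poly_Mapping.keys (pfilter ?P p * (q - pfilter ?P q))"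
      using subsetD[OF keys_add t[unfolded eq]] by simp
    then show "\<not> ?P t"
    proof
      assume "t \<in> Poly_Mapping.keys ((p - pfilter ?P p) * q)"
      then obtain a b where "a \<in> Poly_Mapping.keys (p - pfilter ?P p)" "t = a + b"
        by (rule keys_times_obtain)
      with k[of a p] show ?thesis by (simp add: keys_plus_nat)
    next
      assume "t \<in> Poly_Mapping.keys (pfilter ?P p * (q - pfilter ?P q))"
      then obtain a b where "b \<in> Poly_Mapping.keys (q - pfilter ?P q)" "t = a + b"
        by (rule keys_times_obtain)
      with k[of b q] show ?thesis by (simp add: keys_plus_nat)
    qed
  qed
  also have "\<dots> = pres W p * pres W q"
    unfolding pres_def pfilter_id_iff
  proof
    fix t assume "t \<in> Poly_Mapping.keys (pfilter ?P p * pfilter ?P q)"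
    then obtain a b where "a \<in> Poly_Mapping.keys (pfilter ?P p)" "b \<in> Poly_Mapping.keys (pfilter ?P q)" "t = a + b"
      by (rule keys_times_obtain)
    then show "?P t" by (simp add: keys_plus_nat keys_pfilter)
  qed
  finally show ?thesis .
qed

lemma pres_add: "pres W (p + q) = pres W p + pres W q"
  by (simp add: pres_def pfilter_add)

lemma pres_sum: "pres W (sum f A) = (\<Sum>a\<in>A. pres W (f a))"
  by (simp add: pres_def pfilter_sum)

lemma pres_esym:
  assumes "finite B"
  shows "pres W (esym l B) = esym l (B \<inter> W)"
proof -
  have "pres W (esym l B)
      = (\<Sum>S | S \<subseteq> B \<and> card S = l. if S \<subseteq> W then Poly_Mapping.single (smono S) 1 else 0)"
    unfolding esym_def pres_def pfilter_sum
  proof (rule sum.cong)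
    fix S assume "S \<in> {S. S \<subseteq> B \<and> card S = l}"
    then have "finite S" using assms finite_subset by auto
    then show "pfilter (\<lambda>t. Poly_Mapping.keys t \<subseteq> W) (Poly_Mapping.single (smono S) 1)
        = (if S \<subseteq> W then Poly_Mapping.single (smono S) 1 else 0)"
      by (simp add: pfilter_single)
  qed simp
  also have "\<dots> = (\<Sum>S\<in>{S \<in> {S. S \<subseteq> B \<and> card S = l}. S \<subseteq> W}. Poly_Mapping.single (smono S) 1)"
    by (rule sum.inter_filter[symmetric]) (use assms in simp)
  also have "{S \<in> {S. S \<subseteq> B \<and> card S = l}. S \<subseteq> W} = {S. S \<subseteq> B \<inter> W \<and> card S = l}"
    by auto
  finally show ?thesis by (simp add: esym_def)
qed

lemma pfilter_esym_times:
  fixes p :: "('v, 'k::comm_ring_1) mvpoly"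
  assumes "finite B"
  shows "pfilter (\<lambda>t. total_degree t = d) (esym l B * p)
    = esym l B * pfilter (\<lambda>t. l + total_degree t = d) p"
  unfolding esym_def sum_distrib_right pfilter_sum
proof (rule sum.cong)
  fix S assume "S \<in> {S. S \<subseteq> B \<and> card S = l}"
  then have "total_degree (smono S) = l"
    using finite_subset[OF _ assms] by (auto simp: total_degree_smono)
  then show "pfilter (\<lambda>t. total_degree t = d) (Poly_Mapping.single (smono S) 1 * p)
      = Poly_Mapping.single (smono S) 1 * pfilter (\<lambda>t. l + total_degree t = d) p"
    by (simp add: pfilter_single_times total_degree_add)
qed simp

section \<open>Regularity of the elementary symmetric polynomials\<close>

text \<open>The index shift leaves out \<open>esym 0 B\<close>, which is 1 for finite
  \<open>B\<close>, so there are exactly \<open>i\<close> generators. The coefficients range over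
  polynomials in all indeterminates of the type; \<open>wreg_interval\<close> cuts down to K[B] by
  means of \<open>pres B\<close>.\<close>

definition esym_ideal :: "nat \<Rightarrow> 'v set \<Rightarrow> ('v, 'k::comm_ring_1) mvpoly set" where
  "esym_ideal i B = {\<Sum>l<i. esym (Suc l) B * q l |q. True}"

lemma esym_idealI: "p = (\<Sum>l<i. esym (Suc l) B * q l) \<Longrightarrow> p \<in> esym_ideal i B"
  by (auto simp: esym_ideal_def)

lemma esym_ideal_0 [simp]: "esym_ideal 0 B = {0}"
  by (auto simp: esym_ideal_def)

lemma esym_ideal_add:
  assumes "p \<in> esym_ideal i B" "q \<in> esym_ideal i B"
  shows "p + q \<in> esym_ideal i B"
proof -
  obtain f g where "p = (\<Sum>l<i. esym (Suc l) B * f l)" "q = (\<Sum>l<i. esym (Suc l) B * g l)"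
    using assms by (auto simp: esym_ideal_def)
  then show ?thesis
    by (intro esym_idealI[where q = "\<lambda>l. f l + g l"]) (simp add: distrib_left sum.distrib)
qed

lemma esym_ideal_mult:
  assumes "p \<in> esym_ideal i B"
  shows "r * p \<in> esym_ideal i B"
proof -
  obtain f where "p = (\<Sum>l<i. esym (Suc l) B * f l)"
    using assms by (auto simp: esym_ideal_def)
  then show ?thesis
    by (intro esym_idealI[where q = "\<lambda>l. r * f l"]) (simp add: sum_distrib_left mult.left_commute)
qed

lemma esym_ideal_diff:
  assumes "p \<in> esym_ideal i B" "q \<in> esym_ideal i B"
  shows "p - q \<in> esym_ideal i B"
  using esym_ideal_add[OF assms(1) esym_ideal_mult[OF assms(2), of "-1"]] by simp

lemma esym_ideal_zero [simp]: "0 \<in> esym_ideal i B"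
  by (rule esym_idealI[where q = "\<lambda>_. 0"]) simp

lemma esym_ideal_sum: "(\<And>a. a \<in> A \<Longrightarrow> f a \<in> esym_ideal i B) \<Longrightarrow> sum f A \<in> esym_ideal i B"
  by (induction A rule: infinite_finite_induct) (auto intro: esym_ideal_add)

lemma esym_ideal_Suc_iff:
  "p \<in> esym_ideal (Suc i) B \<longleftrightarrow> (\<exists>a q. a \<in> esym_ideal i B \<and> p = a + esym (Suc i) B * q)"
proof
  assume "p \<in> esym_ideal (Suc i) B"
  then obtain f where "p = (\<Sum>l<i. esym (Suc l) B * f l) + esym (Suc i) B * f i"
    by (auto simp: esym_ideal_def)
  then show "\<exists>a q. a \<in> esym_ideal i B \<and> p = a + esym (Suc i) B * q"
    using esym_idealI[OF refl] by blast
next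
  assume "\<exists>a q. a \<in> esym_ideal i B \<and> p = a + esym (Suc i) B * q"
  then obtain f q where "p = (\<Sum>l<i. esym (Suc l) B * f l) + esym (Suc i) B * q"
    by (auto simp: esym_ideal_def)
  then show "p \<in> esym_ideal (Suc i) B"
    by (intro esym_idealI[where q = "f(i := q)"]) simp
qed

lemma pres_esym_ideal:
  assumes "finite B" "p \<in> esym_ideal i B"
  shows "pres W p \<in> esym_ideal i (B \<inter> W)"
proof -
  obtain f where "p = (\<Sum>l<i. esym (Suc l) B * f l)"
    using assms by (auto simp: esym_ideal_def)
  then show ?thesis
    by (intro esym_idealI[where q = "\<lambda>l. pres W (f l)"])
      (simp add: pres_sum pres_mult pres_esym[OF assms(1)])
qed

lemma pfilter_esym_ideal:
  assumes "finite B" "p \<in> esym_ideal i B"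
  shows "pfilter (\<lambda>t. total_degree t = d) p \<in> esym_ideal i B"
proof -
  obtain f where "p = (\<Sum>l<i. esym (Suc l) B * f l)"
    using assms by (auto simp: esym_ideal_def)
  then show ?thesis
    by (intro esym_idealI[where q = "\<lambda>l. pfilter (\<lambda>t. Suc l + total_degree t = d) (f l)"])
      (simp only: pfilter_sum pfilter_esym_times[OF assms(1)])
qed

lemma indet_quotient:
  fixes p :: "('v, 'k::comm_ring_1) mvpoly"
  obtains q where "p = pres (- {y}) p + indet y * q"
proof -
  let ?T = "{t \<in> Poly_Mapping.keys p. y \<in> Poly_Mapping.keys t}"
  let ?q = "\<Sum>t\<in>?T. Poly_Mapping.single (t - Poly_Mapping.single y 1) (Poly_Mapping.lookup p t)"
  have sub: "Poly_Mapping.single y 1 + (t - Poly_Mapping.single y 1) = t" if "y \<in> Poly_Mapping.keys t"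
    for t :: "'v \<Rightarrow>\<^sub>0 nat"
    by (rule poly_mapping_eqI)
      (use that in \<open>auto simp: lookup_add lookup_minus lookup_single when_def in_keys_iff\<close>)
  have "indet y * ?q = (\<Sum>t\<in>?T. Poly_Mapping.single t (Poly_Mapping.lookup p t))"
    unfolding sum_distrib_left by (rule sum.cong) (auto simp: indet_def mult_single sub[simplified])
  also have "\<dots> = p - pres (- {y}) p"
  proof (rule poly_mapping_eqI)
    fix t
    show "Poly_Mapping.lookup (\<Sum>t\<in>?T. Poly_Mapping.single t (Poly_Mapping.lookup p t)) t
        = Poly_Mapping.lookup (p - pres (- {y}) p) t"
      by (simp add: lookup_sum lookup_single when_def lookup_minus pres_def lookup_pfilter in_keys_iff
          subset_Compl_singleton)
  qed
  finally have "p = pres (- {y}) p + indet y * ?q" by simp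
  then show ?thesis by (rule that)
qed

lemma indet_mult_cancel: "indet y * p = indet y * q \<Longrightarrow> p = q"
  unfolding indet_def by (rule single_one_times_cancel)

text \<open>By \<open>esym_insert\<close>, replacing the generators in \<open>B - {y}\<close> by
  those in \<open>B\<close> changes an element by a multiple of \<open>y\<close> only. So membership
  modulo \<open>y\<close> lifts to membership up to a multiple of \<open>y\<close>.\<close>

lemma esym_ideal_lift:
  fixes p :: "('v, 'k::comm_ring_1) mvpoly"
  assumes "finite B" "y \<in> B" "pres (- {y}) p \<in> esym_ideal i (B - {y})"
  obtains a q where "a \<in> esym_ideal i B" "p = a + indet y * q"
proof -
  obtain q where q: "p = pres (- {y}) p + indet y * q"
    by (rule indet_quotient)
  obtain f where f: "pres (- {y}) p = (\<Sum>l<i. esym (Suc l) (B - {y}) * f l)"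
    using assms(3) by (auto simp: esym_ideal_def)
  have e: "esym (Suc l) B = esym (Suc l) (B - {y}) + indet y * (esym l (B - {y}) :: ('v, 'k) mvpoly)" for l
    using esym_insert[of "B - {y}" y l] assms by (simp add: insert_absorb)
  let ?a = "\<Sum>l<i. esym (Suc l) B * f l"
  have "p = ?a + indet y * (q - (\<Sum>l<i. esym l (B - {y}) * f l))"
    by (subst q) (simp add: f e sum.distrib distrib_right right_diff_distrib sum_distrib_left mult.assoc)
  then show ?thesis by (rule that[rotated]) (rule esym_idealI[OF refl])
qed

lemma homogeneous_decomposition:
  fixes p :: "('v, 'k::comm_ring_1) mvpoly"
  obtains D where "finite D" "p = (\<Sum>d\<in>D. pfilter (\<lambda>t. total_degree t = d) p)"
proof
  let ?D = "total_degree ` Poly_Mapping.keys p"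
  show "finite ?D" by simp
  show "p = (\<Sum>d\<in>?D. pfilter (\<lambda>t. total_degree t = d) p)"
    by (rule poly_mapping_eqI) (auto simp: lookup_sum lookup_pfilter in_keys_iff image_iff)
qed

text \<open>
  Regularity of a homogeneous sequence does not depend on its order. Here \<open>y\<close> is moved
  to the front, because modulo \<open>y\<close> the polynomials \<open>e\<^sub>i(B)\<close> become \<open>e\<^sub>i(B - {y})\<close>. An annihilated \<open>p\<close> is then
  divisible by \<open>y\<close> modulo the ideal, which lowers its degree.
\<close>

lemma esym_regular_step:
  fixes p :: "('v, 'k::comm_ring_1) mvpoly"
  assumes "finite B" "y \<in> B"
    and IH: "\<And>q :: ('v, 'k) mvpoly. esym (Suc i) (B - {y}) * q \<in> esym_ideal i (B - {y})
      \<Longrightarrow> q \<in> esym_ideal i (B - {y})"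
    and y: "\<And>q :: ('v, 'k) mvpoly. indet y * q \<in> esym_ideal i B \<Longrightarrow> q \<in> esym_ideal i B"
    and p: "esym (Suc i) B * p \<in> esym_ideal i B"
  shows "p \<in> esym_ideal i B"
proof -
  have homogeneous: "h \<in> esym_ideal i B"
    if "esym (Suc i) B * h \<in> esym_ideal i B" "pfilter (\<lambda>t. total_degree t = d) h = h"
    for d and h :: "('v, 'k) mvpoly"
    using that
  proof (induction d arbitrary: h)
    case d: (0 h)
    have "esym (Suc i) (B - {y}) * pres (- {y}) h \<in> esym_ideal i (B - {y})"
      using pres_esym_ideal[OF assms(1) d(1), of "- {y}"]
      by (simp add: pres_mult pres_esym[OF assms(1)] Diff_eq)
    from IH[OF this] obtain a q where a: "a \<in> esym_ideal i B" "h = a + indet y * q"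
      by (rule esym_ideal_lift[OF assms(1,2)])
    \<comment> \<open>A multiple of \<open>y\<close> has no component of degree 0, so
      \<open>h\<close> is the degree 0 component of \<open>a\<close>.\<close>
    have "pfilter (\<lambda>t. total_degree t = 0) (indet y * q) = 0"
      by (simp add: indet_def pfilter_single_times total_degree_add pfilter_eq_0_iff[THEN iffD2])
    then have "h = pfilter (\<lambda>t. total_degree t = 0) a"
      using d(2) a(2) by (simp add: pfilter_add)
    with pfilter_esym_ideal[OF assms(1) a(1)] show ?case by simp
  next
    case d: (Suc d h)
    have "esym (Suc i) (B - {y}) * pres (- {y}) h \<in> esym_ideal i (B - {y})"
      using pres_esym_ideal[OF assms(1) d(2), of "- {y}"]
      by (simp add: pres_mult pres_esym[OF assms(1)] Diff_eq)
    from IH[OF this] obtain a q where a: "a \<in> esym_ideal i B" "h = a + indet y * q"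
      by (rule esym_ideal_lift[OF assms(1,2)])
    let ?a = "pfilter (\<lambda>t. total_degree t = Suc d) a" and ?q = "pfilter (\<lambda>t. total_degree t = d) q"
    have "pfilter (\<lambda>t. total_degree t = Suc d) (indet y * q) = indet y * ?q"
      by (simp add: indet_def pfilter_single_times total_degree_add)
    then have h: "h = ?a + indet y * ?q"
      using d(3) a(2) by (simp add: pfilter_add)
    have a': "?a \<in> esym_ideal i B"
      by (rule pfilter_esym_ideal[OF assms(1) a(1)])
    have "esym (Suc i) B * h - esym (Suc i) B * ?a \<in> esym_ideal i B"
      by (intro esym_ideal_diff esym_ideal_mult a' d(2))
    also have "esym (Suc i) B * h - esym (Suc i) B * ?a = indet y * (esym (Suc i) B * ?q)"
      by (subst (1) h) (simp add: algebra_simps)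
    finally have "esym (Suc i) B * ?q \<in> esym_ideal i B"
      by (rule y)
    then have "?q \<in> esym_ideal i B"
      by (rule d(1)) (simp add: pfilter_pfilter)
    then show ?case
      by (subst h) (intro esym_ideal_add esym_ideal_mult a')
  qed
  obtain D where D: "p = (\<Sum>d\<in>D. pfilter (\<lambda>t. total_degree t = d) p)"
    by (rule homogeneous_decomposition)
  have "pfilter (\<lambda>t. total_degree t = d) p \<in> esym_ideal i B" for d
  proof (rule homogeneous[where d = d])
    have "pfilter (\<lambda>t. total_degree t = Suc i + d) (esym (Suc i) B * p) \<in> esym_ideal i B"
      by (rule pfilter_esym_ideal[OF assms(1) p])
    then show "esym (Suc i) B * pfilter (\<lambda>t. total_degree t = d) p \<in> esym_ideal i B"
      by (simp add: pfilter_esym_times[OF assms(1)])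
  qed (simp add: pfilter_pfilter)
  then have "(\<Sum>d\<in>D. pfilter (\<lambda>t. total_degree t = d) p) \<in> esym_ideal i B"
    by (intro esym_ideal_sum)
  with D show ?thesis by simp
qed

text \<open>An exchange of two neighbours in a regular sequence. In
  \<open>indet y * p = a + esym (Suc i) B * z\<close>, reduction modulo \<open>y\<close> and
  \<open>IH\<close> give \<open>z = b + indet y * q\<close> with \<open>b\<close> in the smaller
  ideal. Then \<open>y\<close> times \<open>p - esym (Suc i) B * q\<close> lies in the smaller
  ideal, where \<open>y\<close> can be cancelled.\<close>

lemma indet_regular_step:
  fixes p :: "('v, 'k::comm_ring_1) mvpoly"
  assumes "finite B" "y \<in> B"
    and IH: "\<And>q :: ('v, 'k) mvpoly. esym (Suc i) (B - {y}) * q \<in> esym_ideal i (B - {y})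
      \<Longrightarrow> q \<in> esym_ideal i (B - {y})"
    and y: "\<And>q :: ('v, 'k) mvpoly. indet y * q \<in> esym_ideal i B \<Longrightarrow> q \<in> esym_ideal i B"
    and p: "indet y * p \<in> esym_ideal (Suc i) B"
  shows "p \<in> esym_ideal (Suc i) B"
proof -
  obtain a z where a: "a \<in> esym_ideal i B" "indet y * p = a + esym (Suc i) B * z"
    using p unfolding esym_ideal_Suc_iff by auto
  have "pres (- {y}) (indet y :: ('v, 'k) mvpoly) = 0"
    by (simp add: pres_def indet_def pfilter_single)
  then have "pres (- {y}) (a + esym (Suc i) B * z) = 0"
    using a(2) pres_mult[of "- {y}" "indet y" p] by simp
  then have "pres (- {y}) a + esym (Suc i) (B - {y}) * pres (- {y}) z = 0"
    by (simp only: pres_add pres_mult pres_esym[OF assms(1)] Diff_eq)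
  then have neg: "- pres (- {y}) a = esym (Suc i) (B - {y}) * pres (- {y}) z"
    by (rule minus_unique)
  have "- pres (- {y}) a \<in> esym_ideal i (B - {y})"
    using esym_ideal_mult[OF pres_esym_ideal[OF assms(1) a(1), of "- {y}"], of "-1"]
    by (simp add: Diff_eq)
  then have "pres (- {y}) z \<in> esym_ideal i (B - {y})"
    unfolding neg by (rule IH)
  then obtain b q where b: "b \<in> esym_ideal i B" "z = b + indet y * q"
    by (rule esym_ideal_lift[OF assms(1,2)])
  have "indet y * (p - esym (Suc i) B * q) = a + esym (Suc i) B * b"
    using a(2) b(2) by (simp add: algebra_simps)
  also have "\<dots> \<in> esym_ideal i B"
    by (intro esym_ideal_add esym_ideal_mult a b)
  finally have "p - esym (Suc i) B * q \<in> esym_ideal i B"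
    by (rule y)
  then show ?thesis
    unfolding esym_ideal_Suc_iff by (intro exI[of _ "p - esym (Suc i) B * q"] exI[of _ q]) simp
qed

text \<open>Serves the last elementary symmetric polynomial of a finite set, which is the product of
  all its indeterminates: these are cancelled one by one.\<close>

lemma smono_regular:
  fixes p :: "('v, 'k::comm_ring_1) mvpoly"
  assumes "finite S"
    and "\<And>y q. y \<in> S \<Longrightarrow> indet y * q \<in> J \<Longrightarrow> q \<in> J"
    and "Poly_Mapping.single (smono S) 1 * p \<in> J"
  shows "p \<in> J"
  using assms
proof (induction S arbitrary: p rule: finite_induct)
  case (insert x S)
  have "Poly_Mapping.single (smono (insert x S)) (1::'k) = indet x * Poly_Mapping.single (smono S) 1"
    using insert.hyps by (simp add: smono_insert indet_def mult_single)
  then have "indet x * (Poly_Mapping.single (smono S) 1 * p) \<in> J"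
    using insert.prems(2) by (simp only: mult.assoc)
  then have *: "Poly_Mapping.single (smono S) 1 * p \<in> J"
    by (rule insert.prems(1)[OF insertI1])
  show ?case
    by (rule insert.IH[OF insert.prems(1)[OF insertI2] *])
qed simp

text \<open>Induction on the size of \<open>B\<close>, say N + 1. An inner induction first shows
  that each \<open>y\<close> in \<open>B\<close> is regular modulo the first \<open>j\<close>
  elementary symmetric polynomials for j <= N; all these stay in the range of the outer hypothesis
  for \<open>B - {y}\<close>. For i < N the claim follows by \<open>esym_regular_step\<close>. For i
  = N reduction modulo \<open>y\<close> is useless, because \<open>esym (Suc N) (B - {y})\<close>
  vanishes; there the polynomial is a product of regular indeterminates.\<close>

theorem esym_regular:
  fixes p :: "('v, 'k::comm_ring_1) mvpoly"
  assumes "finite B" "i < card B" "esym (Suc i) B * p \<in> esym_ideal i B"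
  shows "p \<in> esym_ideal i B"
  using assms
proof (induction "card B" arbitrary: B i p)
  case (Suc N B i p)
  have IH: "q \<in> esym_ideal j (B - {y})"
    if "y \<in> B" "j < N" "esym (Suc j) (B - {y}) * q \<in> esym_ideal j (B - {y})"
    for y j and q :: "('v, 'k) mvpoly"
  proof (rule Suc.hyps(1)[OF _ _ _ that(3)])
    show "N = card (B - {y})"
      unfolding card_Diff_singleton[OF that(1)] Suc.hyps(2)[symmetric] by simp
    then show "j < card (B - {y})"
      using that(2) by simp
    show "finite (B - {y})"
      using Suc.prems(1) by simp
  qed
  have indet: "q \<in> esym_ideal j B" if "y \<in> B" "j \<le> N" "indet y * q \<in> esym_ideal j B"
    for y j and q :: "('v, 'k) mvpoly"
    using that
  proof (induction j arbitrary: q)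
    case 0
    then have "indet y * q = indet y * 0" by simp
    then have "q = 0" by (rule indet_mult_cancel)
    then show ?case by simp
  next
    case (Suc j)
    show ?case
    proof (rule indet_regular_step[OF \<open>finite B\<close> \<open>y \<in> B\<close> _ _ Suc.prems(3)])
      show "r \<in> esym_ideal j (B - {y})" if "esym (Suc j) (B - {y}) * r \<in> esym_ideal j (B - {y})"
        for r :: "('v, 'k) mvpoly"
        by (rule IH[OF \<open>y \<in> B\<close> _ that]) (use Suc.prems(2) in simp)
      show "r \<in> esym_ideal j B" if "indet y * r \<in> esym_ideal j B" for r :: "('v, 'k) mvpoly"
        by (rule Suc.IH[OF \<open>y \<in> B\<close> _ that]) (use Suc.prems(2) in simp)
    qed
  qed
  show ?case
  proof (cases "i < N")
    case True
    have "B \<noteq> {}" using Suc.prems(2) by auto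
    then obtain y where "y \<in> B" by blast
    show ?thesis
    proof (rule esym_regular_step[OF Suc.prems(1) \<open>y \<in> B\<close> _ _ Suc.prems(3)])
      show "q \<in> esym_ideal i (B - {y})" if "esym (Suc i) (B - {y}) * q \<in> esym_ideal i (B - {y})"
        for q :: "('v, 'k) mvpoly"
        by (rule IH[OF \<open>y \<in> B\<close> True that])
      show "q \<in> esym_ideal i B" if "indet y * q \<in> esym_ideal i B" for q :: "('v, 'k) mvpoly"
        by (rule indet[OF \<open>y \<in> B\<close> _ that]) (use True in simp)
    qed
  next
    case False
    then have i: "Suc i = card B" "i \<le> N" using Suc.hyps(2) Suc.prems(2) by linarith+
    have "Poly_Mapping.single (smono B) 1 * p \<in> esym_ideal i B"
      using Suc.prems(3) unfolding i(1) esym_card[OF Suc.prems(1)] .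
    then show ?thesis
    proof (rule smono_regular[OF Suc.prems(1), rotated])
      show "q \<in> esym_ideal i B" if "y \<in> B" "indet y * q \<in> esym_ideal i B"
        for y and q :: "('v, 'k) mvpoly"
        by (rule indet[OF that(1) i(2) that(2)])
    qed
  qed
next
  case 0
  then show ?case by (metis not_less_zero)
qed

section \<open>Weakly regular sequences on spans of monomials\<close>

definition order_convex :: "'v set set \<Rightarrow> bool" where
  "order_convex \<F> \<longleftrightarrow> (\<forall>A\<in>\<F>. \<forall>C\<in>\<F>. \<forall>B. A \<subseteq> B \<longrightarrow> B \<subseteq> C \<longrightarrow> B \<in> \<F>)"

definition restr :: "'v set set \<Rightarrow> ('v, 'k::comm_ring_1) mvpoly \<Rightarrow> ('v, 'k) mvpoly" where
  "restr \<F> = pfilter (\<lambda>t. Poly_Mapping.keys t \<in> \<F>)"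

definition span_mod :: "'v set set \<Rightarrow> ('v, 'k::comm_ring_1) mvpoly set" where
  "span_mod \<F> = {p. \<forall>t\<in>Poly_Mapping.keys p. Poly_Mapping.keys t \<in> \<F>}"

lemma restr_zero [simp]: "restr \<F> 0 = 0"
  by (simp add: restr_def)

lemma restr_add: "restr \<F> (p + q) = restr \<F> p + restr \<F> q"
  by (simp add: restr_def pfilter_add)

lemma restr_diff: "restr \<F> (p - q) = restr \<F> p - restr \<F> q"
  by (simp add: restr_def pfilter_diff)

lemma restr_restr: "restr \<F> (restr \<G> p) = restr (\<F> \<inter> \<G>) p"
  by (simp add: restr_def pfilter_pfilter)

lemma restr_in_span_mod [simp]: "restr \<F> p \<in> span_mod \<F>"
  by (simp add: restr_def span_mod_def keys_pfilter)

lemma restr_id: "p \<in> span_mod \<F> \<Longrightarrow> restr \<F> p = p"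
  by (simp add: restr_def span_mod_def pfilter_id_iff)

lemma span_modI: "restr \<F> p = p \<Longrightarrow> p \<in> span_mod \<F>"
  by (metis restr_in_span_mod)

lemma restr_eq_0I: "(\<And>t. t \<in> Poly_Mapping.keys p \<Longrightarrow> Poly_Mapping.keys t \<notin> \<F>) \<Longrightarrow> restr \<F> p = 0"
  by (simp add: restr_def pfilter_eq_0_iff)

lemma zero_in_span_mod [simp]: "0 \<in> span_mod \<F>"
  by (simp add: span_mod_def)

lemma span_mod_diff: "p \<in> span_mod \<F> \<Longrightarrow> q \<in> span_mod \<F> \<Longrightarrow> p - q \<in> span_mod \<F>"
  by (rule span_modI) (simp add: restr_diff restr_id)

lemma span_mod_add: "p \<in> span_mod \<F> \<Longrightarrow> q \<in> span_mod \<F> \<Longrightarrow> p + q \<in> span_mod \<F>"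
  by (rule span_modI) (simp add: restr_add restr_id)

lemma span_mod_mono: "\<F> \<subseteq> \<G> \<Longrightarrow> span_mod \<F> \<subseteq> span_mod \<G>"
  by (auto simp: span_mod_def)

lemma keys_times_mono:
  fixes g d :: "('v, 'k::comm_ring_1) mvpoly"
  assumes "t \<in> Poly_Mapping.keys (g * d)"
  obtains u where "u \<in> Poly_Mapping.keys d" "Poly_Mapping.keys u \<subseteq> Poly_Mapping.keys t"
proof -
  obtain a b where "b \<in> Poly_Mapping.keys d" "t = a + b"
    using assms by (rule keys_times_obtain)
  then show ?thesis by (intro that[of b]) (auto simp: keys_plus_nat)
qed

text \<open>
  For an order convex family \<open>\<F>\<close> the action \<open>f \<cdot> p = restr \<F> (f * p)\<close> makes \<open>span_mod \<F>\<close> a module: it is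
  the subquotient of the polynomial ring with the monomials of support in \<open>\<F>\<close> as a basis.
\<close>

lemma restr_times_restr:
  fixes p :: "('v, 'k::comm_ring_1) mvpoly"
  assumes "order_convex \<F>" "p \<in> span_mod \<F>"
  shows "restr \<F> (g * restr \<F> (f * p)) = restr \<F> (g * (f * p))"
proof -
  let ?d = "f * p - restr \<F> (f * p)"
  \<comment> \<open>A term dropped by the inner restriction has a support outside \<F> that lies
    above a member of \<F>. By convexity no larger set belongs to \<F>, so its multiples are dropped
    as well.\<close>
  have "restr \<F> (g * ?d) = 0"
  proof (rule restr_eq_0I)
    fix t assume "t \<in> Poly_Mapping.keys (g * ?d)"
    then obtain u where u: "u \<in> Poly_Mapping.keys ?d" "Poly_Mapping.keys u \<subseteq> Poly_Mapping.keys t"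
      by (rule keys_times_mono)
    then have "u \<in> Poly_Mapping.keys (f * p)" "Poly_Mapping.keys u \<notin> \<F>"
      by (auto simp: in_keys_iff lookup_minus restr_def lookup_pfilter split: if_splits)
    then obtain s where "s \<in> Poly_Mapping.keys p" "Poly_Mapping.keys s \<subseteq> Poly_Mapping.keys u"
      using keys_times_mono by metis
    moreover then have "Poly_Mapping.keys s \<in> \<F>"
      using assms(2) by (simp add: span_mod_def)
    ultimately show "Poly_Mapping.keys t \<notin> \<F>"
      using assms(1) u(2) \<open>Poly_Mapping.keys u \<notin> \<F>\<close> unfolding order_convex_def by metis
  qed
  then show ?thesis by (simp add: right_diff_distrib restr_diff)
qed

text \<open>
  The predicate \<open>wreg \<F> N fs\<close> states that \<open>fs\<close> is a weakly regular sequence on the quotient of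
  \<open>span_mod \<F>\<close> by its submodule \<open>N\<close>.
\<close>

fun wreg :: "'v set set \<Rightarrow> ('v, 'k::comm_ring_1) mvpoly set \<Rightarrow> ('v, 'k) mvpoly list \<Rightarrow> bool" where
  "wreg \<F> N [] \<longleftrightarrow> True"
| "wreg \<F> N (f # fs) \<longleftrightarrow> (\<forall>p\<in>span_mod \<F>. restr \<F> (f * p) \<in> N \<longrightarrow> p \<in> N) \<and>
     wreg \<F> {n + restr \<F> (f * q) |n q. n \<in> N \<and> q \<in> span_mod \<F>} fs"

definition submod :: "'v set set \<Rightarrow> ('v, 'k::comm_ring_1) mvpoly set \<Rightarrow> bool" where
  "submod \<F> N \<longleftrightarrow> 0 \<in> N \<and> N \<subseteq> span_mod \<F> \<and> (\<forall>p\<in>N. \<forall>q\<in>N. p - q \<in> N) \<and>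
     (\<forall>g. \<forall>p\<in>N. restr \<F> (g * p) \<in> N)"

lemma submod_add: "submod \<F> N \<Longrightarrow> p \<in> N \<Longrightarrow> q \<in> N \<Longrightarrow> p + q \<in> N"
  unfolding submod_def by (metis diff_0 diff_minus_eq_add)

lemma submod_extend:
  assumes "order_convex \<F>" "submod \<F> N"
  shows "submod \<F> {n + restr \<F> (f * q) |n q. n \<in> N \<and> q \<in> span_mod \<F>}" (is "submod \<F> ?N")
  unfolding submod_def
proof (intro conjI ballI allI subsetI)
  show "0 \<in> ?N"
    using assms(2) by (auto simp: submod_def intro!: exI[of _ 0])
  show "p \<in> span_mod \<F>" if "p \<in> ?N" for p
    using that assms(2) by (auto simp: submod_def intro!: span_mod_add)
  show "p - q \<in> ?N" if pq: "p \<in> ?N" "q \<in> ?N" for p q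
  proof -
    obtain n a m b where "p = n + restr \<F> (f * a)" "q = m + restr \<F> (f * b)"
      and nm: "n \<in> N" "m \<in> N" "a \<in> span_mod \<F>" "b \<in> span_mod \<F>"
      using pq by auto
    then have "p - q = (n - m) + restr \<F> (f * (a - b))"
      by (simp add: right_diff_distrib restr_diff)
    moreover have "n - m \<in> N" "a - b \<in> span_mod \<F>"
      using nm assms(2) by (auto simp: submod_def span_mod_diff)
    ultimately show ?thesis by blast
  qed
  show "restr \<F> (g * p) \<in> ?N" if p: "p \<in> ?N" for g p
  proof -
    obtain n a where p: "p = n + restr \<F> (f * a)" and n: "n \<in> N" "a \<in> span_mod \<F>"
      using p by auto
    have "restr \<F> (g * restr \<F> (f * a)) = restr \<F> (f * restr \<F> (g * a))"
      by (simp add: restr_times_restr[OF assms(1) n(2)] mult.left_commute)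
    then have "restr \<F> (g * p) = restr \<F> (g * n) + restr \<F> (f * restr \<F> (g * a))"
      by (simp add: p distrib_left restr_add)
    moreover have "restr \<F> (g * n) \<in> N"
      using n assms(2) by (simp add: submod_def)
    moreover have "restr \<F> (g * a) \<in> span_mod \<F>" by simp
    ultimately show ?thesis by blast
  qed
qed

text \<open>
  The snake lemma for the exact sequence of the modules spanned by \<open>\<F> \<inter> U\<close>, \<open>\<F>\<close> and \<open>\<F> - U\<close>.
  Keeping the sequence fixed avoids the independence of the depth from the choice of the sequence.
\<close>

lemma wreg_split:
  fixes fs :: "('v, 'k::comm_ring_1) mvpoly list"
  assumes "order_convex \<F>" and U: "\<And>A B. A \<in> U \<Longrightarrow> A \<subseteq> B \<Longrightarrow> B \<in> U"
    and "submod \<F> N"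
    and "wreg (\<F> \<inter> U) (N \<inter> span_mod (\<F> \<inter> U)) fs"
    and "wreg (\<F> - U) (restr (\<F> - U) ` N) fs"
  shows "wreg \<F> N fs"
  using assms(3-5)
proof (induction fs arbitrary: N)
  case (Cons f fs N)
  let ?A = "\<F> \<inter> U" and ?C = "\<F> - U"
  have N: "0 \<in> N" "N \<subseteq> span_mod \<F>" "\<And>p q. p \<in> N \<Longrightarrow> q \<in> N \<Longrightarrow> p - q \<in> N"
    "\<And>g p. p \<in> N \<Longrightarrow> restr \<F> (g * p) \<in> N"
    using Cons.prems(1) by (auto simp: submod_def)
  have upper: "Poly_Mapping.keys t \<in> U" if p: "p \<in> span_mod ?A" and t: "t \<in> Poly_Mapping.keys (g * p)"
    for p g :: "('v, 'k) mvpoly" and t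
  proof -
    obtain u where "u \<in> Poly_Mapping.keys p" "Poly_Mapping.keys u \<subseteq> Poly_Mapping.keys t"
      using t by (rule keys_times_mono)
    then show ?thesis using p U by (auto simp: span_mod_def)
  qed
  have restr_A: "restr ?A (g * p) = restr \<F> (g * p)" if "p \<in> span_mod ?A" for p g :: "('v, 'k) mvpoly"
    unfolding restr_def
    by (rule poly_mapping_eqI) (use upper[OF that, of _ g] in \<open>auto simp: lookup_pfilter in_keys_iff\<close>)
  have diff_A: "p - restr ?C p \<in> span_mod ?A" if "p \<in> span_mod \<F>" for p :: "('v, 'k) mvpoly"
    using that by (auto simp: span_mod_def in_keys_iff lookup_minus restr_def lookup_pfilter split: if_splits)
  have restr_C: "restr ?C (restr \<F> (g * p)) = restr ?C (g * restr ?C p)" if "p \<in> span_mod \<F>"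
    for p g :: "('v, 'k) mvpoly"
  proof -
    have "restr ?C (g * (p - restr ?C p)) = 0"
      by (rule restr_eq_0I) (use upper[OF diff_A[OF that], of _ g] in auto)
    moreover have "?C \<inter> \<F> = ?C" by auto
    ultimately show ?thesis by (simp add: restr_restr right_diff_distrib restr_diff)
  qed
  have C: "q \<in> restr ?C ` N" if "q \<in> span_mod ?C" "restr ?C (f * q) \<in> restr ?C ` N" for q
    using Cons.prems(3) that by simp
  \<comment> \<open>Regularity of \<open>f\<close> on the part outside \<open>U\<close>, in a
    liftable form: if \<open>f\<close> times \<open>p\<close> agrees with an element of
    \<open>N\<close> on that part, then \<open>p\<close> agrees with an element of \<open>N\<close>
    up to the span of \<open>?A\<close>.\<close>
  have lift: "\<exists>n\<in>N. p - n \<in> span_mod ?A"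
    if p: "p \<in> span_mod \<F>" "restr ?C (restr \<F> (f * p)) \<in> restr ?C ` N" for p
  proof -
    have "restr ?C p \<in> restr ?C ` N"
      by (rule C) (use p restr_C[OF p(1), of f] in auto)
    then obtain n where n: "n \<in> N" "restr ?C p = restr ?C n" by auto
    then have "p - n \<in> span_mod \<F>" "restr ?C (p - n) = 0"
      using p(1) N(2) by (auto simp: restr_diff intro!: span_mod_diff)
    with diff_A[of "p - n"] n(1) show ?thesis by auto
  qed
  have "p \<in> N" if p: "p \<in> span_mod \<F>" "restr \<F> (f * p) \<in> N" for p
  proof -
    obtain n where n: "n \<in> N" "p - n \<in> span_mod ?A"
      using lift[OF p(1)] p(2) by blast
    have "restr ?A (f * (p - n)) = restr \<F> (f * p) - restr \<F> (f * n)"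
      unfolding restr_A[OF n(2)] by (simp add: right_diff_distrib restr_diff)
    also have "\<dots> \<in> N"
      by (intro N n p)
    finally have "p - n \<in> N"
      using Cons.prems(2) n(2) by simp
    from submod_add[OF Cons.prems(1) this n(1)] show ?thesis by simp
  qed
  moreover
  let ?N = "{n + restr \<F> (f * q) |n q. n \<in> N \<and> q \<in> span_mod \<F>}"
  \<comment> \<open>Dividing by \<open>f\<close> keeps the sequence exact on the left. If
    \<open>n + restr \<F> (f * q)\<close> lies in the span of \<open>?A\<close>, then
    \<open>lift\<close> moves \<open>q\<close> into that span by subtracting some \<open>m\<close>
    in \<open>N\<close>; the product of \<open>f\<close> and \<open>m\<close> is absorbed into
    \<open>n\<close>.\<close>
  have A_eq: "?N \<inter> span_mod ?A
      = {n + restr ?A (f * q) |n q. n \<in> N \<inter> span_mod ?A \<and> q \<in> span_mod ?A}" (is "?L = ?R")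
  proof (intro equalityI subsetI)
    fix x assume "x \<in> ?L"
    then obtain n q where x: "x = n + restr \<F> (f * q)" "n \<in> N" "q \<in> span_mod \<F>" "x \<in> span_mod ?A"
      by auto
    have "restr ?C x = 0"
      by (rule restr_eq_0I) (use x(4) in \<open>auto simp: span_mod_def\<close>)
    then have "restr ?C n + restr ?C (restr \<F> (f * q)) = 0"
      unfolding x(1) by (simp only: restr_add)
    then have "restr ?C (restr \<F> (f * q)) = restr ?C (0 - n)"
      using minus_unique by (metis diff_0 restr_diff restr_zero)
    moreover have "0 - n \<in> N" by (intro N x)
    ultimately obtain m where m: "m \<in> N" "q - m \<in> span_mod ?A"
      using lift[OF x(3)] by blast
    have eq: "x = (n + restr \<F> (f * m)) + restr ?A (f * (q - m))"
      unfolding restr_A[OF m(2)] by (simp add: x(1) right_diff_distrib restr_diff)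
    have "n + restr \<F> (f * m) \<in> N"
      by (intro submod_add[OF Cons.prems(1)] N x m)
    moreover have "n + restr \<F> (f * m) \<in> span_mod ?A"
      using span_mod_diff[OF x(4) restr_in_span_mod[of ?A "f * (q - m)"]] eq by simp
    ultimately show "x \<in> ?R" using eq m(2) by blast
  next
    fix x assume "x \<in> ?R"
    then obtain n q where x: "x = n + restr ?A (f * q)" "n \<in> N" "n \<in> span_mod ?A" "q \<in> span_mod ?A"
      by auto
    moreover have "q \<in> span_mod \<F>"
      using x(4) span_mod_mono[of ?A \<F>] by auto
    ultimately show "x \<in> ?L"
      using restr_A[OF x(4), of f] span_mod_add[OF x(3) restr_in_span_mod[of ?A "f * q"]] by auto
  qed
  \<comment> \<open>Right exactness: the image of the extended submodule is the extension of the
    image.\<close>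
  have C_eq: "restr ?C ` ?N = {n + restr ?C (f * q) |n q. n \<in> restr ?C ` N \<and> q \<in> span_mod ?C}"
    (is "?L = ?R")
  proof (intro equalityI subsetI)
    fix x assume "x \<in> ?L"
    then obtain n q where "x = restr ?C (n + restr \<F> (f * q))" "n \<in> N" "q \<in> span_mod \<F>"
      by auto
    then have "x = restr ?C n + restr ?C (f * restr ?C q)" "n \<in> N"
      by (auto simp: restr_add restr_C)
    moreover have "restr ?C q \<in> span_mod ?C" by simp
    ultimately show "x \<in> ?R" by blast
  next
    fix x assume "x \<in> ?R"
    then obtain n q where x: "x = restr ?C n + restr ?C (f * q)" "n \<in> N" "q \<in> span_mod ?C"
      by auto
    have q: "q \<in> span_mod \<F>"
      using x(3) span_mod_mono[of ?C \<F>] by auto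
    have "x = restr ?C (n + restr \<F> (f * q))"
      using restr_C[OF q, of f] restr_id[OF x(3)] x(1) by (simp add: restr_add)
    then show "x \<in> ?L" using x(2) q by blast
  qed
  have "wreg \<F> ?N fs"
  proof (rule Cons.IH)
    show "submod \<F> ?N"
      by (rule submod_extend[OF assms(1) Cons.prems(1)])
    show "wreg ?A (?N \<inter> span_mod ?A) fs"
      unfolding A_eq using Cons.prems(2) by simp
    show "wreg ?C (restr ?C ` ?N) fs"
      unfolding C_eq using Cons.prems(3) by simp
  qed
  ultimately show ?case by simp
qed simp

text \<open>Each term has all of \<open>A\<close> in its support and so is divisible by
  \<open>smono A\<close>, with a quotient in K[B]. The span of the interval is thus a copy of
  K[B].\<close>

lemma span_mod_interval:
  fixes p :: "('v, 'k::comm_ring_1) mvpoly"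
  assumes "finite A" "p \<in> span_mod {F. A \<subseteq> F \<and> F \<subseteq> B}"
  obtains q where "p = Poly_Mapping.single (smono A) 1 * q" "pres B q = q"
proof -
  let ?K = "Poly_Mapping.keys p"
  let ?q = "\<Sum>t\<in>?K. Poly_Mapping.single (t - smono A) (Poly_Mapping.lookup p t)"
  have K: "A \<subseteq> Poly_Mapping.keys t" "Poly_Mapping.keys t \<subseteq> B" if "t \<in> ?K" for t
    using assms(2) that by (auto simp: span_mod_def)
  have sub: "smono A + (t - smono A) = t" if t: "t \<in> ?K" for t
  proof (rule poly_mapping_eqI)
    fix v
    have "v \<in> A \<Longrightarrow> Poly_Mapping.lookup t v \<noteq> 0"
      using K(1)[OF t] by (auto simp: in_keys_iff)
    then show "Poly_Mapping.lookup (smono A + (t - smono A)) v = Poly_Mapping.lookup t v"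
      using assms(1) by (auto simp: lookup_add lookup_minus lookup_smono)
  qed
  have "Poly_Mapping.single (smono A) 1 * ?q = (\<Sum>t\<in>?K. Poly_Mapping.single t (Poly_Mapping.lookup p t))"
    unfolding sum_distrib_left by (rule sum.cong) (simp_all add: mult_single sub)
  also have "\<dots> = p"
    by (rule poly_mapping_eqI) (simp add: lookup_sum lookup_single when_def in_keys_iff)
  finally have "p = Poly_Mapping.single (smono A) 1 * ?q" by simp
  moreover have "pres B ?q = ?q"
    unfolding pres_sum
  proof (rule sum.cong)
    fix t assume t: "t \<in> ?K"
    have "Poly_Mapping.keys (t - smono A) \<subseteq> Poly_Mapping.keys t"
      by (auto simp: in_keys_iff lookup_minus)
    then have "Poly_Mapping.keys (t - smono A) \<subseteq> B"
      using K(2)[OF t] by (rule subset_trans)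
    then show "pres B (Poly_Mapping.single (t - smono A) (Poly_Mapping.lookup p t))
        = Poly_Mapping.single (t - smono A) (Poly_Mapping.lookup p t)"
      by (simp add: pres_def pfilter_single)
  qed simp
  ultimately show ?thesis by (rule that)
qed

text \<open>Under the identification with K[B] the polynomial \<open>esym l V\<close> acts as
  \<open>esym l B\<close>: the lower bound \<open>A\<close> holds automatically after multiplication
  by \<open>smono A\<close>, and the upper bound \<open>B\<close> amounts to
  \<open>pres B\<close>.\<close>

lemma restr_interval_esym:
  fixes q :: "('v, 'k::comm_ring_1) mvpoly"
  assumes "finite V" "A \<subseteq> B" "B \<subseteq> V" "pres B q = q"
  shows "restr {F. A \<subseteq> F \<and> F \<subseteq> B} (esym l V * (Poly_Mapping.single (smono A) 1 * q))
    = Poly_Mapping.single (smono A) 1 * (esym l B * q)"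
proof -
  have "finite A" using assms finite_subset by metis
  then have "restr {F. A \<subseteq> F \<and> F \<subseteq> B} (Poly_Mapping.single (smono A) 1 * (esym l V * q))
      = Poly_Mapping.single (smono A) 1 * pres B (esym l V * q)"
    using assms(2) by (simp add: restr_def pfilter_single_times keys_plus_nat pres_def)
  moreover have "V \<inter> B = B" using assms(3) by auto
  ultimately show ?thesis
    by (simp add: pres_mult pres_esym[OF assms(1)] assms(4) mult.left_commute)
qed

text \<open>The start index \<open>i\<close> makes the induction follow the recursion of
  \<open>wreg\<close>: the submodule belongs to the first \<open>i\<close> polynomials, and the list
  holds those still to come. Only i = 0, with the zero submodule, is used later. The bound on
  \<open>r\<close> keeps every index within reach of \<open>esym_regular\<close>.\<close>

lemma wreg_interval:
  fixes V :: "'v set"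
  assumes "finite V" "A \<subseteq> B" "B \<subseteq> V" "i \<le> r" "r \<le> card B"
  shows "wreg {F. A \<subseteq> F \<and> F \<subseteq> B}
    {Poly_Mapping.single (smono A) 1 * q |q. q \<in> esym_ideal i B \<and> pres B q = q}
    (map (\<lambda>l. esym (Suc l) V :: ('v, 'k::comm_ring_1) mvpoly) [i..<r])"
  using assms(4)
proof (induction i rule: inc_induct)
  case (step i)
  let ?I = "{F. A \<subseteq> F \<and> F \<subseteq> B}" and ?m = "Poly_Mapping.single (smono A) (1::'k)"
  let ?N = "\<lambda>i. {?m * q |q. q \<in> esym_ideal i B \<and> pres B q = q}"
  let ?e = "esym (Suc i) V :: ('v, 'k) mvpoly"
  have fin: "finite A" "finite B" using assms finite_subset by metis+
  have p_in_N: "p \<in> ?N i" if p: "p \<in> span_mod ?I" and N: "restr ?I (?e * p) \<in> ?N i" for p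
  proof -
    obtain q where q: "p = ?m * q" "pres B q = q"
      using p by (rule span_mod_interval[OF fin(1)])
    obtain s where s: "?m * (esym (Suc i) B * q) = ?m * s" "s \<in> esym_ideal i B"
      using N unfolding q(1) restr_interval_esym[OF assms(1-3) q(2)] by auto
    have "esym (Suc i) B * q = s"
      by (rule single_one_times_cancel[OF s(1)])
    then have "q \<in> esym_ideal i B"
      using esym_regular[OF fin(2), of i q] s(2) step.hyps assms(5) by simp
    then show ?thesis using q by auto
  qed
  have "?N (Suc i) = {n + restr ?I (?e * p) |n p. n \<in> ?N i \<and> p \<in> span_mod ?I}" (is "_ = ?R")
  proof (intro equalityI subsetI)
    fix x assume "x \<in> ?N (Suc i)"
    then obtain q where q: "x = ?m * q" "q \<in> esym_ideal (Suc i) B" "pres B q = q" by auto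
    then obtain a z where a: "a \<in> esym_ideal i B" "q = a + esym (Suc i) B * z"
      unfolding esym_ideal_Suc_iff by auto
    \<comment> \<open>The coefficients may involve indeterminates outside \<open>B\<close>; applying
      \<open>pres B\<close> to the equation removes them without changing \<open>q\<close>.\<close>
    have "q = pres B a + esym (Suc i) B * pres B z"
      using q(3) a(2) by (simp add: pres_add pres_mult pres_esym[OF fin(2)])
    then have x: "x = ?m * pres B a + ?m * (esym (Suc i) B * pres B z)"
      unfolding q(1) by (simp only: distrib_left)
    have idem: "pres B (pres B p) = pres B p" for p :: "('v, 'k) mvpoly"
      by (simp add: pres_def pfilter_pfilter)
    have "x = ?m * pres B a + restr ?I (?e * (?m * pres B z))"
      unfolding x restr_interval_esym[OF assms(1-3) idem] ..
    moreover have "?m * pres B a \<in> ?N i"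
      using pres_esym_ideal[OF fin(2) a(1), of B] idem by auto
    moreover have "?m * pres B z \<in> span_mod ?I"
      using fin(1) assms(2)
      by (intro span_modI) (simp add: restr_def pfilter_single_times keys_plus_nat pres_def pfilter_pfilter)
    ultimately show "x \<in> ?R" by blast
  next
    fix x assume "x \<in> ?R"
    then obtain n p where x: "x = n + restr ?I (?e * p)" "n \<in> ?N i" and p: "p \<in> span_mod ?I" by blast
    obtain q where q: "p = ?m * q" "pres B q = q"
      using p by (rule span_mod_interval[OF fin(1)])
    obtain a where a: "n = ?m * a" "a \<in> esym_ideal i B" "pres B a = a"
      using x(2) by auto
    have "x = ?m * (a + esym (Suc i) B * q)"
      unfolding x(1) q(1) a(1) restr_interval_esym[OF assms(1-3) q(2)] by (simp only: distrib_left)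
    moreover have "a + esym (Suc i) B * q \<in> esym_ideal (Suc i) B"
      unfolding esym_ideal_Suc_iff using a(2) by blast
    moreover have "pres B (a + esym (Suc i) B * q) = a + esym (Suc i) B * q"
      by (simp add: pres_add pres_mult pres_esym[OF fin(2)] a(3) q(2))
    ultimately show "x \<in> ?N (Suc i)" by blast
  qed
  with p_in_N step show ?case by (simp only: upt_conv_Cons list.map wreg.simps) blast
qed simp

text \<open>A certificate for weak regularity in the form of a decision tree whose leaves are empty
  or intervals. Splitting by a set \<open>u\<close>, and not only by one vertex, is what allows
  questions about edges. The members containing \<open>u\<close> are closed under supersets within
  the family, as \<open>wreg_split\<close> requires.\<close>

inductive good :: "nat \<Rightarrow> 'v set set \<Rightarrow> bool" for r where
  empty: "good r {}"
| interval: "A \<subseteq> B \<Longrightarrow> finite B \<Longrightarrow> r \<le> card B \<Longrightarrow> good r {F. A \<subseteq> F \<and> F \<subseteq> B}"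
| split: "good r {F \<in> \<F>. u \<subseteq> F} \<Longrightarrow> good r {F \<in> \<F>. \<not> u \<subseteq> F} \<Longrightarrow> good r \<F>"

lemma wreg_subset:
  fixes fs :: "('v, 'k::comm_ring_1) mvpoly list"
  shows "span_mod \<F> \<subseteq> N \<Longrightarrow> wreg \<F> N fs"
proof (induction fs arbitrary: N)
  case (Cons f fs)
  have "span_mod \<F> \<subseteq> {n + restr \<F> (f * q) |n q. n \<in> N \<and> q \<in> span_mod \<F>}"
  proof
    fix p :: "('v, 'k) mvpoly" assume "p \<in> span_mod \<F>"
    then have "p = p + restr \<F> (f * 0)" "p \<in> N" using Cons.prems by auto
    then show "p \<in> {n + restr \<F> (f * q) |n q. n \<in> N \<and> q \<in> span_mod \<F>}"
      using zero_in_span_mod by blast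
  qed
  then show ?case using Cons by auto
qed simp

theorem wreg_good:
  fixes V :: "'v set"
  assumes "good r \<F>" "order_convex \<F>" "\<Union>\<F> \<subseteq> V" "finite V"
  shows "wreg \<F> {0} (map (\<lambda>l. esym (Suc l) V :: ('v, 'k::comm_ring_1) mvpoly) [0..<r])"
  using assms
proof (induction rule: good.induct)
  case empty
  have "span_mod {} \<subseteq> ({0} :: ('v, 'k) mvpoly set)"
    by (auto simp: span_mod_def)
  then show ?case by (rule wreg_subset)
next
  case (interval A B)
  have "{Poly_Mapping.single (smono A) 1 * q |q. q \<in> esym_ideal 0 B \<and> pres B q = q}
      = ({0} :: ('v, 'k) mvpoly set)"
    by (auto simp: pres_def)
  moreover have "B \<subseteq> V" using interval by auto
  ultimately show ?case
    using wreg_interval[of V A B 0 r, where 'k = 'k] interval by simp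
next
  case (split \<F> u)
  let ?U = "{F. u \<subseteq> F}" and ?fs = "map (\<lambda>l. esym (Suc l) V :: ('v, 'k) mvpoly) [0..<r]"
  have sub: "{F \<in> \<F>. u \<subseteq> F} = \<F> \<inter> ?U" "{F \<in> \<F>. \<not> u \<subseteq> F} = \<F> - ?U" by auto
  have "order_convex (\<F> \<inter> ?U)"
    using split.prems(1) unfolding order_convex_def by blast
  moreover have "order_convex (\<F> - ?U)"
    using split.prems(1) unfolding order_convex_def by blast
  ultimately have wreg: "wreg (\<F> \<inter> ?U) {0} ?fs" "wreg (\<F> - ?U) {0} ?fs"
    using split.IH split.prems unfolding sub by blast+
  show ?case
  proof (rule wreg_split[OF split.prems(1), of ?U])
    show "B \<in> ?U" if "A \<in> ?U" "A \<subseteq> B" for A B using that by auto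
    show "submod \<F> {0}" by (simp add: submod_def)
    have "{0} \<inter> span_mod (\<F> \<inter> ?U) = ({0} :: ('v, 'k) mvpoly set)" by auto
    with wreg show "wreg (\<F> \<inter> ?U) ({0} \<inter> span_mod (\<F> \<inter> ?U)) ?fs"
      "wreg (\<F> - ?U) (restr (\<F> - ?U) ` {0}) ?fs" by simp_all
  qed
qed

section \<open>Matchings of paths\<close>

fun path_arcs :: "'v list \<Rightarrow> ('v \<times> 'v) set" where
  "path_arcs (u # v # vs) = {(u, v), (v, u)} \<union> path_arcs (v # vs)"
| "path_arcs _ = {}"

text \<open>Matching greedily from one end is optimal on a path, see \<open>has_matching_path\<close>.\<close>

fun path_matching :: "'v list \<Rightarrow> 'v set \<Rightarrow> nat" where
  "path_matching (u # v # vs) F =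
     (if u \<in> F \<and> v \<in> F then Suc (path_matching vs F) else path_matching (v # vs) F)"
| "path_matching _ F = 0"

text \<open>Deleting both ends of the chosen edge forces all later edges to be disjoint from it. For
  a loop-free \<open>E\<close> this says that \<open>F\<close> contains a \<open>k\<close>-matching,
  in a form suited to induction on \<open>k\<close>.\<close>

primrec has_matching :: "('v \<times> 'v) set \<Rightarrow> nat \<Rightarrow> 'v set \<Rightarrow> bool" where
  "has_matching E 0 F \<longleftrightarrow> True"
| "has_matching E (Suc k) F \<longleftrightarrow> (\<exists>(u, v)\<in>E. u \<in> F \<and> v \<in> F \<and> has_matching E k (F - {u, v}))"

lemma path_matching_notin: "u \<notin> F \<Longrightarrow> path_matching (u # vs) F = path_matching vs F"
  by (cases vs) auto

text \<open>The two bounds need each other: if the scan takes the edge from \<open>u\<close> to the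
  next vertex \<open>v\<close>, the lower bound for \<open>u\<close> comes from the upper bound for
  \<open>v\<close>, and conversely.\<close>

lemma path_matching_Cons_le:
  "path_matching vs F \<le> path_matching (u # vs) F \<and> path_matching (u # vs) F \<le> Suc (path_matching vs F)"
  by (induction vs arbitrary: u) auto

lemma path_matching_mono: "F \<subseteq> G \<Longrightarrow> path_matching vs F \<le> path_matching vs G"
proof (induction vs rule: induct_list012)
  case (3 u v vs)
  have "path_matching (v # vs) F \<le> Suc (path_matching vs F)"
    using path_matching_Cons_le[of vs F v] by simp
  moreover have "u \<in> F \<and> v \<in> F \<Longrightarrow> u \<in> G \<and> v \<in> G"
    using 3(3) by auto
  ultimately show ?case
    using 3(1,2)[OF 3(3)] by (simp split: if_splits)
qed auto

lemma path_matching_le: "path_matching vs F \<le> length vs div 2"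
  by (induction vs F rule: path_matching.induct) auto

lemma path_matching_cong: "F \<inter> set vs = G \<inter> set vs \<Longrightarrow> path_matching vs F = path_matching vs G"
proof (induction vs rule: induct_list012)
  case (3 u v vs)
  have "F \<inter> set vs = G \<inter> set vs" "F \<inter> set (v # vs) = G \<inter> set (v # vs)"
    and "u \<in> F \<longleftrightarrow> u \<in> G" "v \<in> F \<longleftrightarrow> v \<in> G"
    using 3(3) by auto
  with 3(1,2) show ?case by simp
qed auto

lemma path_arcs_subset: "path_arcs vs \<subseteq> set vs \<times> set vs"
  by (induction vs rule: induct_list012) auto

text \<open>The exchange argument behind the optimality of the greedy scan: giving up the ends of
  any edge, greedy or not, costs at least one greedy edge.\<close>

lemma path_matching_remove:
  assumes "distinct vs" "(u, v) \<in> path_arcs vs" "u \<in> F" "v \<in> F"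
  shows "Suc (path_matching vs (F - {u, v})) \<le> path_matching vs F"
  using assms
proof (induction vs rule: induct_list012)
  case (3 a b vs)
  have mono: "path_matching vs (F - {u, v}) \<le> path_matching vs F"
    by (rule path_matching_mono) auto
  show ?case
  proof (cases "(u, v) = (a, b) \<or> (u, v) = (b, a)")
    case True
    then show ?thesis using mono 3(5,6) by (auto simp: path_matching_notin)
  next
    case False
    then have arc: "(u, v) \<in> path_arcs (b # vs)" using 3(4) by auto
    then have uv: "u \<in> set (b # vs)" "v \<in> set (b # vs)" using path_arcs_subset by blast+
    then have a: "a \<noteq> u" "a \<noteq> v" using 3(3) by auto
    have IH: "Suc (path_matching (b # vs) (F - {u, v})) \<le> path_matching (b # vs) F"
      using 3(2)[OF _ arc 3(5,6)] 3(3) by simp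
    show ?thesis
    proof (cases "a \<in> F \<and> b \<in> F")
      case both: True
      show ?thesis
      proof (cases "b = u \<or> b = v")
        \<comment> \<open>The given edge uses \<open>b\<close>, so \<open>a\<close> loses its greedy
          partner, the scan passes over both, and \<open>mono\<close> bounds the rest.\<close>
        case True
        then show ?thesis using both mono by (auto simp: path_matching_notin)
      next
        case b: False
        then have "(u, v) \<in> path_arcs vs" using arc by (cases vs) auto
        then have "Suc (path_matching vs (F - {u, v})) \<le> path_matching vs F"
          using 3(1)[OF _ _ 3(5,6)] 3(3) by simp
        then show ?thesis using both a b by auto
      qed
    next
      case False
      then have "path_matching (a # b # vs) F = path_matching (b # vs) F"
        "path_matching (a # b # vs) (F - {u, v}) = path_matching (b # vs) (F - {u, v})"
        by auto
      with IH show ?thesis by simp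
    qed
  qed
qed auto

text \<open>The first edge taken by the scan attains equality in
  \<open>path_matching_remove\<close>. The two lemmas together give
  \<open>has_matching_path\<close>.\<close>

lemma path_matching_pick:
  assumes "distinct vs" "path_matching vs F > 0"
  obtains u v where "(u, v) \<in> path_arcs vs" "u \<in> F" "v \<in> F"
    "path_matching vs F = Suc (path_matching vs (F - {u, v}))"
proof -
  have "\<exists>u v. (u, v) \<in> path_arcs vs \<and> u \<in> F \<and> v \<in> F
      \<and> path_matching vs F = Suc (path_matching vs (F - {u, v}))"
    using assms
  proof (induction vs rule: induct_list012)
    case (3 a b vs)
    show ?case
    proof (cases "a \<in> F \<and> b \<in> F")
      case True
      have "path_matching vs (F - {a, b}) = path_matching vs F"
        by (rule path_matching_cong) (use 3(3) in auto)
      then have "path_matching (a # b # vs) F = Suc (path_matching (a # b # vs) (F - {a, b}))"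
        using True by (simp add: path_matching_notin)
      then show ?thesis using True by (intro exI[of _ a] exI[of _ b]) simp
    next
      case False
      then have eq: "path_matching (a # b # vs) (F - X) = path_matching (b # vs) (F - X)" for X
        by auto
      obtain u v where "(u, v) \<in> path_arcs (b # vs)" "u \<in> F" "v \<in> F"
        "path_matching (b # vs) F = Suc (path_matching (b # vs) (F - {u, v}))"
        using 3(2) 3(3,4) eq[of "{}"] by auto
      then show ?thesis using eq[of "{}"] eq[of "{u, v}"] by (intro exI[of _ u] exI[of _ v]) simp
    qed
  qed auto
  then show ?thesis using that by blast
qed

lemma has_matching_path:
  assumes "distinct vs"
  shows "has_matching (path_arcs vs) k F \<longleftrightarrow> k \<le> path_matching vs F"
proof (induction k arbitrary: F)
  case (Suc k)
  show ?case
  proof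
    assume "has_matching (path_arcs vs) (Suc k) F"
    then obtain u v where "(u, v) \<in> path_arcs vs" "u \<in> F" "v \<in> F" "k \<le> path_matching vs (F - {u, v})"
      using Suc by auto
    with path_matching_remove[OF assms, of u v F] show "Suc k \<le> path_matching vs F"
      by simp
  next
    assume k: "Suc k \<le> path_matching vs F"
    then have "path_matching vs F > 0" by simp
    then obtain u v where "(u, v) \<in> path_arcs vs" "u \<in> F" "v \<in> F"
      "path_matching vs F = Suc (path_matching vs (F - {u, v}))"
      by (rule path_matching_pick[OF assms])
    with k Suc show "has_matching (path_arcs vs) (Suc k) F" by auto
  qed
qed simp

text \<open>Only arcs inside \<open>F\<close> matter. This replaces the cycle by a path as soon as
  one vertex is missing from \<open>F\<close>.\<close>

lemma has_matching_cong:
  assumes "E \<inter> F \<times> F = E' \<inter> F \<times> F"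
  shows "has_matching E k F \<longleftrightarrow> has_matching E' k F"
  using assms
proof (induction k arbitrary: F)
  case (Suc k)
  have IH: "has_matching E k (F - X) = has_matching E' k (F - X)" for X
    by (rule Suc.IH) (use Suc.prems in blast)
  have "(u, v) \<in> E \<and> u \<in> F \<and> v \<in> F \<longleftrightarrow> (u, v) \<in> E' \<and> u \<in> F \<and> v \<in> F" for u v
    using Suc.prems by blast
  with IH show ?case by (simp add: Bex_def split_paired_Ex) metis
qed simp

lemma has_matching_mono: "has_matching E k F \<Longrightarrow> F \<subseteq> G \<Longrightarrow> has_matching E k G"
proof (induction k arbitrary: F G)
  case (Suc k)
  then obtain u v where "(u, v) \<in> E" "u \<in> F" "v \<in> F" "has_matching E k (F - {u, v})" by auto
  moreover have "F - {u, v} \<subseteq> G - {u, v}" using Suc.prems by auto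
  ultimately have "has_matching E k (G - {u, v})" "u \<in> G" "v \<in> G"
    using Suc.IH[of "F - {u, v}" "G - {u, v}"] Suc.prems(2) by auto
  with \<open>(u, v) \<in> E\<close> show ?case by auto
qed simp

lemma has_matching_card:
  assumes "has_matching E k F" "finite F" "\<And>v. (v, v) \<notin> E"
  shows "2 * k \<le> card F"
  using assms
proof (induction k arbitrary: F)
  case (Suc k)
  then obtain u v where uv: "(u, v) \<in> E" "u \<in> F" "v \<in> F" "has_matching E k (F - {u, v})" by auto
  then have "u \<noteq> v" using Suc.prems(3) by auto
  then have "card {u, v} = 2" by simp
  moreover have "card (F - {u, v}) = card F - card {u, v}" "card {u, v} \<le> card F"
    using uv Suc.prems(2) by (simp_all add: card_Diff_subset card_mono del: card_Diff_insert)
  moreover have "2 * k \<le> card (F - {u, v})"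
    using Suc.IH[OF uv(4)] Suc.prems by blast
  ultimately show ?case by simp
qed simp

section \<open>Concatenation and reversal of paths\<close>

lemma path_arcs_Cons: "path_arcs (u # vs) = (if vs = [] then {} else {(u, hd vs), (hd vs, u)}) \<union> path_arcs vs"
  by (cases vs) auto

lemma path_arcs_append:
  "path_arcs (us @ vs) = path_arcs us \<union> path_arcs vs \<union>
     (if us = [] \<or> vs = [] then {} else {(last us, hd vs), (hd vs, last us)})"
  by (induction us rule: induct_list012) (auto simp: path_arcs_Cons)

lemma path_arcs_rev: "path_arcs (rev vs) = path_arcs vs"
  by (induction vs) (auto simp: path_arcs_append path_arcs_Cons last_rev)

lemma path_arcs_upt: "path_arcs [a..<b] = {(i, Suc i) |i. a \<le> i \<and> Suc i < b} \<union> {(Suc i, i) |i. a \<le> i \<and> Suc i < b}"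
proof (induction b)
  case (Suc b)
  show ?case
  proof (cases "a < b")
    case True
    then obtain c where c: "b = Suc c" "a \<le> c" by (cases b) auto
    have "path_arcs [a..<Suc b] = path_arcs [a..<b] \<union> {(c, b), (b, c)}"
      using c by (simp add: path_arcs_append)
    moreover have "a \<le> i \<and> Suc i < Suc b \<longleftrightarrow> (a \<le> i \<and> Suc i < b) \<or> i = c" for i
      using c by auto
    ultimately show ?thesis unfolding Suc.IH using c(1) by blast
  next
    case False
    then have "path_arcs [a..<Suc b] = {}"
      by (cases "a = b") simp_all
    moreover have "\<not> (a \<le> i \<and> Suc i < Suc b)" for i
      using False by auto
    ultimately show ?thesis by blast
  qed
qed simp

text \<open>Greedy scans from the two ends may choose different edges, but both counts are the
  matching number of the same path.\<close>

lemma path_matching_rev: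
  assumes "distinct vs"
  shows "path_matching (rev vs) F = path_matching vs F"
proof -
  have "k \<le> path_matching (rev vs) F \<longleftrightarrow> k \<le> path_matching vs F" for k
    using has_matching_path[of "rev vs" k F] has_matching_path[of vs k F] assms
    by (simp add: path_arcs_rev)
  from this[of "path_matching (rev vs) F"] this[of "path_matching vs F"] show ?thesis
    by simp
qed

lemma path_matching_full_prefix:
  "set us \<subseteq> F \<Longrightarrow> even (length us) \<Longrightarrow>
    path_matching (us @ ws) F = length us div 2 + path_matching ws F"
  by (induction us rule: induct_list012) auto

section \<open>Families of faces of a path\<close>

lemma good_query:
  assumes "good r {F \<in> \<F>. x \<in> F}" "good r {F \<in> \<F>. x \<notin> F}"
  shows "good r \<F>"
  by (rule good.split[where u = "{x}"]) (use assms in simp_all)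

lemma good_full:
  assumes "finite B" "r \<le> card B" "\<And>F. A \<subseteq> F \<Longrightarrow> F \<subseteq> B \<Longrightarrow> P F"
  shows "good r {F. A \<subseteq> F \<and> F \<subseteq> B \<and> P F}"
proof (cases "A \<subseteq> B")
  case True
  have "{F. A \<subseteq> F \<and> F \<subseteq> B \<and> P F} = {F. A \<subseteq> F \<and> F \<subseteq> B}"
    using assms(3) by blast
  then show ?thesis using good.interval[OF True assms(1,2)] by simp
next
  case False
  then have "{F. A \<subseteq> F \<and> F \<subseteq> B \<and> P F} = {}" by blast
  then show ?thesis by (simp only: good.empty)
qed

text \<open>The boundary of a simplex. Leaving out a vertex gives an interval whose top has one
  vertex less than \<open>B\<close>; putting it in repeats the situation with a larger
  \<open>A\<close>, until nothing is left.\<close>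

lemma good_proper:
  assumes "finite B" "A \<subseteq> B" "r \<le> card B - 1"
  shows "good r {F. A \<subseteq> F \<and> F \<subset> B}"
  using assms(2)
proof (induction "card (B - A)" arbitrary: A)
  case 0
  then have "A = B" using assms(1) by auto
  then have "{F. A \<subseteq> F \<and> F \<subset> B} = {}" by auto
  then show ?case by (simp only: good.empty)
next
  case (Suc m)
  then have "B - A \<noteq> {}" by auto
  then obtain x where x: "x \<in> B" "x \<notin> A" by blast
  have "card (B - insert x A) = card (B - A) - 1"
    unfolding Diff_insert[of B x A] by (rule card_Diff_singleton) (use x in simp)
  then have m: "m = card (B - insert x A)"
    unfolding Suc(2)[symmetric] by simp
  have 1: "good r {F. insert x A \<subseteq> F \<and> F \<subset> B}"
    by (rule Suc(1)[OF m]) (use Suc(3) x in simp)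
  have "r \<le> card (B - {x})"
    using assms(3) card_Diff_singleton[OF x(1)] by simp
  then have 2: "good r {F. A \<subseteq> F \<and> F \<subseteq> B - {x}}"
    by (intro good.interval) (use assms(1) x Suc(3) in auto)
  show ?case
  proof (rule good_query[of r _ x])
    have "{F \<in> {F. A \<subseteq> F \<and> F \<subset> B}. x \<in> F} = {F. insert x A \<subseteq> F \<and> F \<subset> B}"
      by blast
    with 1 show "good r {F \<in> {F. A \<subseteq> F \<and> F \<subset> B}. x \<in> F}" by (simp only:)
    have "{F \<in> {F. A \<subseteq> F \<and> F \<subset> B}. x \<notin> F} = {F. A \<subseteq> F \<and> F \<subseteq> B - {x}}"
      using x by blast
    with 2 show "good r {F \<in> {F. A \<subseteq> F \<and> F \<subset> B}. x \<notin> F}" by (simp only:)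
  qed
qed

lemma card_Un_set:
  assumes "finite B" "distinct vs" "B \<inter> set vs = {}"
  shows "card (B \<union> set vs) = card B + length vs"
  using assms by (simp add: card_Un_disjoint distinct_card)

text \<open>The first vertex \<open>x\<close> is already in the face. If its neighbour
  \<open>y\<close> is in, the two are matched and \<open>j\<close> drops by one against a gain of
  two vertices; if \<open>y\<close> is out, \<open>x\<close> is isolated and is the gain. Either way
  the rest \<open>ws\<close> has one vertex less than \<open>vs\<close>, and 1 + (length ws + 2) div
  3 = (length vs + 4) div 3. The statement for paths without a root enters as the hypothesis
  \<open>path\<close>, because the two statements call each other on shorter lists.\<close>

lemma good_path_rooted_aux:
  fixes vs :: "'v list"
  assumes path: "\<And>A B j (ws :: 'v list). length ws < length vs \<Longrightarrow> A \<subseteq> B \<Longrightarrow> finite B \<Longrightarrow> distinct ws \<Longrightarrow>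
      B \<inter> set ws = {} \<Longrightarrow> r \<le> card B + length ws \<Longrightarrow> r \<le> card B + (length ws + 2) div 3 + j \<Longrightarrow>
      good r {F. A \<subseteq> F \<and> F \<subseteq> B \<union> set ws \<and> path_matching ws F \<le> j}"
    and "A \<subseteq> B" "finite B" "distinct (x # vs)" "B \<inter> set (x # vs) = {}"
    and "r \<le> card B + length vs + 1" "r \<le> card B + (length vs + 4) div 3 + j"
  shows "good r {F. insert x A \<subseteq> F \<and> F \<subseteq> insert x B \<union> set vs \<and> path_matching (x # vs) F \<le> j}"
    (is "good r ?\<F>")
proof (cases "length vs \<le> 2 * j")
  \<comment> \<open>At most 2j + 1 vertices carry no j + 1 disjoint edges, so the condition on
    matchings is vacuous. The first bound on \<open>r\<close> is the one for this case.\<close>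
  case True
  have "card (insert x B \<union> set vs) = card B + length vs + 1"
    using card_Un_set[of "insert x B" vs] assms by simp
  moreover have "path_matching (x # vs) F \<le> j" for F
    using path_matching_le[of "x # vs" F] True by simp
  ultimately show ?thesis
    using assms by (intro good_full) auto
next
  case False
  then obtain y ws where vs: "vs = y # ws" by (cases vs) auto
  note dist = assms(4,5)[unfolded vs]
  show ?thesis
  proof (rule good_query[of r _ y])
    show "good r {F \<in> ?\<F>. y \<in> F}"
    proof (cases j)
      case 0
      then have "{F \<in> ?\<F>. y \<in> F} = {}" unfolding vs by auto
      then show ?thesis by (simp only: good.empty)
    next
      case (Suc i)
      have "{F \<in> ?\<F>. y \<in> F}
          = {F. insert x (insert y A) \<subseteq> F \<and> F \<subseteq> insert x (insert y B) \<union> set ws \<and> path_matching ws F \<le> i}"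
        unfolding vs Suc by auto
      also have "good r \<dots>"
        by (rule path) (use assms(2,3,6,7) dist Suc vs False in auto)
      finally show ?thesis .
    qed
    \<comment> \<open>Since \<open>vs\<close> has more than 2j vertices, the size bound required by
      this call follows from the second bound on \<open>r\<close>.\<close>
    have "{F \<in> ?\<F>. y \<notin> F}
        = {F. insert x A \<subseteq> F \<and> F \<subseteq> insert x B \<union> set ws \<and> path_matching ws F \<le> j}"
      unfolding vs using dist by (auto simp: path_matching_notin)
    also have "good r \<dots>"
      by (rule path) (use assms(2,3,6,7) dist vs False in auto)
    finally show "good r {F \<in> ?\<F>. y \<notin> F}" .
  qed
qed

text \<open>The second vertex \<open>y\<close> is queried before the first vertex \<open>x\<close>.
  Starting with \<open>x\<close> would, when \<open>x\<close> is out, shorten the path by one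
  without any gain, which is too little if the length is 1 modulo 3. If \<open>y\<close> is out,
  \<open>x\<close> is isolated and gained; if both are in, they form a matched pair; if only
  \<open>y\<close> is in, the path is rooted at \<open>y\<close>.\<close>

lemma good_path:
  assumes "A \<subseteq> B" "finite B" "distinct vs" "B \<inter> set vs = {}"
    and "r \<le> card B + length vs" "r \<le> card B + (length vs + 2) div 3 + j"
  shows "good r {F. A \<subseteq> F \<and> F \<subseteq> B \<union> set vs \<and> path_matching vs F \<le> j}"
  using assms
proof (induction vs arbitrary: A B j rule: length_induct)
  case (1 vs)
  note path = 1(1)[rule_format]
  let ?\<F> = "{F. A \<subseteq> F \<and> F \<subseteq> B \<union> set vs \<and> path_matching vs F \<le> j}"
  show ?case
  proof (cases "length vs \<le> 2 * j + 1")
    case True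
    have "card (B \<union> set vs) = card B + length vs"
      using card_Un_set[of B vs] 1 by simp
    moreover have "path_matching vs F \<le> j" for F
      using path_matching_le[of vs F] True by simp
    ultimately show ?thesis
      using 1(3,6) by (intro good_full) auto
  next
    case False
    then obtain x y ws where vs: "vs = x # y # ws"
      by (cases vs; cases "tl vs") auto
    note dist = 1(4,5)[unfolded vs]
    show ?thesis
    proof (rule good_query[of r _ y])
      have y: "F \<subseteq> insert x B \<union> set ws \<Longrightarrow> y \<notin> F" for F
        using dist by auto
      have "{F \<in> ?\<F>. y \<notin> F}
          = {F. A \<subseteq> F \<and> F \<subseteq> insert x B \<union> set ws \<and> path_matching ws F \<le> j}"
        unfolding vs using dist by (auto simp: path_matching_notin y)
      also have "good r \<dots>"
        by (rule path) (use 1(2,3,6,7) dist vs False in auto)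
      finally show "good r {F \<in> ?\<F>. y \<notin> F}" .
      show "good r {F \<in> ?\<F>. y \<in> F}"
      proof (rule good_query[of r _ x])
        show "good r {F \<in> {F \<in> ?\<F>. y \<in> F}. x \<in> F}"
        proof (cases j)
          case 0
          then have "{F \<in> {F \<in> ?\<F>. y \<in> F}. x \<in> F} = {}" unfolding vs by auto
          then show ?thesis by (simp only: good.empty)
        next
          case (Suc i)
          have "{F \<in> {F \<in> ?\<F>. y \<in> F}. x \<in> F} = {F. insert x (insert y A) \<subseteq> F \<and>
              F \<subseteq> insert x (insert y B) \<union> set ws \<and> path_matching ws F \<le> i}"
            unfolding vs Suc by auto
          also have "good r \<dots>"
            by (rule path) (use 1(2,3,6,7) dist Suc vs False in auto)
          finally show ?thesis .
        qed
        have "{F \<in> {F \<in> ?\<F>. y \<in> F}. x \<notin> F}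
            = {F. insert y A \<subseteq> F \<and> F \<subseteq> insert y B \<union> set ws \<and> path_matching (y # ws) F \<le> j}"
          unfolding vs using dist by (auto simp: path_matching_notin)
        also have "good r \<dots>"
        proof (rule good_path_rooted_aux)
          fix A' B' :: "'a set" and j' us
          assume "length us < length ws" "A' \<subseteq> B'" "finite B'" "distinct us" "B' \<inter> set us = {}"
            "r \<le> card B' + length us" "r \<le> card B' + (length us + 2) div 3 + j'"
          then show "good r {F. A' \<subseteq> F \<and> F \<subseteq> B' \<union> set us \<and> path_matching us F \<le> j'}"
            by (intro path) (auto simp: vs)
        qed (use 1(2,3,6,7) dist vs False in auto)
        finally show "good r {F \<in> {F \<in> ?\<F>. y \<in> F}. x \<notin> F}" .
      qed
    qed
  qed
qed

lemmas good_path_rooted = good_path_rooted_aux[OF good_path]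

text \<open>With 2j + 2 vertices a matching of j + 1 edges uses all of them, so a set is excluded
  only if it contains the whole path. Scanning by pairs, the first missing vertex makes the
  condition vacuous, and just one vertex is lost against the full interval.\<close>

lemma good_path_even:
  assumes "A \<subseteq> B" "finite B" "distinct vs" "B \<inter> set vs = {}" "length vs = 2 * j + 2"
    and "r \<le> card B + 2 * j + 1"
  shows "good r {F. A \<subseteq> F \<and> F \<subseteq> B \<union> set vs \<and> path_matching vs F \<le> j}"
  using assms
proof (induction j arbitrary: A B vs)
  case (0 A B vs)
  then obtain x y where vs: "vs = [x, y]"
    by (cases vs; cases "tl vs") auto
  show ?case
    by (rule good_path) (use 0 in auto)
next
  case (Suc j A B vs)
  then obtain x y ws where vs: "vs = x # y # ws"
    by (cases vs; cases "tl vs") auto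
  let ?\<F> = "{F. A \<subseteq> F \<and> F \<subseteq> B \<union> set vs \<and> path_matching vs F \<le> Suc j}"
  note dist = Suc.prems(3-5)[unfolded vs]
  show ?case
  proof (rule good_query[of r _ x])
    have "{F \<in> ?\<F>. x \<notin> F}
        = {F. A \<subseteq> F \<and> F \<subseteq> B \<union> set (y # ws) \<and> path_matching (y # ws) F \<le> Suc j}"
      unfolding vs using dist by (auto simp: path_matching_notin)
    also have "good r \<dots>"
    proof (rule good_full)
      show "r \<le> card (B \<union> set (y # ws))"
        using card_Un_set[of B "y # ws"] Suc.prems(2,6) dist by simp
      show "path_matching (y # ws) F \<le> Suc j" for F
        using path_matching_le[of "y # ws" F] dist(3) by simp
    qed (use Suc.prems in auto)
    finally show "good r {F \<in> ?\<F>. x \<notin> F}" .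
    show "good r {F \<in> ?\<F>. x \<in> F}"
    proof (rule good_query[of r _ y])
      have "{F \<in> {F \<in> ?\<F>. x \<in> F}. y \<in> F} = {F. insert x (insert y A) \<subseteq> F \<and>
          F \<subseteq> insert x (insert y B) \<union> set ws \<and> path_matching ws F \<le> j}"
        unfolding vs by auto
      also have "good r \<dots>"
        by (rule Suc.IH) (use Suc.prems(1,2,6) dist in auto)
      finally show "good r {F \<in> {F \<in> ?\<F>. x \<in> F}. y \<in> F}" .
      have "{F \<in> {F \<in> ?\<F>. x \<in> F}. y \<notin> F}
          = {F. insert x A \<subseteq> F \<and> F \<subseteq> insert x B \<union> set ws \<and> path_matching (x # y # ws) F \<le> Suc j \<and> y \<notin> F}"
        unfolding vs by auto
      also have "\<dots> = {F. insert x A \<subseteq> F \<and> F \<subseteq> insert x B \<union> set ws \<and> path_matching ws F \<le> Suc j \<and> y \<notin> F}"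
        by (auto simp: path_matching_notin)
      also have "\<dots> = {F. insert x A \<subseteq> F \<and> F \<subseteq> insert x B \<union> set ws \<and> path_matching ws F \<le> Suc j}"
        using dist by auto
      also have "good r \<dots>"
      proof (rule good_full)
        show "r \<le> card (insert x B \<union> set ws)"
          using card_Un_set[of "insert x B" ws] Suc.prems(2,6) dist by simp
        show "path_matching ws F \<le> Suc j" for F
          using path_matching_le[of ws F] dist(3) by simp
      qed (use Suc.prems in auto)
      finally show "good r {F \<in> {F \<in> ?\<F>. x \<in> F}. y \<notin> F}" .
    qed
  qed
qed

section \<open>Paths with an edge-free initial segment\<close>

abbreviation edge_free :: "'v list \<Rightarrow> 'v set \<Rightarrow> bool" where
  "edge_free zs F \<equiv> successively (\<lambda>u v. \<not> (u \<in> F \<and> v \<in> F)) zs"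

text \<open>
  Deciding about the second vertex of \<open>zs\<close> shortens \<open>zs\<close> by three (the vertex is in) or by two (it is out),
  at the gain of one vertex in either case.
\<close>

lemma good_independent_path:
  fixes c :: "nat \<Rightarrow> nat" and ys :: "'v list"
  assumes base: "\<And>A B (zs :: 'v list). length zs \<le> 2 \<Longrightarrow> A \<subseteq> B \<Longrightarrow> finite B \<Longrightarrow> distinct (zs @ ys) \<Longrightarrow>
      B \<inter> set (zs @ ys) = {} \<Longrightarrow> r \<le> card B + c (length zs) \<Longrightarrow>
      good r {F. A \<subseteq> F \<and> F \<subseteq> B \<union> set (zs @ ys) \<and> edge_free zs F \<and> path_matching (zs @ ys) F \<le> j}"
    and step: "\<And>b. c (b + 3) \<le> Suc (c b)" "\<And>b. c (b + 3) \<le> Suc (c (b + 1))"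
    and "A \<subseteq> B" "finite B" "distinct (zs @ ys)" "B \<inter> set (zs @ ys) = {}" "r \<le> card B + c (length zs)"
  shows "good r {F. A \<subseteq> F \<and> F \<subseteq> B \<union> set (zs @ ys) \<and> edge_free zs F \<and> path_matching (zs @ ys) F \<le> j}"
  using assms(4-)
proof (induction zs arbitrary: A B rule: length_induct)
  case (1 zs)
  note IH = 1(1)[rule_format]
  let ?\<F> = "{F. A \<subseteq> F \<and> F \<subseteq> B \<union> set (zs @ ys) \<and> edge_free zs F \<and> path_matching (zs @ ys) F \<le> j}"
  show ?case
  proof (cases "length zs \<le> 2")
    case True
    then show ?thesis using 1(2-6) by (rule base)
  next
    case False
    then obtain x y z ws where zs: "zs = x # y # z # ws"
      by (cases zs; cases "tl zs"; cases "tl (tl zs)") auto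
    note dist = 1(4,5)[unfolded zs]
    \<comment> \<open>\<open>c b\<close> is the number of vertices that an edge-free segment of
      length \<open>b\<close> together with \<open>ys\<close> has to contribute to the top of an
      interval. The hypotheses \<open>step\<close> say that one gained vertex pays for three or for
      two lost positions.\<close>
    have c: "c (length zs) \<le> Suc (c (length ws))" "c (length zs) \<le> Suc (c (length (z # ws)))"
      using step[of "length ws"] by (simp_all add: zs numeral_3_eq_3)
    show "good r ?\<F>"
    proof (rule good_query[of r _ y])
      have xz: "F \<subseteq> insert y B \<union> set (ws @ ys) \<Longrightarrow> x \<notin> F \<and> z \<notin> F" for F
        using dist by auto
      \<comment> \<open>As \<open>zs\<close> spans no edge of \<open>F\<close>, having
        \<open>y\<close> in forces its neighbours \<open>x\<close> and \<open>z\<close> out.\<close>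
      have iff: "F \<in> ?\<F> \<and> y \<in> F \<longleftrightarrow> insert y A \<subseteq> F \<and> F \<subseteq> insert y B \<union> set (ws @ ys)
          \<and> edge_free ws F \<and> path_matching (ws @ ys) F \<le> j" for F
      proof (cases "y \<in> F \<and> x \<notin> F \<and> z \<notin> F")
        case True
        then have "edge_free zs F \<longleftrightarrow> edge_free ws F"
          unfolding zs by (cases ws) auto
        moreover have "path_matching (zs @ ys) F = path_matching (ws @ ys) F"
          using True unfolding zs by (simp add: path_matching_notin)
        moreover have "F \<subseteq> B \<union> set (zs @ ys) \<longleftrightarrow> F \<subseteq> insert y B \<union> set (ws @ ys)"
          using True unfolding zs by auto
        ultimately show ?thesis using True by simp
      next
        case False
        moreover have "\<not> edge_free zs F" if "y \<in> F"
          using False that unfolding zs by auto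
        moreover have "x \<notin> F \<and> z \<notin> F" if "F \<subseteq> insert y B \<union> set (ws @ ys)"
          by (rule xz[OF that])
        ultimately have "\<not> (y \<in> F \<and> F \<in> ?\<F>)" "\<not> F \<subseteq> insert y B \<union> set (ws @ ys) \<or> y \<notin> F"
          by auto
        then show ?thesis by auto
      qed
      have "{F \<in> ?\<F>. y \<in> F} = {F. insert y A \<subseteq> F \<and> F \<subseteq> insert y B \<union> set (ws @ ys)
          \<and> edge_free ws F \<and> path_matching (ws @ ys) F \<le> j}"
        by (rule Collect_cong) (rule iff)
      also have "good r \<dots>"
        by (rule IH) (use 1(2,3,6) dist c(1) zs in auto)
      finally show "good r {F \<in> ?\<F>. y \<in> F}" .
      \<comment> \<open>With \<open>y\<close> out, the end vertex \<open>x\<close> has no neighbour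
        left and becomes free, hence it moves into \<open>B\<close>.\<close>
      have iff: "F \<in> ?\<F> \<and> y \<notin> F \<longleftrightarrow> A \<subseteq> F \<and> F \<subseteq> insert x B \<union> set ((z # ws) @ ys)
          \<and> edge_free (z # ws) F \<and> path_matching ((z # ws) @ ys) F \<le> j" for F
      proof (cases "y \<in> F")
        case True
        then have "\<not> F \<subseteq> insert x B \<union> set ((z # ws) @ ys)" using dist by auto
        with True show ?thesis by blast
      next
        case False
        then have "edge_free zs F \<longleftrightarrow> edge_free (z # ws) F"
          unfolding zs by auto
        moreover have "path_matching (zs @ ys) F = path_matching ((z # ws) @ ys) F"
          using False unfolding zs by (simp add: path_matching_notin)
        moreover have "F \<subseteq> B \<union> set (zs @ ys) \<longleftrightarrow> F \<subseteq> insert x B \<union> set ((z # ws) @ ys)"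
          using False unfolding zs by auto
        ultimately show ?thesis using False by simp
      qed
      have "{F \<in> ?\<F>. y \<notin> F} = {F. A \<subseteq> F \<and> F \<subseteq> insert x B \<union> set ((z # ws) @ ys)
          \<and> edge_free (z # ws) F \<and> path_matching ((z # ws) @ ys) F \<le> j}"
        by (rule Collect_cong) (rule iff)
      also have "good r \<dots>"
        by (rule IH) (use 1(2,3,6) dist c(2) zs in auto)
      finally show "good r {F \<in> ?\<F>. y \<notin> F}" .
    qed
  qed
qed

lemma list_length_le_2_cases:
  assumes "length zs \<le> 2"
  obtains "zs = []" | x where "zs = [x]" | x y where "zs = [x, y]"
  using assms by (cases zs; cases "tl zs"; cases "tl (tl zs)") auto

text \<open>The bound for the whole path \<open>zs @ ys\<close> survives the additional condition on
  \<open>zs\<close>. The lower bound on the length of \<open>ys\<close> supplies the size bounds in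
  \<open>good_path\<close> and \<open>good_path_rooted\<close>.\<close>

lemma good_independent_path_long:
  assumes "A \<subseteq> B" "finite B" "distinct (zs @ ys)" "B \<inter> set (zs @ ys) = {}" "2 * j \<le> length ys"
    and "r \<le> card B + (length ys + length zs + 2) div 3 + j"
  shows "good r {F. A \<subseteq> F \<and> F \<subseteq> B \<union> set (zs @ ys) \<and> edge_free zs F \<and> path_matching (zs @ ys) F \<le> j}"
proof (rule good_independent_path[where c = "\<lambda>b. (length ys + b + 2) div 3 + j"])
  fix A B :: "'a set" and zs :: "'a list"
  assume len: "length zs \<le> 2" and *: "A \<subseteq> B" "finite B" "distinct (zs @ ys)" "B \<inter> set (zs @ ys) = {}"
    "r \<le> card B + ((length ys + length zs + 2) div 3 + j)"
  let ?\<F> = "{F. A \<subseteq> F \<and> F \<subseteq> B \<union> set (zs @ ys) \<and> edge_free zs F \<and> path_matching (zs @ ys) F \<le> j}"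
  show "good r ?\<F>"
    using len
  proof (cases rule: list_length_le_2_cases)
    case 1
    have "good r {F. A \<subseteq> F \<and> F \<subseteq> B \<union> set ys \<and> path_matching ys F \<le> j}"
      by (rule good_path) (use * 1 assms(5) in auto)
    then show ?thesis using 1 by simp
  next
    case (2 x)
    have "good r {F. A \<subseteq> F \<and> F \<subseteq> B \<union> set (x # ys) \<and> path_matching (x # ys) F \<le> j}"
      by (rule good_path) (use * 2 assms(5) in auto)
    then show ?thesis using 2 by simp
  next
    case (3 x y)
    show ?thesis
    \<comment> \<open>If \<open>y\<close> is in, \<open>x\<close> is out and the path is rooted at
      \<open>y\<close>; if \<open>y\<close> is out, \<open>x\<close> is free and \<open>ys\<close>
      is detached.\<close>
    proof (rule good_query[of r _ y])
      have x: "F \<subseteq> insert y B \<union> set ys \<Longrightarrow> x \<notin> F" for F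
        using * 3 by auto
      have "{F \<in> ?\<F>. y \<in> F} = {F. insert y A \<subseteq> F \<and> F \<subseteq> insert y B \<union> set ys \<and> path_matching (y # ys) F \<le> j}"
        unfolding 3 by (auto simp: path_matching_notin x)
      also have "good r \<dots>"
        by (rule good_path_rooted) (use * 3 assms(5) in auto)
      finally show "good r {F \<in> ?\<F>. y \<in> F}" .
      have y: "F \<subseteq> insert x B \<union> set ys \<Longrightarrow> y \<notin> F" for F
        using * 3 by auto
      have "{F \<in> ?\<F>. y \<notin> F} = {F. A \<subseteq> F \<and> F \<subseteq> insert x B \<union> set ys \<and> path_matching ys F \<le> j}"
        unfolding 3 by (auto simp: path_matching_notin y)
      also have "good r \<dots>"
        by (rule good_path) (use * 3 assms(5) in auto)
      finally show "good r {F \<in> ?\<F>. y \<notin> F}" .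
    qed
  qed
qed (use assms in auto)

text \<open>Alone, \<open>ys\<close> is too short for j + 1 disjoint edges and contributes all its
  2j + 1 vertices. For long \<open>ys\<close> this is more than the path bound gives; the edge-free
  part adds a third of its length, rounded down.\<close>

lemma good_independent_path_odd:
  assumes "A \<subseteq> B" "finite B" "distinct (zs @ ys)" "B \<inter> set (zs @ ys) = {}" "length ys = 2 * j + 1"
    and "r \<le> card B + 2 * j + 1 + length zs div 3"
  shows "good r {F. A \<subseteq> F \<and> F \<subseteq> B \<union> set (zs @ ys) \<and> edge_free zs F \<and> path_matching (zs @ ys) F \<le> j}"
proof (rule good_independent_path[where c = "\<lambda>b. 2 * j + 1 + b div 3"])
  fix A B :: "'a set" and zs :: "'a list"
  assume len: "length zs \<le> 2" and *: "A \<subseteq> B" "finite B" "distinct (zs @ ys)" "B \<inter> set (zs @ ys) = {}"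
    "r \<le> card B + (2 * j + 1 + length zs div 3)"
  let ?\<F> = "{F. A \<subseteq> F \<and> F \<subseteq> B \<union> set (zs @ ys) \<and> edge_free zs F \<and> path_matching (zs @ ys) F \<le> j}"
  have full: "path_matching ys F \<le> j" for F
    using path_matching_le[of ys F] assms(5) by simp
  show "good r ?\<F>"
    using len
  proof (cases rule: list_length_le_2_cases)
    case 1
    have "good r {F. A \<subseteq> F \<and> F \<subseteq> B \<union> set ys \<and> path_matching ys F \<le> j}"
      by (rule good_full) (use * 1 full assms(5) card_Un_set[of B ys] in auto)
    then show ?thesis using 1 by simp
  next
    case (2 x)
    have "good r {F. A \<subseteq> F \<and> F \<subseteq> B \<union> set (x # ys) \<and> path_matching (x # ys) F \<le> j}"
      by (rule good_path_even) (use * 2 assms(5) in auto)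
    then show ?thesis using 2 by simp
  next
    case (3 x y)
    show ?thesis
    \<comment> \<open>If \<open>x\<close> is in, \<open>y\<close> is out and \<open>ys\<close> is
      detached; if \<open>x\<close> is out, \<open>y # ys\<close> is an even path and loses only one
      vertex.\<close>
    proof (rule good_query[of r _ x])
      have y: "F \<subseteq> insert x B \<union> set ys \<Longrightarrow> y \<notin> F" for F
        using * 3 by auto
      have "{F \<in> ?\<F>. x \<in> F} = {F. insert x A \<subseteq> F \<and> F \<subseteq> insert x B \<union> set ys \<and> path_matching ys F \<le> j}"
        unfolding 3 by (auto simp: path_matching_notin y)
      also have "good r \<dots>"
        by (rule good_full) (use * 3 full assms(5) card_Un_set[of "insert x B" ys] in auto)
      finally show "good r {F \<in> ?\<F>. x \<in> F}" .
      have x: "F \<subseteq> B \<union> set (y # ys) \<Longrightarrow> x \<notin> F" for F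
        using * 3 by auto
      have "{F \<in> ?\<F>. x \<notin> F} = {F. A \<subseteq> F \<and> F \<subseteq> B \<union> set (y # ys) \<and> path_matching (y # ys) F \<le> j}"
        unfolding 3 by (auto simp: path_matching_notin x[simplified])
      also have "good r \<dots>"
        by (rule good_path_even) (use * 3 assms(5) in auto)
      finally show "good r {F \<in> ?\<F>. x \<notin> F}" .
    qed
  qed
qed (use assms in auto)

section \<open>Faces of a cycle\<close>

text \<open>Here j = k - 1: the faces are the vertex sets with matching number at most
  \<open>j\<close>, and the non-faces are the supports of the monomials in the square-free
  power.\<close>

definition cycle_faces :: "nat \<Rightarrow> nat \<Rightarrow> nat set set" where
  "cycle_faces n j = {F. F \<subseteq> {1..n} \<and> \<not> has_matching (parcs (cycle_graph n)) (Suc j) F}"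

lemma parcs_cycle_graph:
  "(u, v) \<in> parcs (cycle_graph n) \<longleftrightarrow> 1 \<le> u \<and> u < n \<and> v = Suc u \<or> 1 \<le> v \<and> v < n \<and> u = Suc v
    \<or> u = 1 \<and> v = n \<or> u = n \<and> v = 1"
  by (auto simp: cycle_graph_def Let_def)

lemma path_arcs_cut:
  assumes "v \<in> {1..n}" "F \<subseteq> {1..n}" "v \<notin> F"
  shows "parcs (cycle_graph n) \<inter> F \<times> F = path_arcs ([Suc v..<Suc n] @ [1..<v]) \<inter> F \<times> F"
proof -
  have v: "1 \<le> v" "v \<le> n" using assms(1) by auto
  \<comment> \<open>The closing edge between \<open>n\<close> and 1 survives the cut exactly if
    \<open>v\<close> is neither of its ends.\<close>
  have wrap: "(if [Suc v..<Suc n] = [] \<or> [1..<v] = [] then {}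
      else {(last [Suc v..<Suc n], hd [1..<v]), (hd [1..<v], last [Suc v..<Suc n])})
    = (if v < n \<and> 1 < v then {(n, 1), (1, n)} else {})"
    using v by (cases "v < n \<and> 1 < v") (auto simp: hd_upt)
  have arcs: "(x, y) \<in> path_arcs ([Suc v..<Suc n] @ [1..<v]) \<longleftrightarrow>
      (v < x \<and> x < n \<or> 1 \<le> x \<and> Suc x < v) \<and> y = Suc x
      \<or> (v < y \<and> y < n \<or> 1 \<le> y \<and> Suc y < v) \<and> x = Suc y
      \<or> v < n \<and> 1 < v \<and> (x = n \<and> y = 1 \<or> x = 1 \<and> y = n)" for x y
    unfolding path_arcs_append wrap path_arcs_upt
    by (simp add: less_eq_Suc_le[of v, symmetric] del: One_nat_def) blast
  have edge: "1 \<le> x \<and> x < n \<longleftrightarrow> v < x \<and> x < n \<or> 1 \<le> x \<and> Suc x < v" if "x \<noteq> v" "Suc x \<noteq> v" for x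
    using that v by linarith
  have "(x, y) \<in> parcs (cycle_graph n) \<longleftrightarrow> (x, y) \<in> path_arcs ([Suc v..<Suc n] @ [1..<v])"
    if "x \<in> F" "y \<in> F" for x y
  proof -
    have xy: "x \<noteq> v" "y \<noteq> v"
      using that assms(3) by auto
    have "v < n \<and> 1 < v" if "x = 1 \<and> y = n \<or> x = n \<and> y = 1"
      using that xy v by linarith
    moreover have "1 \<le> x \<and> x < n \<longleftrightarrow> v < x \<and> x < n \<or> 1 \<le> x \<and> Suc x < v" if "y = Suc x"
      using edge[of x] xy that by simp
    moreover have "1 \<le> y \<and> y < n \<longleftrightarrow> v < y \<and> y < n \<or> 1 \<le> y \<and> Suc y < v" if "x = Suc y"
      using edge[of y] xy that by simp
    ultimately show ?thesis
      unfolding parcs_cycle_graph arcs by blast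
  qed
  then show ?thesis by auto
qed

lemma cycle_faces_cut:
  assumes "v \<in> {1..n}"
  shows "F \<in> cycle_faces n j \<and> v \<notin> F \<longleftrightarrow>
    F \<subseteq> {1..n} - {v} \<and> path_matching ([Suc v..<Suc n] @ [1..<v]) F \<le> j"
proof -
  have "\<not> has_matching (parcs (cycle_graph n)) (Suc j) F \<longleftrightarrow>
      path_matching ([Suc v..<Suc n] @ [1..<v]) F \<le> j" if "F \<subseteq> {1..n}" "v \<notin> F"
  proof -
    have "distinct ([Suc v..<Suc n] @ [1..<v])" by auto
    from has_matching_path[OF this] show ?thesis
      by (simp only: has_matching_cong[OF path_arcs_cut[OF assms that]] not_less_eq_eq[symmetric] not_not)
  qed
  moreover have "F \<subseteq> {1..n} - {v} \<longleftrightarrow> F \<subseteq> {1..n} \<and> v \<notin> F"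
    by blast
  ultimately show ?thesis
    unfolding cycle_faces_def mem_Collect_eq by blast
qed

lemma has_matching_initial:
  assumes "2 * k \<le> n" "{1..2 * k} \<subseteq> F"
  shows "has_matching (parcs (cycle_graph n)) k F"
  using assms
proof (induction k arbitrary: F)
  case (Suc k)
  have "has_matching (parcs (cycle_graph n)) k (F - {2 * k + 1, 2 * k + 2})"
    by (rule Suc.IH) (use Suc.prems in auto)
  moreover have "(2 * k + 1, 2 * k + 2) \<in> parcs (cycle_graph n)"
    using Suc.prems by (simp add: parcs_cycle_graph)
  moreover have "2 * k + 1 \<in> F" "2 * k + 2 \<in> F"
    using Suc.prems by auto
  ultimately show ?case
    unfolding has_matching.simps by blast
qed simp

lemma edge_free_upt: "edge_free [a..<b] F \<longleftrightarrow> (\<forall>l. a \<le> l \<and> Suc l < b \<longrightarrow> \<not> (l \<in> F \<and> Suc l \<in> F))"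
proof (induction b)
  case (Suc b)
  show ?case
  proof (cases "a < b")
    case True
    then obtain c where c: "b = Suc c" "a \<le> c" by (cases b) auto
    then have "edge_free [a..<Suc b] F \<longleftrightarrow> edge_free [a..<b] F \<and> \<not> (c \<in> F \<and> b \<in> F)"
      by (simp add: successively_append_iff) blast
    moreover have "a \<le> l \<and> Suc l < Suc b \<longleftrightarrow> (a \<le> l \<and> Suc l < b) \<or> l = c" for l
      using c by auto
    ultimately show ?thesis unfolding Suc.IH using c(1) by blast
  next
    case False
    then have "edge_free [a..<Suc b] F" by (cases "a = b") simp_all
    moreover have "\<not> (a \<le> l \<and> Suc l < Suc b)" for l
      using False by auto
    ultimately show ?thesis by blast
  qed
qed simp

lemma edge_free_rev: "edge_free (rev zs) F \<longleftrightarrow> edge_free zs F"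
proof -
  have "(\<lambda>u v. \<not> (v \<in> F \<and> u \<in> F)) = (\<lambda>u v. \<not> (u \<in> F \<and> v \<in> F))" by auto
  then show ?thesis by (simp only: successively_rev)
qed

lemma path_matching_rev_append:
  "distinct (us @ vs) \<Longrightarrow> path_matching (us @ vs) F = path_matching (rev vs @ rev us) F"
  using path_matching_rev[of "us @ vs" F] by simp

text \<open>
  A face containing the vertices 1 and 2 contains a maximal run \<open>1, \<dots>, t\<close>. Then \<open>t + 1\<close> is not in
  the face and the cycle becomes a path starting with this run.
\<close>

lemma good_run:
  assumes "2 * j + 3 \<le> n" "r = (n + 2) div 3 + j" "2 \<le> t" "t \<le> 2 * j + 2"
  shows "good r {F \<in> cycle_faces n j. {1..t} \<subseteq> F}"
  using assms(4,3)
proof (induction t rule: inc_induct)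
  case base
  \<comment> \<open>A run of 2j + 2 vertices already carries j + 1 disjoint edges.\<close>
  have "has_matching (parcs (cycle_graph n)) (Suc j) F" if "{1..2 * j + 2} \<subseteq> F" for F
    by (rule has_matching_initial) (use assms(1) that in auto)
  then have "{F \<in> cycle_faces n j. {1..2 * j + 2} \<subseteq> F} = {}"
    unfolding cycle_faces_def by auto
  then show ?case by (simp only: good.empty)
next
  case (step t)
  let ?\<F> = "{F \<in> cycle_faces n j. {1..t} \<subseteq> F}" and ?ws = "rev [t + 2..<Suc n]"
  have ws: "set ?ws = {t + 2..n}" "length ?ws = n - t - 1" "distinct ?ws"
    by auto
  show ?case
  proof (rule good_query[of r _ "Suc t"])
    have "{F \<in> ?\<F>. Suc t \<in> F} = {F \<in> cycle_faces n j. {1..Suc t} \<subseteq> F}"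
      by (auto simp: atLeastAtMostSuc_conv)
    with step show "good r {F \<in> ?\<F>. Suc t \<in> F}" by (simp only: le_SucI)
    \<comment> \<open>Reversal turns the path into t, ..., 1, n, ..., t + 2, so that the greedy scan
      meets the run first.\<close>
    have cut: "F \<in> ?\<F> \<and> Suc t \<notin> F \<longleftrightarrow> {1..t} \<subseteq> F \<and> F \<subseteq> {1..t} \<union> set ?ws
        \<and> path_matching (rev [1..<Suc t] @ ?ws) F \<le> j" for F
    proof -
      have "{1..n} - {Suc t} = {1..t} \<union> set ?ws"
        unfolding ws using step assms(1) by auto
      moreover have "path_matching ([Suc (Suc t)..<Suc n] @ [1..<Suc t]) F
          = path_matching (rev [1..<Suc t] @ ?ws) F"
        by (subst path_matching_rev_append) auto
      ultimately show ?thesis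
        using cycle_faces_cut[of "Suc t" n F j] step assms(1) by auto
    qed
    show "good r {F \<in> ?\<F>. Suc t \<notin> F}"
    \<comment> \<open>An even run is matched within itself and the path after it starts afresh at
      \<open>n\<close>. In an odd run the scan from \<open>t\<close> downwards leaves vertex 1 over,
      and the remaining path is rooted there.\<close>
    proof (cases "even t")
      case True
      have "{F \<in> ?\<F>. Suc t \<notin> F} = {F. {1..t} \<subseteq> F \<and> F \<subseteq> {1..t} \<union> set ?ws \<and> path_matching ?ws F \<le> j - t div 2}"
      proof (rule Collect_cong)
        fix F
        have "path_matching (rev [1..<Suc t] @ ?ws) F = t div 2 + path_matching ?ws F" if "{1..t} \<subseteq> F"
          by (subst path_matching_full_prefix) (use that True in auto)
        moreover have "t div 2 \<le> j" using True step by presburger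
        ultimately show "(F \<in> ?\<F> \<and> Suc t \<notin> F) = ({1..t} \<subseteq> F \<and> F \<subseteq> {1..t} \<union> set ?ws \<and> path_matching ?ws F \<le> j - t div 2)"
          unfolding cut by auto
      qed
      also have "good r \<dots>"
      proof (rule good_path)
        have "t div 2 \<le> j" "t = 2 * (t div 2)" using True step by presburger+
        then show "r \<le> card {1..t} + length ?ws" "r \<le> card {1..t} + (length ?ws + 2) div 3 + (j - t div 2)"
          unfolding ws assms(2) using step assms(1) by auto
      qed (use ws in auto)
      finally show ?thesis .
    next
      case False
      have "{F \<in> ?\<F>. Suc t \<notin> F} = {F. insert 1 {2..t} \<subseteq> F \<and> F \<subseteq> insert 1 {2..t} \<union> set ?ws
          \<and> path_matching (1 # ?ws) F \<le> j - t div 2}"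
      proof (rule Collect_cong)
        fix F
        have "rev [1..<Suc t] = rev [2..<Suc t] @ [1]"
          using step by (subst upt_conv_Cons) (simp_all add: numeral_2_eq_2)
        then have "path_matching (rev [1..<Suc t] @ ?ws) F = t div 2 + path_matching (1 # ?ws) F"
          if "{1..t} \<subseteq> F"
        proof -
          have "even (length (rev [2..<Suc t]))" "length (rev [2..<Suc t]) div 2 = t div 2"
            using False by (auto elim: oddE simp del: upt_Suc)
          moreover have "set (rev [2..<Suc t]) \<subseteq> F"
            using that by (auto simp del: upt_Suc)
          ultimately show ?thesis
            using path_matching_full_prefix[of "rev [2..<Suc t]" F "1 # ?ws"]
              \<open>rev [1..<Suc t] = _\<close> by (simp del: upt_Suc)
        qed
        moreover have "t div 2 \<le> j" using step by presburger
        moreover have "{1..t} = insert 1 {2..t}" using step by auto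
        ultimately show "(F \<in> ?\<F> \<and> Suc t \<notin> F) = (insert 1 {2..t} \<subseteq> F
            \<and> F \<subseteq> insert 1 {2..t} \<union> set ?ws \<and> path_matching (1 # ?ws) F \<le> j - t div 2)"
          unfolding cut by auto
      qed
      also have "good r \<dots>"
      proof (rule good_path_rooted)
        have "t div 2 \<le> j" "t = 2 * (t div 2) + 1" using False step by presburger+
        then show "r \<le> card {2..t} + length ?ws + 1"
          "r \<le> card {2..t} + (length ?ws + 4) div 3 + (j - t div 2)"
          unfolding ws assms(2) using step assms(1) by auto
      qed (use ws in auto)
      finally show ?thesis .
    qed
  qed
qed

text \<open>The vertex \<open>m\<close> must be out, since otherwise it would form an edge with
  \<open>Suc m\<close> among the first vertices. Cutting at \<open>m\<close> puts the pair at the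
  front of a path, where it is matched. There remain n - 3 vertices, of which 1, ..., m - 1 span no
  edge, and \<open>j\<close> drops by one: 2 + ceil((n-3)/3) + (j-1) = ceil(n/3) + j. Reversal
  brings the edge-free part to the front of the remaining path.\<close>

lemma good_pair:
  assumes "1 \<le> j" "1 \<le> m" "m + 2 * j + 3 \<le> n" "r = (n + 2) div 3 + j"
  shows "good r {F \<in> cycle_faces n j.
    (\<forall>l. 1 \<le> l \<and> l < Suc m \<longrightarrow> \<not> (l \<in> F \<and> Suc l \<in> F)) \<and> {Suc m, Suc (Suc m)} \<subseteq> F}"
proof -
  let ?zs = "rev [1..<m]" and ?ys = "rev [m + 3..<Suc n]" and ?P = "{Suc m, Suc (Suc m)}"
  have "{F \<in> cycle_faces n j. (\<forall>l. 1 \<le> l \<and> l < Suc m \<longrightarrow> \<not> (l \<in> F \<and> Suc l \<in> F)) \<and> ?P \<subseteq> F}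
    = {F. ?P \<subseteq> F \<and> F \<subseteq> ?P \<union> set (?zs @ ?ys) \<and> edge_free ?zs F \<and> path_matching (?zs @ ?ys) F \<le> j - 1}"
  proof (rule Collect_cong)
    fix F
    have set: "{1..n} - {m} = ?P \<union> set (?zs @ ?ys)"
    proof (rule Set.set_eqI)
      show "x \<in> {1..n} - {m} \<longleftrightarrow> x \<in> ?P \<union> set (?zs @ ?ys)" for x
        using assms(2,3) by (simp del: upt_Suc) linarith
    qed
    have ind: "(\<forall>l. 1 \<le> l \<and> l < Suc m \<longrightarrow> \<not> (l \<in> F \<and> Suc l \<in> F)) \<longleftrightarrow> m \<notin> F \<and> edge_free ?zs F"
      if "?P \<subseteq> F"
    proof -
      have zs: "edge_free ?zs F \<longleftrightarrow> (\<forall>l. 1 \<le> l \<and> Suc l < m \<longrightarrow> \<not> (l \<in> F \<and> Suc l \<in> F))"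
        by (simp only: edge_free_rev edge_free_upt)
      show ?thesis
        unfolding zs
      proof
        assume H: "\<forall>l. 1 \<le> l \<and> l < Suc m \<longrightarrow> \<not> (l \<in> F \<and> Suc l \<in> F)"
        from H[rule_format, of m] have "m \<notin> F"
          using assms(2) that by simp
        moreover have "\<not> (l \<in> F \<and> Suc l \<in> F)" if "1 \<le> l \<and> Suc l < m" for l
          by (rule H[rule_format]) (use that in simp)
        ultimately show "m \<notin> F \<and> (\<forall>l. 1 \<le> l \<and> Suc l < m \<longrightarrow> \<not> (l \<in> F \<and> Suc l \<in> F))"
          by blast
      next
        assume H: "m \<notin> F \<and> (\<forall>l. 1 \<le> l \<and> Suc l < m \<longrightarrow> \<not> (l \<in> F \<and> Suc l \<in> F))"
        show "\<forall>l. 1 \<le> l \<and> l < Suc m \<longrightarrow> \<not> (l \<in> F \<and> Suc l \<in> F)"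
        proof (intro allI impI)
          fix l assume l: "1 \<le> l \<and> l < Suc m"
          consider "Suc l < m" | "Suc l = m" | "l = m" using l by linarith
          then show "\<not> (l \<in> F \<and> Suc l \<in> F)"
          proof cases
            case 1
            then show ?thesis by (intro H[THEN conjunct2, rule_format]) (use l in simp)
          next
            case 2
            with H show ?thesis by blast
          next
            case 3
            with H show ?thesis by blast
          qed
        qed
      qed
    qed
    have pm: "path_matching ([Suc m..<Suc n] @ [1..<m]) F \<le> j \<longleftrightarrow> path_matching (?zs @ ?ys) F \<le> j - 1"
      if "?P \<subseteq> F"
    proof -
      have "[Suc m..<Suc n] = Suc m # Suc (Suc m) # [m + 3..<Suc n]"
        using assms(3) by (simp add: upt_conv_Cons numeral_3_eq_3 del: upt_Suc)
      then have "path_matching ([Suc m..<Suc n] @ [1..<m]) F = Suc (path_matching ([m + 3..<Suc n] @ [1..<m]) F)"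
        using that by (simp del: upt_Suc)
      also have "path_matching ([m + 3..<Suc n] @ [1..<m]) F = path_matching (?zs @ ?ys) F"
        by (rule path_matching_rev_append) (auto simp del: upt_Suc)
      finally show ?thesis using assms(1) by linarith
    qed
    show "(F \<in> cycle_faces n j \<and> (\<forall>l. 1 \<le> l \<and> l < Suc m \<longrightarrow> \<not> (l \<in> F \<and> Suc l \<in> F)) \<and> ?P \<subseteq> F)
      = (?P \<subseteq> F \<and> F \<subseteq> ?P \<union> set (?zs @ ?ys) \<and> edge_free ?zs F \<and> path_matching (?zs @ ?ys) F \<le> j - 1)"
    proof (cases "?P \<subseteq> F")
      case True
      have "F \<in> cycle_faces n j \<and> m \<notin> F \<longleftrightarrow> F \<subseteq> ?P \<union> set (?zs @ ?ys) \<and> path_matching (?zs @ ?ys) F \<le> j - 1"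
        using cycle_faces_cut[of m n F j] assms(2,3) unfolding set pm[OF True] by simp
      then show ?thesis unfolding ind[OF True] using True by blast
    next
      case False
      then show ?thesis by (simp only: simp_thms)
    qed
  qed
  also have "good r \<dots>"
  proof (rule good_independent_path_long)
    show "distinct (?zs @ ?ys)" "?P \<inter> set (?zs @ ?ys) = {}"
      by (auto simp del: upt_Suc)
    have len: "length ?ys = n - m - 2" "length ?zs = m - 1"
      by (simp_all del: upt_Suc)
    show "2 * (j - 1) \<le> length ?ys"
      unfolding len using assms(1-3) by linarith
    have sum: "length ?ys + length ?zs + 2 = n - 1"
      unfolding len using assms(2,3) by linarith
    have n: "n + 2 = (n - 1) + 3" using assms(3) by linarith
    have "(n + 2) div 3 = (n - 1) div 3 + 1"
      unfolding n by (rule div_add_self2) simp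
    then have "r = 2 + (n - 1) div 3 + (j - 1)"
      unfolding assms(4) using assms(1) by (cases j) simp_all
    moreover have "card ?P = 2" by simp
    ultimately show "r \<le> card ?P + (length ?ys + length ?zs + 2) div 3 + (j - 1)"
      unfolding sum by simp
    show "?P \<subseteq> ?P" by (rule subset_refl)
    show "finite ?P" by (simp only: finite.intros)
  qed
  finally show ?thesis .
qed

lemma div_3_add: "3 \<le> n \<Longrightarrow> (n + 2) div 3 = Suc ((n - 1) div 3)"
proof -
  assume "3 \<le> n"
  then have n: "n + 2 = (n - 1) + 3" by linarith
  have "(n + 2) div 3 = (n - 1) div 3 + 1"
    unfolding n by (rule div_add_self2) simp
  then show ?thesis by (simp only: Suc_eq_plus1)
qed

lemma upt_append_upt: "a \<le> b \<Longrightarrow> b \<le> c \<Longrightarrow> [a..<b] @ [b..<c] = [a..<c]"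
  by (metis le_add_diff_inverse upt_add_eq_append)

text \<open>The end of the splitting: the first \<open>b\<close> vertices span no edge and 2j + 1
  vertices follow. With 1 out this is \<open>good_independent_path_odd\<close>, which is stronger
  here than the path bound. With 1 in, vertex 2 is out and the cycle is cut there instead.\<close>

lemma good_last:
  assumes "1 \<le> j" "2 * j + 3 \<le> n" "r = (n + 2) div 3 + j" "b = n - 1 - 2 * j"
  shows "good r {F \<in> cycle_faces n j. \<forall>l. 1 \<le> l \<and> l < b \<longrightarrow> \<not> (l \<in> F \<and> Suc l \<in> F)}"
    (is "good r ?\<F>")
proof (rule good_query[of r _ 1])
  have b: "2 \<le> b" "b < n" "n = b + 2 * j + 1" using assms(2,4) by linarith+
  let ?ys = "[Suc b..<Suc n]" and ?zs = "[2..<Suc b]"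
  have "?zs @ ?ys = [2..<Suc n]"
    by (rule upt_append_upt) (use b in simp_all)
  then have list: "[Suc 1..<Suc n] @ [1..<1] = ?zs @ ?ys"
    by (simp add: numeral_2_eq_2 del: upt_Suc)
  have "{F \<in> ?\<F>. 1 \<notin> F} = {F. {} \<subseteq> F \<and> F \<subseteq> {} \<union> set (?zs @ ?ys) \<and> edge_free ?zs F \<and> path_matching (?zs @ ?ys) F \<le> j}"
  proof (rule Collect_cong)
    fix F
    have set: "{1..n} - {1} = {} \<union> set (?zs @ ?ys)"
      unfolding \<open>?zs @ ?ys = _\<close> by auto
    have cut: "F \<in> cycle_faces n j \<and> 1 \<notin> F \<longleftrightarrow> F \<subseteq> {} \<union> set (?zs @ ?ys) \<and> path_matching (?zs @ ?ys) F \<le> j"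
      using cycle_faces_cut[of 1 n F j] b unfolding set list by simp
    have "(\<forall>l. 1 \<le> l \<and> l < b \<longrightarrow> \<not> (l \<in> F \<and> Suc l \<in> F)) \<longleftrightarrow> edge_free ?zs F" if "1 \<notin> F"
    proof -
      have "1 \<le> l \<and> l < b \<longleftrightarrow> 2 \<le> l \<and> Suc l < Suc b \<or> l = 1" for l using b by auto
      with that show ?thesis unfolding edge_free_upt by blast
    qed
    then show "(F \<in> ?\<F> \<and> 1 \<notin> F) = ({} \<subseteq> F \<and> F \<subseteq> {} \<union> set (?zs @ ?ys) \<and> edge_free ?zs F \<and> path_matching (?zs @ ?ys) F \<le> j)"
      using cut unfolding mem_Collect_eq by blast
  qed
  also have "good r \<dots>"
  proof (rule good_independent_path_odd)
    show "distinct (?zs @ ?ys)" by (auto simp del: upt_Suc)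
    show "length ?ys = 2 * j + 1" using b by (simp del: upt_Suc)
    have "length ?zs = b - 1" by (simp del: upt_Suc)
    \<comment> \<open>This uses j >= 1, that is k >= 2: the comparison is 2j + 3 <= 3j + 2. For j =
      0 the inequality fails if b = n - 1 is divisible by 3.\<close>
    moreover have "(b + 2 * j + 3) div 3 + j \<le> 2 * j + 1 + (b - 1) div 3"
    proof -
      have "(b + 2 * j + 3) div 3 \<le> ((b - 1) + 3 * (j + 1)) div 3"
        using assms(1) b(1) by (intro div_le_mono) simp
      also have "\<dots> = (b - 1) div 3 + (j + 1)" by simp
      finally show ?thesis by linarith
    qed
    moreover have "n + 2 = b + 2 * j + 3" using b by linarith
    ultimately show "r \<le> card ({} :: nat set) + 2 * j + 1 + length ?zs div 3"
      unfolding assms(3) by simp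
  qed simp_all
  finally show "good r {F \<in> ?\<F>. 1 \<notin> F}" .
  let ?ys = "[Suc b..<n]" and ?zs = "[3..<Suc b]"
  have split: "?zs @ ?ys = [3..<n]"
    by (rule upt_append_upt) (use b in simp_all)
  have len: "length ?ys = 2 * j" "length ?ys + length ?zs + 2 = n - 1"
    using b by (simp_all del: upt_Suc)
  have dist: "distinct (?zs @ ?ys)" "set (?zs @ ?ys) = {3..<n}"
    unfolding split by auto
  \<comment> \<open>Cut at 2 and reversed, the path starts with 1 and its only remaining neighbour
    \<open>n\<close>.\<close>
  have key: "F \<in> ?\<F> \<and> 1 \<in> F \<longleftrightarrow> 1 \<in> F \<and> F \<subseteq> {1, n} \<union> set (?zs @ ?ys) \<and> edge_free ?zs F
      \<and> path_matching (1 # n # rev (?zs @ ?ys)) F \<le> j" for F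
  proof -
    have "{1..n} - {2} = {1, n} \<union> set (?zs @ ?ys)"
      unfolding dist(2) using b by auto
    moreover have "path_matching ([Suc 2..<Suc n] @ [1..<2]) F = path_matching (1 # n # rev (?zs @ ?ys)) F"
    proof -
      have "[Suc 2..<Suc n] = [3..<n] @ [n]"
        using b by simp
      moreover have "[1..<2] = [1::nat]"
        by (simp add: numeral_2_eq_2)
      ultimately have rev: "rev ([Suc 2..<Suc n] @ [1..<2]) = 1 # n # rev [3..<n]"
        by (simp only: rev_append rev.simps append.simps)
      have "distinct ([Suc 2..<Suc n] @ [1..<2])"
        by (auto simp del: upt_Suc)
      from path_matching_rev[OF this, of F] show ?thesis
        unfolding split rev by (rule sym)
    qed
    ultimately have cut: "F \<in> cycle_faces n j \<and> 2 \<notin> F \<longleftrightarrow> F \<subseteq> {1, n} \<union> set (?zs @ ?ys)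
        \<and> path_matching (1 # n # rev (?zs @ ?ys)) F \<le> j"
      using cycle_faces_cut[of 2 n F j] b by simp
    have "(\<forall>l. 1 \<le> l \<and> l < b \<longrightarrow> \<not> (l \<in> F \<and> Suc l \<in> F)) \<longleftrightarrow> 2 \<notin> F \<and> edge_free ?zs F" if "1 \<in> F"
    proof -
      have "1 \<le> l \<and> l < b \<longleftrightarrow> 3 \<le> l \<and> Suc l < Suc b \<or> l = 1 \<or> l = 2 \<and> l < b" for l using b by auto
      with that show ?thesis unfolding edge_free_upt by (metis Suc_1)
    qed
    with cut show ?thesis unfolding mem_Collect_eq by blast
  qed
  show "good r {F \<in> ?\<F>. 1 \<in> F}"
  \<comment> \<open>With \<open>n\<close> in, the pair is matched and gives 2 + ceil((n-3)/3) +
    (j-1); with \<open>n\<close> out, 1 is isolated and gives 1 + ceil((n-3)/3) + j. Both equal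
    ceil(n/3) + j.\<close>
  proof (rule good_query[of r _ n])
    have "{F \<in> {F \<in> ?\<F>. 1 \<in> F}. n \<in> F} = {F. {1, n} \<subseteq> F \<and> F \<subseteq> {1, n} \<union> set (?zs @ ?ys)
        \<and> edge_free ?zs F \<and> path_matching (?zs @ ?ys) F \<le> j - 1}"
    proof (rule Collect_cong)
      fix F
      have "path_matching (1 # n # rev (?zs @ ?ys)) F \<le> j \<longleftrightarrow> path_matching (?zs @ ?ys) F \<le> j - 1"
        if "1 \<in> F" "n \<in> F"
      proof -
        have "path_matching (1 # n # rev (?zs @ ?ys)) F = Suc (path_matching (?zs @ ?ys) F)"
          unfolding path_matching.simps path_matching_rev[OF dist(1)] using that by (simp only: simp_thms if_True)
        then show ?thesis using assms(1) by linarith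
      qed
      then show "(F \<in> {F \<in> ?\<F>. 1 \<in> F} \<and> n \<in> F) = ({1, n} \<subseteq> F \<and> F \<subseteq> {1, n} \<union> set (?zs @ ?ys)
          \<and> edge_free ?zs F \<and> path_matching (?zs @ ?ys) F \<le> j - 1)"
        unfolding mem_Collect_eq using key[of F, unfolded mem_Collect_eq] by blast
    qed
    also have "good r \<dots>"
    proof (rule good_independent_path_long)
      show "{1, n} \<inter> set (?zs @ ?ys) = {}" unfolding dist(2) by auto
      show "2 * (j - 1) \<le> length ?ys" unfolding len by simp
      have "card {1, n} = 2" using b by simp
      then show "r \<le> card {1, n} + (length ?ys + length ?zs + 2) div 3 + (j - 1)"
        unfolding len(2) assms(3) using div_3_add[of n] assms(1,2) by (cases j) simp_all
    qed (simp_all only: subset_refl finite.intros dist)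
    finally show "good r {F \<in> {F \<in> ?\<F>. 1 \<in> F}. n \<in> F}" .
    have "{F \<in> {F \<in> ?\<F>. 1 \<in> F}. n \<notin> F} = {F. {1} \<subseteq> F \<and> F \<subseteq> {1} \<union> set (?zs @ ?ys)
        \<and> edge_free ?zs F \<and> path_matching (?zs @ ?ys) F \<le> j}"
    proof (rule Collect_cong)
      fix F
      have pm: "path_matching (1 # n # rev (?zs @ ?ys)) F = path_matching (?zs @ ?ys) F" if "n \<notin> F"
        unfolding path_matching.simps path_matching_notin[OF that] path_matching_rev[OF dist(1)]
        using that by (simp only: simp_thms if_False)
      have "n \<notin> {1} \<union> set (?zs @ ?ys)" unfolding dist(2) using b by simp
      then have "F \<subseteq> {1, n} \<union> set (?zs @ ?ys) \<and> n \<notin> F \<longleftrightarrow> F \<subseteq> {1} \<union> set (?zs @ ?ys)"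
        by blast
      with pm show "(F \<in> {F \<in> ?\<F>. 1 \<in> F} \<and> n \<notin> F) = ({1} \<subseteq> F \<and> F \<subseteq> {1} \<union> set (?zs @ ?ys)
          \<and> edge_free ?zs F \<and> path_matching (?zs @ ?ys) F \<le> j)"
        unfolding mem_Collect_eq using key[of F, unfolded mem_Collect_eq] by (metis insert_subset empty_subsetI)
    qed
    also have "good r \<dots>"
    proof (rule good_independent_path_long)
      show "{1} \<inter> set (?zs @ ?ys) = {}" unfolding dist(2) by auto
      show "2 * j \<le> length ?ys" unfolding len by simp
      show "r \<le> card {1 :: nat} + (length ?ys + length ?zs + 2) div 3 + j"
        unfolding len(2) assms(3) using div_3_add[of n] assms(2) by simp
    qed (simp_all only: subset_refl finite.intros dist)
    finally show "good r {F \<in> {F \<in> ?\<F>. 1 \<in> F}. n \<notin> F}" .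
  qed
qed

text \<open>If n = 2j + 2, a matching of j + 1 edges is perfect, and the complex is the boundary of
  a simplex. Otherwise \<open>good_run\<close> and \<open>good_pair\<close> handle the faces
  containing the next edge, and \<open>good_last\<close> those that avoid all the edges in
  question.\<close>

theorem good_cycle_faces:
  assumes "1 \<le> j" "2 * j + 2 \<le> n" "r = (n + 2) div 3 + j"
  shows "good r (cycle_faces n j)"
proof (cases "n = 2 * j + 2")
  case True
  have loop_free: "(v, v) \<notin> parcs (cycle_graph n)" for v
    using assms(2) by (auto simp: parcs_cycle_graph)
  have "\<not> has_matching (parcs (cycle_graph n)) (Suc j) F" if "F \<subset> {1..n}" for F
  proof
    assume "has_matching (parcs (cycle_graph n)) (Suc j) F"
    moreover have "finite F" "card F < card {1..n}"
      using finite_subset[OF psubset_imp_subset[OF that]] psubset_card_mono[OF _ that] by simp_all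
    ultimately show False
      using has_matching_card[of "parcs (cycle_graph n)" "Suc j" F] loop_free True by simp
  qed
  moreover have "has_matching (parcs (cycle_graph n)) (Suc j) {1..n}"
    by (rule has_matching_initial) (use True in auto)
  ultimately have "F \<in> cycle_faces n j \<longleftrightarrow> {} \<subseteq> F \<and> F \<subset> {1..n}" for F
    unfolding cycle_faces_def mem_Collect_eq by (metis empty_subsetI psubsetE psubsetI subset_refl)
  then have "cycle_faces n j = {F. {} \<subseteq> F \<and> F \<subset> {1..n}}"
    by blast
  also have "good r \<dots>"
  proof (rule good_proper)
    \<comment> \<open>The boundary of the simplex provides n - 1 = 2j + 1 vertices; since j >= 1,
      this suffices for \<open>r\<close>.\<close>
    have "(2 * j + 4) div 3 \<le> (3 * (j + 1)) div 3"
      using assms(1) by (intro div_le_mono) simp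
    then show "r \<le> card {1..n} - 1"
      unfolding assms(3) True by simp
  qed simp_all
  finally show ?thesis .
next
  case False
  then have n: "2 * j + 3 \<le> n" using assms(2) by linarith
  \<comment> \<open>\<open>?E 1\<close> is the whole complex. The induction runs downwards from n -
    1 - 2j, with \<open>?E (Suc i)\<close> as the part of \<open>?E i\<close> that avoids the edge
    from \<open>i\<close> to \<open>Suc i\<close>.\<close>
  let ?E = "\<lambda>i. {F \<in> cycle_faces n j. \<forall>l. 1 \<le> l \<and> l < i \<longrightarrow> \<not> (l \<in> F \<and> Suc l \<in> F)}"
  have "good r (?E i)" if "1 \<le> i" "i \<le> n - 1 - 2 * j" for i
    using that(2,1)
  proof (induction i rule: inc_induct)
    case base
    show ?case by (rule good_last[OF assms(1) n assms(3) refl])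
  next
    case (step i)
    show ?case
    proof (rule good.split[where u = "{i, Suc i}"])
      have "{F \<in> ?E i. \<not> {i, Suc i} \<subseteq> F} = ?E (Suc i)"
      proof (rule Collect_cong)
        fix F
        have "1 \<le> l \<and> l < Suc i \<longleftrightarrow> 1 \<le> l \<and> l < i \<or> l = i" for l
          using step.prems by linarith
        then show "(F \<in> ?E i \<and> \<not> {i, Suc i} \<subseteq> F)
          = (F \<in> cycle_faces n j \<and> (\<forall>l. 1 \<le> l \<and> l < Suc i \<longrightarrow> \<not> (l \<in> F \<and> Suc l \<in> F)))"
          unfolding mem_Collect_eq by blast
      qed
      moreover have "good r (?E (Suc i))"
        by (rule step.IH) simp
      ultimately show "good r {F \<in> ?E i. \<not> {i, Suc i} \<subseteq> F}" by (simp only:)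
      show "good r {F \<in> ?E i. {i, Suc i} \<subseteq> F}"
      proof (cases "i = 1")
        case True
        have "{F \<in> ?E i. {i, Suc i} \<subseteq> F} = {F \<in> cycle_faces n j. {1..2} \<subseteq> F}"
        proof (rule Collect_cong)
          fix F
          have "{i, Suc i} = {1..2}" using True by auto
          moreover have "\<not> (1 \<le> l \<and> l < i)" for l using True by linarith
          ultimately show "(F \<in> ?E i \<and> {i, Suc i} \<subseteq> F) = (F \<in> cycle_faces n j \<and> {1..2} \<subseteq> F)"
            unfolding mem_Collect_eq by (simp only: simp_thms)
        qed
        also have "good r \<dots>"
          by (rule good_run[OF n assms(3)]) simp_all
        finally show ?thesis .
      next
        case False
        then obtain m where m: "i = Suc m" "1 \<le> m" using step.prems by (cases i) auto
        have "m + 2 * j + 3 \<le> n" using step.hyps m(1) by linarith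
        from good_pair[OF assms(1) m(2) this assms(3)] show ?thesis
          unfolding m(1) mem_Collect_eq conj_assoc .
      qed
    qed
  qed
  from this[of 1] show ?thesis using n by simp
qed

section \<open>Square-free powers and depth\<close>

lemma poly_ring_simps:
  "p \<in> carrier (poly_ring V) \<longleftrightarrow> (\<forall>t\<in>Poly_Mapping.keys p. Poly_Mapping.keys t \<subseteq> V)"
  "p \<otimes>\<^bsub>poly_ring V\<^esub> q = p * q" "p \<oplus>\<^bsub>poly_ring V\<^esub> q = p + q"
  "\<one>\<^bsub>poly_ring V\<^esub> = 1" "\<zero>\<^bsub>poly_ring V\<^esub> = 0"
  by (simp_all add: poly_ring_def)

lemma poly_ring_uminus:
  fixes p :: "('v, 'k::comm_ring_1) mvpoly"
  assumes "p \<in> carrier (poly_ring V)"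
  shows "\<ominus>\<^bsub>poly_ring V\<^esub> p = - p"
proof -
  interpret cring "poly_ring V :: ('v, 'k) mvpoly ring" by (rule poly_ring_cring)
  show ?thesis
    by (rule minus_equality) (use assms in \<open>simp_all add: poly_ring_simps\<close>)
qed

lemma poly_ring_minus:
  fixes p q :: "('v, 'k::comm_ring_1) mvpoly"
  assumes "q \<in> carrier (poly_ring V)"
  shows "p \<ominus>\<^bsub>poly_ring V\<^esub> q = p - q"
  by (simp add: a_minus_def poly_ring_uminus[OF assms] poly_ring_simps)

text \<open>Instantiated three times: with divisibility by an edge, with supports that contain a
  matching, and with supports that are non-faces.\<close>

lemma ideal_monomials:
  fixes Q :: "('v \<Rightarrow>\<^sub>0 nat) \<Rightarrow> bool"
  assumes "\<And>s t. Q t \<Longrightarrow> Q (s + t)"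
  shows "ideal {p \<in> carrier (poly_ring V). \<forall>t\<in>Poly_Mapping.keys p. Q t}
    (poly_ring V :: ('v, 'k::comm_ring_1) mvpoly ring)" (is "ideal ?I ?R")
proof -
  interpret cring ?R by (rule poly_ring_cring)
  have mult: "q * p \<in> ?I" if p: "p \<in> ?I" and q: "q \<in> carrier ?R" for p q
  proof -
    have "q * p \<in> carrier ?R"
      using m_closed[OF q, of p] p by (simp add: poly_ring_simps(2))
    moreover have "Q u" if u: "u \<in> Poly_Mapping.keys (q * p)" for u
    proof -
      obtain s t where "t \<in> Poly_Mapping.keys p" "u = s + t"
        using u by (rule keys_times_obtain)
      then show ?thesis using p assms by simp
    qed
    ultimately show ?thesis by simp
  qed
  show ?thesis
  proof (rule idealI)
    show "ring ?R" by (rule ring_axioms)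
    show "subgroup ?I (add_monoid ?R)"
    proof (rule add.subgroupI)
      show "?I \<subseteq> carrier ?R" by auto
      have "0 \<in> ?I" by (simp add: poly_ring_simps)
      then show "?I \<noteq> {}" by blast
      show "\<ominus>\<^bsub>?R\<^esub> p \<in> ?I" if "p \<in> ?I" for p
        using that by (simp add: poly_ring_uminus) (simp add: poly_ring_simps)
      show "p \<oplus>\<^bsub>?R\<^esub> q \<in> ?I" if "p \<in> ?I" "q \<in> ?I" for p q
      proof -
        have "p + q \<in> carrier ?R"
          using a_closed[of p q] that by (simp add: poly_ring_simps(3))
        then show ?thesis
          using that keys_add[of p q] by (auto simp: poly_ring_simps(3))
      qed
    qed
    show "q \<otimes>\<^bsub>?R\<^esub> p \<in> ?I" if "p \<in> ?I" "q \<in> carrier ?R" for p q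
      unfolding poly_ring_simps(2) by (rule mult[OF that])
    show "p \<otimes>\<^bsub>?R\<^esub> q \<in> ?I" if "p \<in> ?I" "q \<in> carrier ?R" for p q
      unfolding poly_ring_simps(2) mult.commute[of p] by (rule mult[OF that])
  qed
qed

lemma ideal_sum_poly_ring:
  fixes I :: "('v, 'k::comm_ring_1) mvpoly set"
  assumes "ideal I R" "R = poly_ring V" "finite A" "\<And>a. a \<in> A \<Longrightarrow> f a \<in> I"
  shows "sum f A \<in> I"
proof -
  have subgroup: "additive_subgroup I (poly_ring V)"
    using ideal.axioms(1)[OF assms(1)] assms(2) by simp
  show ?thesis
    using assms(3,4)
  proof (induction A rule: finite_induct)
    case empty
    show ?case using additive_subgroup.zero_closed[OF subgroup] by (simp add: poly_ring_simps)
  next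
    case (insert a A)
    have "f a \<in> I" "sum f A \<in> I" using insert by auto
    then show ?case
      using additive_subgroup.a_closed[OF subgroup, of "f a" "sum f A"] insert.hyps by (simp add: poly_ring_simps)
  qed
qed

lemma mvpoly_sum_monomials: "p = (\<Sum>t\<in>Poly_Mapping.keys p. Poly_Mapping.single t (Poly_Mapping.lookup p t))"
  by (rule poly_mapping_eqI) (simp add: lookup_sum lookup_single when_def in_keys_iff)

text \<open>The \<open>k\<close> edges need not be disjoint.\<close>

primrec edge_product_dvd :: "('v \<times> 'v) set \<Rightarrow> nat \<Rightarrow> ('v \<Rightarrow>\<^sub>0 nat) \<Rightarrow> bool" where
  "edge_product_dvd E 0 t \<longleftrightarrow> True"
| "edge_product_dvd E (Suc k) t \<longleftrightarrow> (\<exists>(u, v)\<in>E. \<exists>s. edge_product_dvd E k s \<and>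
     t = Poly_Mapping.single u 1 + Poly_Mapping.single v 1 + s)"

lemma edge_product_dvd_add: "edge_product_dvd E k t \<Longrightarrow> edge_product_dvd E k (s + t)"
proof (induction k arbitrary: t)
  case (Suc k)
  then obtain u v r where uv: "(u, v) \<in> E" "edge_product_dvd E k r"
    "t = Poly_Mapping.single u 1 + Poly_Mapping.single v 1 + r" by auto
  have "edge_product_dvd E k (s + r)" by (rule Suc.IH[OF uv(2)])
  moreover have "s + t = Poly_Mapping.single u 1 + Poly_Mapping.single v 1 + (s + r)"
    using uv(3) by (simp add: ac_simps)
  ultimately show ?case using uv(1) by auto
qed simp

lemma edge_product_dvd_mult:
  assumes "edge_product_dvd E k s" "edge_product_dvd E 1 t"
  shows "edge_product_dvd E (Suc k) (s + t)"
proof -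
  obtain u v r where uv: "(u, v) \<in> E" "t = Poly_Mapping.single u 1 + Poly_Mapping.single v 1 + r"
    using assms(2) by auto
  then have "s + t = Poly_Mapping.single u 1 + Poly_Mapping.single v 1 + (r + s)"
    by (simp add: ac_simps)
  with uv(1) edge_product_dvd_add[OF assms(1), of r] show ?thesis by auto
qed

text \<open>With exponents at most 1 no vertex can be used by two of the edges, so the edges of the
  product are disjoint.\<close>

lemma edge_product_dvd_squarefree:
  assumes "edge_product_dvd E k t" "\<And>v. Poly_Mapping.lookup t v \<le> 1"
  shows "has_matching E k (Poly_Mapping.keys t)"
  using assms
proof (induction k arbitrary: t)
  case (Suc k)
  then obtain u v s where uv: "(u, v) \<in> E" "edge_product_dvd E k s"
    and t: "t = Poly_Mapping.single u 1 + Poly_Mapping.single v 1 + s" by auto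
  have lookup: "Poly_Mapping.lookup t x = (if x = u then 1 else 0) + (if x = v then 1 else 0) + Poly_Mapping.lookup s x" for x
    unfolding t by (simp add: lookup_add lookup_single when_def)
  have "Poly_Mapping.lookup s x \<le> 1" for x
    using Suc.prems(2)[of x] unfolding lookup by simp
  then have IH: "has_matching E k (Poly_Mapping.keys s)"
    by (rule Suc.IH[OF uv(2)])
  have "Poly_Mapping.keys s \<subseteq> Poly_Mapping.keys t - {u, v}"
  proof
    fix x assume "x \<in> Poly_Mapping.keys s"
    then have "0 < Poly_Mapping.lookup s x" by (simp add: in_keys_iff)
    then have "x \<noteq> u" "x \<noteq> v" "Poly_Mapping.lookup t x \<noteq> 0"
      using Suc.prems(2)[of x] unfolding lookup by (auto split: if_splits)
    then show "x \<in> Poly_Mapping.keys t - {u, v}"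
      by (simp only: in_keys_iff Diff_iff insert_iff empty_iff simp_thms)
  qed
  with IH have "has_matching E k (Poly_Mapping.keys t - {u, v})"
    by (rule has_matching_mono)
  moreover have "u \<in> Poly_Mapping.keys t" "v \<in> Poly_Mapping.keys t"
    unfolding in_keys_iff lookup by auto
  ultimately show ?case using uv(1) by auto
qed simp

section \<open>Square-free powers of edge ideals\<close>

context
  fixes G :: "'v pair_pre_digraph" and I :: "('v, 'k::field) mvpoly set" and R :: "('v, 'k) mvpoly ring"
  assumes G: "parcs G \<subseteq> pverts G \<times> pverts G" "\<And>v. (v, v) \<notin> parcs G"
  defines "I \<equiv> edge_ideal G" and "R \<equiv> poly_ring (pverts G)"
begin

interpretation R: cring R
  unfolding R_def by (rule poly_ring_cring)

lemma edge_generators_carrier: "{indet u * indet v | u v. (u, v) \<in> parcs G} \<subseteq> carrier R"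
  using G(1) by (auto simp: R_def poly_ring_simps indet_def mult_single keys_plus_nat)

lemma edge_ideal_ideal: "ideal I R"
  unfolding I_def edge_ideal_def R_def[symmetric] by (rule R.genideal_ideal[OF edge_generators_carrier])

lemma edge_ideal_power_Suc: "I [^]\<^bsub>ideals_set R\<^esub> Suc k = ideal_prod R (I [^]\<^bsub>ideals_set R\<^esub> k) I"
  by (simp add: nat_pow_def ideals_set_def)

lemma edge_ideal_power_0: "I [^]\<^bsub>ideals_set R\<^esub> (0::nat) = carrier R"
  by (simp add: nat_pow_def ideals_set_def)

lemma edge_ideal_power_ideal: "ideal (I [^]\<^bsub>ideals_set R\<^esub> (k::nat)) R"
proof (induction k)
  case 0
  show ?case unfolding edge_ideal_power_0 by (rule R.oneideal)
next
  case (Suc k)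
  show ?case unfolding edge_ideal_power_Suc by (rule R.ideal_prod_is_ideal[OF Suc edge_ideal_ideal])
qed

lemma edge_ideal_subset: "I \<subseteq> {p \<in> carrier R. \<forall>t\<in>Poly_Mapping.keys p. edge_product_dvd (parcs G) 1 t}"
  unfolding I_def edge_ideal_def R_def[symmetric]
proof (rule R.genideal_minimal)
  show "ideal {p \<in> carrier R. \<forall>t\<in>Poly_Mapping.keys p. edge_product_dvd (parcs G) 1 t} R"
    unfolding R_def by (rule ideal_monomials) (rule edge_product_dvd_add)
  have "edge_product_dvd (parcs G) 1 (Poly_Mapping.single u 1 + Poly_Mapping.single v 1)"
    if "(u, v) \<in> parcs G" for u v
    using that by (auto intro!: bexI[of _ "(u, v)"])
  then have "\<forall>t\<in>Poly_Mapping.keys (indet u * indet v :: ('v, 'k) mvpoly). edge_product_dvd (parcs G) 1 t"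
    if "(u, v) \<in> parcs G" for u v
    using that by (simp only: indet_def mult_single keys_single) simp
  then show "{indet u * indet v | u v. (u, v) \<in> parcs G}
      \<subseteq> {p \<in> carrier R. \<forall>t\<in>Poly_Mapping.keys p. edge_product_dvd (parcs G) 1 t}"
    using edge_generators_carrier by blast
qed

lemma edge_ideal_power_subset:
  "p \<in> I [^]\<^bsub>ideals_set R\<^esub> (k::nat) \<Longrightarrow> t \<in> Poly_Mapping.keys p \<Longrightarrow> edge_product_dvd (parcs G) k t"
proof (induction k arbitrary: p t)
  case (Suc k)
  from Suc.prems show ?case
    unfolding edge_ideal_power_Suc
  proof (induction p arbitrary: t rule: ideal_prod.induct)
    case (prod i j)
    then have "t \<in> Poly_Mapping.keys (i * j)" by (simp add: R_def poly_ring_simps)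
    then obtain a b where ab: "a \<in> Poly_Mapping.keys i" "b \<in> Poly_Mapping.keys j" "t = a + b"
      by (rule keys_times_obtain)
    have "edge_product_dvd (parcs G) 1 b"
      using edge_ideal_subset prod.hyps(2) ab(2) by blast
    with Suc.IH[OF prod.hyps(1) ab(1)] show ?case
      unfolding ab(3) by (rule edge_product_dvd_mult)
  next
    case (sum p q)
    then have "t \<in> Poly_Mapping.keys p \<union> Poly_Mapping.keys q"
      using keys_add[of p q] by (auto simp: R_def poly_ring_simps)
    then show ?case using sum.IH by blast
  qed
qed simp

lemma smono_in_edge_ideal_power:
  assumes "finite F" "F \<subseteq> pverts G" "has_matching (parcs G) k F"
  shows "Poly_Mapping.single (smono F) 1 \<in> I [^]\<^bsub>ideals_set R\<^esub> k"
  using assms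
proof (induction k arbitrary: F)
  case 0
  then show ?case
    unfolding edge_ideal_power_0 by (simp add: R_def poly_ring_simps)
next
  case (Suc k)
  then obtain u v where uv: "(u, v) \<in> parcs G" "u \<in> F" "v \<in> F" "has_matching (parcs G) k (F - {u, v})"
    by auto
  have ne: "u \<noteq> v" using uv(1) G(2) by auto
  have "F = insert u (insert v (F - {u, v}))" using uv by auto
  then have "smono F = Poly_Mapping.single u 1 + (Poly_Mapping.single v 1 + smono (F - {u, v}))"
    using smono_insert[of "insert v (F - {u, v})" u] smono_insert[of "F - {u, v}" v] ne Suc.prems(1) by simp
  then have eq: "Poly_Mapping.single (smono F) (1::'k)
      = Poly_Mapping.single (smono (F - {u, v})) 1 \<otimes>\<^bsub>R\<^esub> (indet u * indet v)"
    by (simp add: R_def poly_ring_simps indet_def mult_single ac_simps)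
  have "Poly_Mapping.single (smono (F - {u, v})) 1 \<in> I [^]\<^bsub>ideals_set R\<^esub> k"
    by (rule Suc.IH) (use Suc.prems uv in auto)
  moreover have "indet u * indet v \<in> I"
    unfolding I_def edge_ideal_def R_def[symmetric]
    using R.genideal_self[OF edge_generators_carrier] uv(1) by blast
  ultimately show ?case
    unfolding edge_ideal_power_Suc eq by (rule ideal_prod.prod)
qed

text \<open>A square-free generator is divisible by \<open>k\<close> edges, which are disjoint
  because it is square-free. Conversely, a monomial whose support contains a
  \<open>k\<close>-matching is a multiple of the product of its support, which is itself a
  generator.\<close>

lemma squarefree_power_edge_ideal:
  "squarefree_power (pverts G) I k
    = {p \<in> carrier R. \<forall>t\<in>Poly_Mapping.keys p. has_matching (parcs G) k (Poly_Mapping.keys t)}"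
    (is "_ = ?J")
proof -
  let ?S = "{Poly_Mapping.single t (1::'k) | t. \<forall>v. Poly_Mapping.lookup t v \<le> 1} \<inter> I [^]\<^bsub>ideals_set R\<^esub> k"
  have carr: "?S \<subseteq> carrier R"
    using ideal.Icarr[OF edge_ideal_power_ideal] by blast
  have "genideal R ?S \<subseteq> ?J"
  proof (rule R.genideal_minimal)
    show "ideal ?J R"
      unfolding R_def
    proof (rule ideal_monomials)
      fix s t :: "'v \<Rightarrow>\<^sub>0 nat" assume "has_matching (parcs G) k (Poly_Mapping.keys t)"
      then show "has_matching (parcs G) k (Poly_Mapping.keys (s + t))"
        by (rule has_matching_mono) (simp add: keys_plus_nat)
    qed
    show "?S \<subseteq> ?J"
    proof
      fix p assume p: "p \<in> ?S"
      then obtain t where t: "p = Poly_Mapping.single t 1" "\<forall>v. Poly_Mapping.lookup t v \<le> 1" by blast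
      have "edge_product_dvd (parcs G) k t"
        using edge_ideal_power_subset[of p k t] p t(1) by simp
      then have "has_matching (parcs G) k (Poly_Mapping.keys t)"
        by (rule edge_product_dvd_squarefree) (use t(2) in blast)
      then show "p \<in> ?J" using p carr t(1) by auto
    qed
  qed
  moreover have "?J \<subseteq> genideal R ?S"
  proof
    fix p assume p: "p \<in> ?J"
    have ideal: "ideal (genideal R ?S) R" by (rule R.genideal_ideal[OF carr])
    have "(\<Sum>t\<in>Poly_Mapping.keys p. Poly_Mapping.single t (Poly_Mapping.lookup p t)) \<in> genideal R ?S"
    proof (rule ideal_sum_poly_ring[OF ideal R_def[THEN meta_eq_to_obj_eq]])
      fix t assume t: "t \<in> Poly_Mapping.keys p"
      let ?F = "Poly_Mapping.keys t"
      have F: "?F \<subseteq> pverts G" "has_matching (parcs G) k ?F"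
        using p t by (auto simp: R_def poly_ring_simps)
      \<comment> \<open>The product of the support of \<open>t\<close> serves as the generator
        dividing \<open>t\<close>.\<close>
      have "Poly_Mapping.single (smono ?F) 1 \<in> ?S"
        using smono_in_edge_ideal_power[OF _ F] by (auto simp: lookup_smono)
      then have gen: "Poly_Mapping.single (smono ?F) 1 \<in> genideal R ?S"
        using R.genideal_self[OF carr] by blast
      have "(t - smono ?F) + smono ?F = t"
        by (rule poly_mapping_eqI) (simp add: lookup_add lookup_minus lookup_smono in_keys_iff)
      then have "Poly_Mapping.single t (Poly_Mapping.lookup p t)
          = Poly_Mapping.single (t - smono ?F) (Poly_Mapping.lookup p t) \<otimes>\<^bsub>R\<^esub> Poly_Mapping.single (smono ?F) 1"
        by (simp add: R_def poly_ring_simps mult_single)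
      moreover have "Poly_Mapping.keys (t - smono ?F) \<subseteq> ?F"
        by (auto simp: in_keys_iff lookup_minus)
      then have "Poly_Mapping.single (t - smono ?F) (Poly_Mapping.lookup p t) \<in> carrier R"
        using F(1) t by (auto simp: R_def poly_ring_simps)
      ultimately show "Poly_Mapping.single t (Poly_Mapping.lookup p t) \<in> genideal R ?S"
        using ideal.I_l_closed[OF ideal gen] by simp
    qed simp
    then show "p \<in> genideal R ?S"
      using mvpoly_sum_monomials[of p] by simp
  qed
  ultimately show ?thesis
    unfolding squarefree_power_def R_def[symmetric] by (rule subset_antisym)
qed

end

text \<open>Translates the recursion of \<open>wreg\<close> into the form of
  \<open>regular_seq\<close>, which refers to initial segments: the fold is the submodule generated
  by the segment \<open>fs\<close> on top of \<open>N\<close>.\<close>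

lemma wreg_appendD:
  "wreg \<F> N (fs @ gs) \<Longrightarrow> wreg \<F> (foldl (\<lambda>N f. {n + restr \<F> (f * q) |n q. n \<in> N \<and> q \<in> span_mod \<F>}) N fs) gs"
  by (induction fs arbitrary: N) simp_all

section \<open>The quotient by the ideal of non-faces and its depth\<close>

context
  fixes V :: "'v set" and \<Delta> :: "'v set set" and R :: "('v, 'k::field) mvpoly ring"
    and J :: "('v, 'k) mvpoly set" and M :: "(('v, 'k) mvpoly, ('v, 'k) mvpoly set) module"
  assumes down_closed: "\<And>A B. A \<in> \<Delta> \<Longrightarrow> B \<subseteq> A \<Longrightarrow> B \<in> \<Delta>" and \<Delta>_subset: "\<Union>\<Delta> \<subseteq> V"
    and R_eq: "R = poly_ring V"
    and J_eq: "J = {p \<in> carrier R. \<forall>t\<in>Poly_Mapping.keys p. Poly_Mapping.keys t \<notin> \<Delta>}"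
    and M_eq: "M = quotient_module R J"
begin

interpretation R: cring R
  unfolding R_eq by (rule poly_ring_cring)

lemma ideal_J: "ideal J R"
  unfolding J_eq unfolding R_eq
proof (rule ideal_monomials)
  fix s t :: "'v \<Rightarrow>\<^sub>0 nat" assume "Poly_Mapping.keys t \<notin> \<Delta>"
  then show "Poly_Mapping.keys (s + t) \<notin> \<Delta>"
    using down_closed[of "Poly_Mapping.keys (s + t)" "Poly_Mapping.keys t"] by (auto simp: keys_plus_nat)
qed

interpretation J: ideal J R by (rule ideal_J)
interpretation Q: ring "R Quot J" by (rule J.quotient_is_ring)
interpretation h: ring_hom_ring R "R Quot J" "(+>\<^bsub>R\<^esub>) J" by (rule J.rcos_ring_hom_ring)
interpretation M: module R M
  unfolding M_eq by (rule quotient_module_module[OF R.cring_axioms ideal_J])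

abbreviation (input) coset :: "('v, 'k) mvpoly \<Rightarrow> ('v, 'k) mvpoly set" where
  "coset p \<equiv> J +>\<^bsub>R\<^esub> p"

lemma carrier_M: "carrier M = coset ` carrier R"
  unfolding M_eq quotient_module_def FactRing_simps partial_object.select_convs by blast

lemma add_M: "p \<in> carrier R \<Longrightarrow> q \<in> carrier R \<Longrightarrow> coset p \<oplus>\<^bsub>M\<^esub> coset q = coset (p + q)"
  using h.hom_add[of p q] unfolding M_eq quotient_module_def R_eq by (simp add: poly_ring_simps(2-5))

lemma smult_M: "f \<in> carrier R \<Longrightarrow> p \<in> carrier R \<Longrightarrow> f \<odot>\<^bsub>M\<^esub> coset p = coset (f * p)"
  using h.hom_mult[of f p] unfolding M_eq quotient_module_def R_eq by (simp add: poly_ring_simps(2-5))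

lemma zero_M: "\<zero>\<^bsub>M\<^esub> = coset 0"
  using h.hom_zero unfolding M_eq quotient_module_def R_eq by (simp add: poly_ring_simps(2-5))

lemma carrier_R_diff: "p \<in> carrier R \<Longrightarrow> q \<in> carrier R \<Longrightarrow> p - q \<in> carrier R"
  using R.minus_closed[of p q] unfolding R_eq by (simp only: poly_ring_minus)

lemma carrier_R_mult: "p \<in> carrier R \<Longrightarrow> q \<in> carrier R \<Longrightarrow> p * q \<in> carrier R"
  using R.m_closed[of p q] unfolding R_eq by (simp only: poly_ring_simps(2))

lemma carrier_R_add: "p \<in> carrier R \<Longrightarrow> q \<in> carrier R \<Longrightarrow> p + q \<in> carrier R"
  using R.a_closed[of p q] unfolding R_eq by (simp only: poly_ring_simps(3))

lemma zero_carrier_R: "0 \<in> carrier R"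
  using R.zero_closed unfolding R_eq by (simp only: poly_ring_simps(5))

lemma J_iff: "p \<in> carrier R \<Longrightarrow> p \<in> J \<longleftrightarrow> restr \<Delta> p = 0"
  unfolding J_eq restr_def pfilter_eq_0_iff by blast

lemma coset_eq_iff:
  assumes "p \<in> carrier R" "q \<in> carrier R"
  shows "coset p = coset q \<longleftrightarrow> restr \<Delta> p = restr \<Delta> q"
proof -
  have "p \<ominus>\<^bsub>R\<^esub> q = p - q"
    using assms(2) unfolding R_eq by (rule poly_ring_minus)
  then have "coset p = coset q \<longleftrightarrow> p - q \<in> J"
    using R.quotient_eq_iff_same_a_r_cos[OF ideal_J assms] by simp
  also have "\<dots> \<longleftrightarrow> restr \<Delta> p = restr \<Delta> q"
    using J_iff[OF carrier_R_diff[OF assms]] by (simp add: restr_diff)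
  finally show ?thesis .
qed

lemma span_mod_subset: "p \<in> span_mod \<Delta> \<Longrightarrow> p \<in> carrier R"
  using \<Delta>_subset by (auto simp: span_mod_def R_eq poly_ring_simps)

lemma coset_restr: "p \<in> carrier R \<Longrightarrow> coset (restr \<Delta> p) = coset p"
  using coset_eq_iff[OF span_mod_subset[OF restr_in_span_mod]] by (simp add: restr_restr)

lemma order_convex_\<Delta>: "order_convex \<Delta>"
  unfolding order_convex_def
proof (intro ballI allI impI)
  fix A C B assume "C \<in> \<Delta>" "B \<subseteq> C"
  then show "B \<in> \<Delta>" by (rule down_closed)
qed

text \<open>In contrast to \<open>restr_times_restr\<close>, here \<open>p\<close> is any
  polynomial: non-faces are closed under supersets, so a dropped term can never return.\<close>

lemma restr_mult_restr: "restr \<Delta> (f * restr \<Delta> p) = restr \<Delta> (f * p)"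
proof -
  have "restr \<Delta> (f * (p - restr \<Delta> p)) = 0"
  proof (rule restr_eq_0I)
    fix t assume "t \<in> Poly_Mapping.keys (f * (p - restr \<Delta> p))"
    then obtain u where u: "u \<in> Poly_Mapping.keys (p - restr \<Delta> p)" "Poly_Mapping.keys u \<subseteq> Poly_Mapping.keys t"
      by (rule keys_times_mono)
    then have "Poly_Mapping.keys u \<notin> \<Delta>"
      by (auto simp: in_keys_iff lookup_minus restr_def lookup_pfilter split: if_splits)
    with down_closed[OF _ u(2)] show "Poly_Mapping.keys t \<notin> \<Delta>" by metis
  qed
  then show ?thesis by (simp add: right_diff_distrib restr_diff)
qed

abbreviation (input) extend :: "('v, 'k) mvpoly set \<Rightarrow> ('v, 'k) mvpoly \<Rightarrow> ('v, 'k) mvpoly set" where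
  "extend N f \<equiv> {n + restr \<Delta> (f * q) |n q. n \<in> N \<and> q \<in> span_mod \<Delta>}"

lemma foldl_extend:
  assumes "submod \<Delta> N"
  shows "submod \<Delta> (foldl extend N fs) \<and> N \<subseteq> foldl extend N fs \<and>
    (\<forall>f\<in>set fs. \<forall>q\<in>span_mod \<Delta>. restr \<Delta> (f * q) \<in> foldl extend N fs)"
  using assms
proof (induction fs arbitrary: N)
  case (Cons g fs)
  have sub: "submod \<Delta> (extend N g)"
    by (rule submod_extend[OF order_convex_\<Delta> Cons.prems])
  have 1: "N \<subseteq> extend N g"
  proof
    fix n assume "n \<in> N"
    then have "n = n + restr \<Delta> (g * 0)" "n \<in> N" by simp_all
    then show "n \<in> extend N g" using zero_in_span_mod by blast
  qed
  have 2: "restr \<Delta> (g * q) \<in> extend N g" if "q \<in> span_mod \<Delta>" for q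
  proof -
    have "restr \<Delta> (g * q) = 0 + restr \<Delta> (g * q)" "0 \<in> N"
      using Cons.prems by (simp_all add: submod_def)
    with that show ?thesis by blast
  qed
  have IH: "submod \<Delta> (foldl extend (extend N g) fs)" "extend N g \<subseteq> foldl extend (extend N g) fs"
    "\<forall>f\<in>set fs. \<forall>q\<in>span_mod \<Delta>. restr \<Delta> (f * q) \<in> foldl extend (extend N g) fs"
    using Cons.IH[OF sub] by blast+
  have "N \<subseteq> foldl extend (extend N g) fs"
    by (rule subset_trans[OF 1 IH(2)])
  moreover have "restr \<Delta> (f * q) \<in> foldl extend (extend N g) fs"
    if "f \<in> set (g # fs)" "q \<in> span_mod \<Delta>" for f q
    using that IH(3) subsetD[OF IH(2) 2[OF that(2)]] by auto
  ultimately show ?case using IH(1) unfolding foldl.simps by blast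
qed simp

text \<open>A coset is represented by its restriction to the faces. One inclusion holds because the
  right side is a submodule containing all products; for the other, every such submodule contains
  each stage of the fold.\<close>

lemma smult_submodule_M:
  assumes "set fs \<subseteq> carrier R"
  shows "smult_submodule R (set fs) M = {coset p |p. p \<in> carrier R \<and> restr \<Delta> p \<in> foldl extend {0} fs}"
    (is "_ = ?S")
proof (rule subset_antisym)
  let ?N = "foldl extend {0} fs"
  have "submod \<Delta> {0}" by (simp add: submod_def)
  from foldl_extend[OF this, where fs = fs]
  have acc: "submod \<Delta> ?N" "\<And>f q. f \<in> set fs \<Longrightarrow> q \<in> span_mod \<Delta> \<Longrightarrow> restr \<Delta> (f * q) \<in> ?N"
    by blast+
  note N = acc(1)[unfolded submod_def]
  have sub: "submodule ?S R M"
  proof (rule M.submoduleI)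
    show "?S \<subseteq> carrier M" unfolding carrier_M by blast
    have "restr \<Delta> 0 \<in> ?N" unfolding restr_zero by (rule conjunct1[OF N])
    then show "\<zero>\<^bsub>M\<^esub> \<in> ?S" unfolding zero_M using zero_carrier_R by blast
    show "x \<oplus>\<^bsub>M\<^esub> y \<in> ?S" if xy: "x \<in> ?S" "y \<in> ?S" for x y
    proof -
      obtain p q where pq: "x = coset p" "y = coset q" "p \<in> carrier R" "q \<in> carrier R"
        "restr \<Delta> p \<in> ?N" "restr \<Delta> q \<in> ?N"
        using xy by blast
      have "restr \<Delta> (p + q) \<in> ?N"
        using submod_add[OF acc(1) pq(5,6)] by (simp add: restr_add)
      moreover have "x \<oplus>\<^bsub>M\<^esub> y = coset (p + q)" using add_M pq by simp
      ultimately show ?thesis using carrier_R_add pq by blast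
    qed
    show smult: "f \<odot>\<^bsub>M\<^esub> x \<in> ?S" if f: "f \<in> carrier R" and x: "x \<in> ?S" for f x
    proof -
      obtain p where p: "x = coset p" "p \<in> carrier R" "restr \<Delta> p \<in> ?N"
        using x by blast
      have "restr \<Delta> (f * p) \<in> ?N"
        unfolding restr_mult_restr[of f p, symmetric] using N p(3) by blast
      moreover have "f \<odot>\<^bsub>M\<^esub> x = coset (f * p)" using smult_M f p by simp
      ultimately show ?thesis using carrier_R_mult[OF f p(2)] by blast
    qed
    show "\<ominus>\<^bsub>M\<^esub> x \<in> ?S" if x: "x \<in> ?S" for x
    proof -
      obtain p where p: "x = coset p" "p \<in> carrier R" "restr \<Delta> p \<in> ?N"
        using x by blast
      have neg: "0 - p \<in> carrier R" by (rule carrier_R_diff[OF zero_carrier_R p(2)])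
      have "coset (0 - p) \<oplus>\<^bsub>M\<^esub> x = \<zero>\<^bsub>M\<^esub>"
        unfolding p(1) zero_M add_M[OF neg p(2)] by simp
      then have "\<ominus>\<^bsub>M\<^esub> x = coset (0 - p)"
        by (rule M.minus_equality) (use p neg carrier_M in auto)
      moreover have "restr \<Delta> (0 - p) \<in> ?N"
        unfolding restr_diff restr_zero using N p(3) by blast
      ultimately show ?thesis using neg by blast
    qed
  qed
  have prod: "f \<odot>\<^bsub>M\<^esub> x \<in> ?S" if f: "f \<in> set fs" and x: "x \<in> carrier M" for f x
  proof -
    obtain p where p: "x = coset p" "p \<in> carrier R" using x unfolding carrier_M by blast
    have "restr \<Delta> (f * restr \<Delta> p) \<in> ?N" by (rule acc(2)[OF f]) simp
    then have "restr \<Delta> (f * p) \<in> ?N" by (simp only: restr_mult_restr)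
    moreover have "f \<in> carrier R" using f assms by blast
    moreover have "f \<odot>\<^bsub>M\<^esub> x = coset (f * p)" using smult_M[OF _ p(2)] calculation(2) p(1) by simp
    ultimately show ?thesis using carrier_R_mult[OF _ p(2)] by blast
  qed
  show "smult_submodule R (set fs) M \<subseteq> ?S"
    unfolding smult_submodule_def
    by (rule Inter_lower, rule CollectI, intro conjI ballI, rule sub, rule prod)
  have "coset p \<in> S" if S: "submodule S R M" "\<forall>f\<in>set fs. \<forall>m\<in>carrier M. f \<odot>\<^bsub>M\<^esub> m \<in> S"
    and p: "p \<in> carrier R" "restr \<Delta> p \<in> ?N" for S p
  proof -
    \<comment> \<open>Generalized over the starting set \<open>N\<close>, because the fold changes
      its accumulator; the claim needed is the one for \<open>{0}\<close> and
      \<open>fs\<close>.\<close>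
    have *: "coset n \<in> S" if "\<forall>n\<in>N. coset n \<in> S" "N \<subseteq> carrier R" "set gs \<subseteq> set fs" "n \<in> foldl extend N gs"
      for n N gs
      using that
    proof (induction gs arbitrary: N)
      case (Cons g gs)
      have g: "g \<in> set fs" "g \<in> carrier R" using Cons.prems(3) assms by auto
      have ext: "coset x \<in> S \<and> x \<in> carrier R" if x: "x \<in> extend N g" for x
      proof -
        obtain m q where mq: "x = m + restr \<Delta> (g * q)" "m \<in> N" "q \<in> span_mod \<Delta>" using x by blast
        have q: "q \<in> carrier R" by (rule span_mod_subset[OF mq(3)])
        have m: "m \<in> carrier R" using mq(2) Cons.prems(2) by blast
        have gq: "restr \<Delta> (g * q) \<in> carrier R" by (rule span_mod_subset) simp
        have "coset (restr \<Delta> (g * q)) = g \<odot>\<^bsub>M\<^esub> coset q"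
          unfolding smult_M[OF g(2) q] by (rule coset_restr[OF carrier_R_mult[OF g(2) q]])
        then have "coset (restr \<Delta> (g * q)) \<in> S"
          using S(2) g(1) q unfolding carrier_M by auto
        then have "coset m \<oplus>\<^bsub>M\<^esub> coset (restr \<Delta> (g * q)) \<in> S"
          using M.submoduleE(5)[OF S(1)] Cons.prems(1) mq(2) by blast
        then show ?thesis
          unfolding add_M[OF m gq] mq(1) using carrier_R_add[OF m gq] by blast
      qed
      show ?case
        by (rule Cons.IH[of "extend N g"]) (use ext Cons.prems in auto)
    qed simp
    have "coset 0 \<in> S"
      using subgroup.one_closed[OF submodule.axioms(1)[OF S(1)]] zero_M by simp
    then have "coset (restr \<Delta> p) \<in> S"
      by (intro *[of "{0}" fs]) (use p zero_carrier_R in auto)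
    then show ?thesis using coset_restr[OF p(1)] by simp
  qed
  then have "\<forall>p. p \<in> carrier R \<and> restr \<Delta> p \<in> ?N \<longrightarrow> coset p \<in> smult_submodule R (set fs) M"
    unfolding smult_submodule_def Inter_iff mem_Collect_eq by blast
  then show "?S \<subseteq> smult_submodule R (set fs) M"
    by blast
qed

text \<open>\<open>wreg\<close> supplies the cancellation conditions of a regular sequence.
  Properness comes from the ideal: if \<open>X\<close> generates a proper submodule of
  \<open>M\<close>, so does the subset \<open>set fs\<close>; otherwise the depth is infinite by
  definition.\<close>

lemma depth_ge_wreg:
  assumes wreg: "wreg \<Delta> {0} fs" and fs: "set fs \<subseteq> X" "X \<subseteq> carrier R"
  shows "depth R X M \<ge> enat (length fs)"
proof (cases "smult_submodule R X M = carrier M")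
  case False
  have "regular_seq R M fs"
    unfolding regular_seq_def
  proof (intro conjI allI impI ballI)
    show "set fs \<subseteq> carrier R" using fs by blast
    have "smult_submodule R (set fs) M \<subseteq> smult_submodule R X M"
      unfolding smult_submodule_def by (rule Inter_anti_mono) (use fs(1) in blast)
    moreover have "smult_submodule R X M \<subseteq> carrier M"
      unfolding smult_submodule_def
    proof (rule Inter_lower, rule CollectI, intro conjI ballI)
      show "f \<odot>\<^bsub>M\<^esub> m \<in> carrier M" if "f \<in> X" "m \<in> carrier M" for f m
        by (rule M.smult_closed[OF subsetD[OF fs(2) that(1)] that(2)])
    qed (rule M.carrier_is_submodule)
    ultimately show "smult_submodule R (set fs) M \<noteq> carrier M" using False by blast
    fix i m assume i: "i < length fs" and m: "m \<in> carrier M"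
      and reg: "(fs ! i) \<odot>\<^bsub>M\<^esub> m \<in> smult_submodule R (set (take i fs)) M"
    have take: "set (take i fs) \<subseteq> carrier R" using fs set_take_subset[of i fs] by blast
    have f: "fs ! i \<in> carrier R" using i fs nth_mem by blast
    let ?N = "foldl extend {0} (take i fs)"
    obtain p where p: "m = coset p" "p \<in> carrier R" using m unfolding carrier_M by blast
    have "coset (fs ! i * p) \<in> smult_submodule R (set (take i fs)) M"
      using reg unfolding p(1) smult_M[OF f p(2)] .
    then obtain q where q: "coset (fs ! i * p) = coset q" "q \<in> carrier R" "restr \<Delta> q \<in> ?N"
      unfolding smult_submodule_M[OF take] by blast
    have "restr \<Delta> (fs ! i * restr \<Delta> p) \<in> ?N"
      using q(3) coset_eq_iff[OF carrier_R_mult[OF f p(2)] q(2)] q(1) by (simp add: restr_mult_restr)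
    \<comment> \<open>The first \<open>i\<close> elements are absorbed into the submodule, which
      leaves \<open>fs ! i\<close> at the head of the remaining list.\<close>
    moreover have "wreg \<Delta> ?N (fs ! i # drop (Suc i) fs)"
      using wreg_appendD[of \<Delta> "{0}" "take i fs" "drop i fs"] wreg Cons_nth_drop_Suc[OF i] by simp
    ultimately have "restr \<Delta> p \<in> ?N" by simp
    then show "m \<in> smult_submodule R (set (take i fs)) M"
      unfolding smult_submodule_M[OF take] using p by blast
  qed
  then have "enat (length fs) \<in> {enat (length fs) |fs. set fs \<subseteq> X \<and> regular_seq R M fs}"
    using fs(1) by blast
  then show ?thesis
    unfolding depth_def by (simp only: False if_False Sup_upper)
next
  case True
  then have "depth R X M = \<infinity>"
    unfolding depth_def by (rule if_P)
  then show ?thesis by simp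
qed

end

section \<open>Conclusion for the cycle\<close>

lemma esym_in_irrelevant_ideal:
  assumes "finite V"
  shows "esym (Suc l) V \<in> (irrelevant_ideal V :: ('v, 'k::field) mvpoly set)"
proof -
  interpret R: cring "poly_ring V :: ('v, 'k) mvpoly ring" by (rule poly_ring_cring)
  have gen: "indet ` V \<subseteq> carrier (poly_ring V :: ('v, 'k) mvpoly ring)"
    by (auto simp: poly_ring_simps indet_def)
  have ideal: "ideal (irrelevant_ideal V) (poly_ring V :: ('v, 'k) mvpoly ring)"
    unfolding irrelevant_ideal_def by (rule R.genideal_ideal[OF gen])
  show ?thesis
    unfolding esym_def
  proof (rule ideal_sum_poly_ring[OF ideal refl])
    fix S assume S: "S \<in> {S. S \<subseteq> V \<and> card S = Suc l}"
    then have sub: "S \<subseteq> V" "card S = Suc l" by simp_all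
    then have "finite S" using assms by (intro finite_subset[of S V])
    have "S \<noteq> {}" using sub(2) by force
    then obtain v where v: "v \<in> S" by blast
    have "smono (insert v (S - {v})) = Poly_Mapping.single v 1 + smono (S - {v})"
      by (rule smono_insert) (use \<open>finite S\<close> in simp_all)
    then have eq: "smono S = Poly_Mapping.single v 1 + smono (S - {v})"
      unfolding insert_Diff[OF v] .
    have "Poly_Mapping.single (smono S) (1::'k)
        = Poly_Mapping.single (smono (S - {v})) 1 \<otimes>\<^bsub>poly_ring V\<^esub> indet v"
      unfolding eq by (simp add: poly_ring_simps(2) indet_def mult_single add.commute)
    moreover have "indet v \<in> (irrelevant_ideal V :: ('v, 'k) mvpoly set)"
      unfolding irrelevant_ideal_def using subsetD[OF R.genideal_self[OF gen] imageI[OF subsetD[OF sub(1) v]]] .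
    moreover have "Poly_Mapping.single (smono (S - {v})) 1 \<in> carrier (poly_ring V :: ('v, 'k) mvpoly ring)"
      using sub(1) \<open>finite S\<close> by (simp add: poly_ring_simps) blast
    ultimately show "Poly_Mapping.single (smono S) 1 \<in> (irrelevant_ideal V :: ('v, 'k) mvpoly set)"
      using ideal.I_l_closed[OF ideal] by simp
  qed (use assms in simp)
qed

lemma nat_ceiling_div_3: "nat \<lceil>real n / 3\<rceil> = (n + 2) div 3"
proof -
  let ?q = "(n + 2) div 3"
  have "3 * ?q + (n + 2) mod 3 = n + 2" "(n + 2) mod 3 < 3"
    by (simp_all add: mult_div_mod_eq)
  then have "3 * ?q \<le> n + 2" "n \<le> 3 * ?q"
    by linarith+
  then have "3 * real ?q \<le> real n + 2" "real n \<le> 3 * real ?q"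
    by linarith+
  then have "\<lceil>real n / 3\<rceil> = int ?q"
    by (intro ceiling_unique) (simp_all add: field_simps)
  then show ?thesis by simp
qed

theorem theorem4p10:
  fixes n k :: nat
    and R :: "(nat, 'k::field) mvpoly ring"
    and I :: "(nat, 'k) mvpoly set"
  assumes "n \<ge> 4" and "2 \<le> k" and "k \<le> n div 2"
    and "R = poly_ring (pverts (cycle_graph n))"
    and "I = edge_ideal (cycle_graph n)"
  shows "depth R (irrelevant_ideal (pverts (cycle_graph n)))
           (quotient_module R (squarefree_power (pverts (cycle_graph n)) I k))
         \<ge> enat (nat \<lceil>real n / 3\<rceil> + k - 1)"
proof -
  obtain j where k: "k = Suc j" and j: "1 \<le> j" using assms(2) by (cases k) auto
  have V: "pverts (cycle_graph n) = {1..n}"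
    by (simp add: cycle_graph_def Let_def)
  let ?X = "irrelevant_ideal {1..n} :: (nat, 'k) mvpoly set"
  define r where "r = (n + 2) div 3 + j"
  define fs where "fs = map (\<lambda>l. esym (Suc l) {1..n} :: (nat, 'k) mvpoly) [0..<r]"
  have arcs: "parcs (cycle_graph n) \<subseteq> pverts (cycle_graph n) \<times> pverts (cycle_graph n)"
    unfolding V using assms(1) by (auto simp: parcs_cycle_graph)
  have loop_free: "(v, v) \<notin> parcs (cycle_graph n)" for v
    using assms(1) by (auto simp: parcs_cycle_graph)
  have J: "squarefree_power {1..n} I k
      = {p \<in> carrier R. \<forall>t\<in>Poly_Mapping.keys p. Poly_Mapping.keys t \<notin> cycle_faces n j}"
  proof -
    have "has_matching (parcs (cycle_graph n)) k (Poly_Mapping.keys t) \<longleftrightarrow> Poly_Mapping.keys t \<notin> cycle_faces n j"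
      if "p \<in> carrier R" "t \<in> Poly_Mapping.keys p" for p and t
      using that unfolding assms(4) V poly_ring_simps cycle_faces_def k by blast
    then show ?thesis
      using squarefree_power_edge_ideal[OF arcs loop_free, of k, where 'k = 'k]
      unfolding assms(5) V assms(4)[unfolded V, symmetric] by blast
  qed
  have down: "B \<in> cycle_faces n j" if "A \<in> cycle_faces n j" "B \<subseteq> A" for A B
    using that has_matching_mono[of _ "Suc j" B A] unfolding cycle_faces_def by blast
  have "order_convex (cycle_faces n j)"
    unfolding order_convex_def using down by blast
  moreover have "good r (cycle_faces n j)"
    by (rule good_cycle_faces[OF j _ r_def]) (use assms(3) k in simp)
  moreover have faces: "\<Union>(cycle_faces n j) \<subseteq> {1..n}"
    unfolding cycle_faces_def by blast
  ultimately have wreg: "wreg (cycle_faces n j) {0} fs"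
    unfolding fs_def by (intro wreg_good) simp_all
  have fs: "set fs \<subseteq> ?X"
    unfolding fs_def using esym_in_irrelevant_ideal[of "{1..n}"] by auto
  have X: "?X \<subseteq> carrier R"
  proof -
    interpret R: cring R unfolding assms(4) by (rule poly_ring_cring)
    have "indet ` {1..n} \<subseteq> carrier R"
      unfolding assms(4) V by (auto simp: poly_ring_simps indet_def)
    then show ?thesis
      using ideal.Icarr[OF R.genideal_ideal] unfolding irrelevant_ideal_def assms(4) V by blast
  qed
  have "depth R ?X (quotient_module R (squarefree_power {1..n} I k)) \<ge> enat (length fs)"
    by (rule depth_ge_wreg[OF down faces assms(4)[unfolded V] J refl wreg fs X])
  moreover have "length fs = nat \<lceil>real n / 3\<rceil> + k - 1"
    by (simp add: fs_def r_def k nat_ceiling_div_3)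
  ultimately show ?thesis unfolding V by simp
qed

end
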